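(* There is a deterministic algorithm that, given $\epsilon>0$ and an $n$-vertex graph $G$ with vertex set $V=V(G)$, outputs, in $\epsilon^{-O(1)}n^2$ time, subsets $S_1,\dots,S_r,T_1,\dots,T_r\subseteq V$ and numbers $c_1,\dots,c_r\in\{-\frac{\epsilon^8}{300},\frac{\epsilon^8}{300}\}$, for some $r=O(\epsilon^{-16})$, such that \[ d_\square\bigl(G,\; d(G)+c_1K_{S_1,T_1}+\dots+c_rK_{S_r,T_r}\bigr)\le \epsilon . \]
   Context: A weighted graph on a finite vertex set $V$ is a graph with real edge-weights, i.e. a symmetric function on $V\times V$ (value $0$ meaning no edge); an ordinary graph is a weighted graph with weights $0,1$. For $X,Y\subseteq V$, $e(X,Y)$ (or $e_G(X,Y)$) is the sum of the weights over all ordered pairs $(x,y)\in X\times Y$, and $d(X,Y)=e(X,Y)/(|X||Y|)$. The edge density of $G$ is $d(G)=d(V,V)$; when $d(G)$ appears as a weighted graph it denotes the constant weighted graph in which every pair $(x,y)\in V\times V$ has weight $d(G)$. Weighted graphs on the same vertex set are added, and multiplied by real scalars, weight by weight. For $S,T\subseteq V$, $K_{S,T}$ is the weighted graph in which $\{s,t\}$ has weight $1$ if $s\in S$ and $t\in T$, weight $2$ if $s,t\in S\cap T$, and weight $0$ otherwise; that is, its matrix is $\mathbf 1_S\mathbf 1_T^\top+\mathbf 1_T\mathbf 1_S^\top$. For weighted graphs $G,H$ on the same vertex set $V$, the cut metric is \[ d_\square(G,H)=\max_{U,W\subseteq V}\frac{|e_G(U,W)-e_H(U,W)|}{|V|^2}.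 \] Running time counts elementary operations (arithmetic operations and comparisons on numbers, memory accesses at unit cost). The bound "$\epsilon^{-O(1)}n^2$ time" means at most $K\max(1,1/\epsilon)^{K}n^2$ operations for an absolute constant $K$; $r=O(\epsilon^{-16})$ means $r\le K\epsilon^{-16}$ for an absolute constant $K$ ($r=0$ is allowed). *)

theory Defs
  imports Complex_Main
begin

section \<open>Weighted graphs and the cut metric\<close>

text \<open>
  A weighted graph on a finite vertex set \<open>V\<close> is a weight function; its values outside
  \<open>V \<times> V\<close> are irrelevant. As weight 1 on the diagonal is not excluded, a graph may have loops.
\<close>

type_synonym 'a wgraph = "'a \<Rightarrow> 'a \<Rightarrow> real"

definition weighted_graph :: "'a set \<Rightarrow> 'a wgraph \<Rightarrow> bool" where
  "weighted_graph V G \<longleftrightarrow> finite V \<and> (\<forall>x\<in>V. \<forall>y\<in>V. G x y = G y x)"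

definition graph :: "'a set \<Rightarrow> 'a wgraph \<Rightarrow> bool" where
  "graph V G \<longleftrightarrow> weighted_graph V G \<and> (\<forall>x\<in>V. \<forall>y\<in>V. G x y \<in> {0, 1})"

definition edge_weight :: "'a wgraph \<Rightarrow> 'a set \<Rightarrow> 'a set \<Rightarrow> real" where
  "edge_weight G X Y = (\<Sum>x\<in>X. \<Sum>y\<in>Y. G x y)"

definition density :: "'a wgraph \<Rightarrow> 'a set \<Rightarrow> 'a set \<Rightarrow> real" where
  "density G X Y = edge_weight G X Y / (real (card X) * real (card Y))"

definition edge_density :: "'a set \<Rightarrow> 'a wgraph \<Rightarrow> real" where
  "edge_density V G = density G V V"

definition K_graph :: "'a set \<Rightarrow> 'a set \<Rightarrow> 'a wgraph" where
  "K_graph S T = (\<lambda>x y. of_bool (x \<in> S \<and> y \<in> T) + of_bool (x \<in> T \<and> y \<in> S))"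

definition cut_dist :: "'a set \<Rightarrow> 'a wgraph \<Rightarrow> 'a wgraph \<Rightarrow> real" where
  "cut_dist V G H =
     Max ((\<lambda>(U, W). \<bar>edge_weight G U W - edge_weight H U W\<bar> / (real (card V))\<^sup>2)
          ` (Pow V \<times> Pow V))"

section \<open>The model of computation\<close>

text \<open>
  A deterministic random access machine over the real numbers, given as a while language.
  The memory consists of infinite arrays of numbers; a program names only finitely many of them,
  so they could be interleaved in a single array. A scalar variable is cell 0 of an array.

  The model is restricted as follows, to avoid hidden computing power:
  \<^item> The only constants are integers, since an arbitrary real constant could carry
    an infinite amount of advice.
  \<^item> There is no rounding operation. An address has to evaluate to a natural number:
    a program accessing any other address (or dividing by 0) is stuck and has no result.
\<close>

type_synonym state = "string \<Rightarrow> nat \<Rightarrow> real"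

datatype expr =
    Const int
  | Read string expr
  | Add expr expr
  | Sub expr expr
  | Mul expr expr
  | Div expr expr

datatype test =
    Less expr expr
  | Equal expr expr
  | Neg test
  | Conj test test

datatype program =
    Skip
  | Write string expr expr  \<comment> \<open>array, address, value\<close>
  | Seq program program
  | IfElse test program program
  | While test program

fun val :: "expr \<Rightarrow> state \<Rightarrow> real" where
  "val (Const k) s = of_int k"
| "val (Read a i) s = s a (nat \<lfloor>val i s\<rfloor>)"
| "val (Add e f) s = val e s + val f s"
| "val (Sub e f) s = val e s - val f s"
| "val (Mul e f) s = val e s * val f s"
| "val (Div e f) s = val e s / val f s"

text \<open>
  The rounding in \<^const>\<open>val\<close> is never effective: the operational semantics below
  evaluates \<open>e\<close> in state \<open>s\<close> only if \<open>defined e s\<close>.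
\<close>

fun defined :: "expr \<Rightarrow> state \<Rightarrow> bool" where
  "defined (Const k) s \<longleftrightarrow> True"
| "defined (Read a i) s \<longleftrightarrow> defined i s \<and> val i s \<in> \<nat>"
| "defined (Add e f) s \<longleftrightarrow> defined e s \<and> defined f s"
| "defined (Sub e f) s \<longleftrightarrow> defined e s \<and> defined f s"
| "defined (Mul e f) s \<longleftrightarrow> defined e s \<and> defined f s"
| "defined (Div e f) s \<longleftrightarrow> defined e s \<and> defined f s \<and> val f s \<noteq> 0"

fun cost :: "expr \<Rightarrow> nat" where
  "cost (Const k) = 1"
| "cost (Read a i) = 1 + cost i"
| "cost (Add e f) = 1 + cost e + cost f"
| "cost (Sub e f) = 1 + cost e + cost f"
| "cost (Mul e f) = 1 + cost e + cost f"
| "cost (Div e f) = 1 + cost e + cost f"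

fun test_val :: "test \<Rightarrow> state \<Rightarrow> bool" where
  "test_val (Less e f) s \<longleftrightarrow> val e s < val f s"
| "test_val (Equal e f) s \<longleftrightarrow> val e s = val f s"
| "test_val (Neg b) s \<longleftrightarrow> \<not> test_val b s"
| "test_val (Conj b c) s \<longleftrightarrow> test_val b s \<and> test_val c s"

fun test_defined :: "test \<Rightarrow> state \<Rightarrow> bool" where
  "test_defined (Less e f) s \<longleftrightarrow> defined e s \<and> defined f s"
| "test_defined (Equal e f) s \<longleftrightarrow> defined e s \<and> defined f s"
| "test_defined (Neg b) s \<longleftrightarrow> test_defined b s"
| "test_defined (Conj b c) s \<longleftrightarrow> test_defined b s \<and> test_defined c s"

fun test_cost :: "test \<Rightarrow> nat" where
  "test_cost (Less e f) = 1 + cost e + cost f"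
| "test_cost (Equal e f) = 1 + cost e + cost f"
| "test_cost (Neg b) = 1 + test_cost b"
| "test_cost (Conj b c) = 1 + test_cost b + test_cost c"

text \<open>
  \<open>run p s t s'\<close>: started in state \<open>s\<close>, the program \<open>p\<close> terminates in state \<open>s'\<close> after
  exactly \<open>t\<close> elementary operations.
\<close>

inductive run :: "program \<Rightarrow> state \<Rightarrow> nat \<Rightarrow> state \<Rightarrow> bool" where
  run_Skip: "run Skip s 1 s"
| run_Write:
    "defined i s \<Longrightarrow> defined e s \<Longrightarrow> val i s = real k \<Longrightarrow>
     run (Write a i e) s (1 + cost i + cost e) (s(a := (s a)(k := val e s)))"
| run_Seq:
    "run p s t s' \<Longrightarrow> run q s' t' s'' \<Longrightarrow> run (Seq p q) s (t + t') s''"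
| run_If_True:
    "test_defined b s \<Longrightarrow> test_val b s \<Longrightarrow> run p s t s' \<Longrightarrow>
     run (IfElse b p q) s (1 + test_cost b + t) s'"
| run_If_False:
    "test_defined b s \<Longrightarrow> \<not> test_val b s \<Longrightarrow> run q s t s' \<Longrightarrow>
     run (IfElse b p q) s (1 + test_cost b + t) s'"
| run_While_False:
    "test_defined b s \<Longrightarrow> \<not> test_val b s \<Longrightarrow>
     run (While b p) s (1 + test_cost b) s"
| run_While_True:
    "test_defined b s \<Longrightarrow> test_val b s \<Longrightarrow> run p s t s' \<Longrightarrow> run (While b p) s' t' s'' \<Longrightarrow>
     run (While b p) s (1 + test_cost b + t + t') s''"

text \<open>The machine is deterministic.\<close>

inductive_cases run_SkipE: "run Skip s t s'"
inductive_cases run_WriteE: "run (Write a i e) s t s'"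
inductive_cases run_SeqE: "run (Seq p q) s t s'"
inductive_cases run_IfElseE: "run (IfElse b p q) s t s'"
inductive_cases run_WhileE: "run (While b p) s t s'"

theorem run_deterministic:
  "run p s t s' \<Longrightarrow> run p s u s'' \<Longrightarrow> u = t \<and> s'' = s'"
proof (induction arbitrary: u s'' rule: run.induct)
  case (run_Skip s)
  then show ?case by (rule run_SkipE) simp
next
  case (run_Write i s e k a)
  from run_Write.prems show ?case
    by (rule run_WriteE) (use run_Write.hyps in simp)
next
  case (run_Seq p s t s' q t' s2)
  from run_Seq.prems show ?case
  proof (rule run_SeqE)
    fix v w r
    assume *: "u = v + w" "run p s v r" "run q r w s''"
    from run_Seq.IH(1)[OF *(2)] have eq: "v = t" "r = s'" by simp_all
    from run_Seq.IH(2)[OF *(3)[unfolded eq]] show ?thesis by (simp add: *(1) eq)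
  qed
next
  case (run_If_True b s p t s' q)
  from run_If_True.prems show ?case
  proof (rule run_IfElseE)
    fix v
    assume "u = Suc (test_cost b + v)" "run p s v s''"
    then show ?thesis using run_If_True.IH[of v s''] by simp
  next
    assume "\<not> test_val b s"
    with run_If_True.hyps show ?thesis by simp
  qed
next
  case (run_If_False b s q t s' p)
  from run_If_False.prems show ?case
  proof (rule run_IfElseE)
    assume "test_val b s"
    with run_If_False.hyps show ?thesis by simp
  next
    fix v
    assume "u = Suc (test_cost b + v)" "run q s v s''"
    then show ?thesis using run_If_False.IH[of v s''] by simp
  qed
next
  case (run_While_False b s p)
  from run_While_False.prems show ?case
    by (rule run_WhileE) (use run_While_False.hyps in auto)
next
  case (run_While_True b s p t s' t' s2)
  from run_While_True.prems show ?case
  proof (rule run_WhileE)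
    assume "\<not> test_val b s"
    with run_While_True.hyps show ?thesis by simp
  next
    fix v r w
    assume *: "u = Suc (test_cost b + v + w)" "run p s v r" "run (While b p) r w s''"
    from run_While_True.IH(1)[OF *(2)] have eq: "v = t" "r = s'" by simp_all
    from run_While_True.IH(2)[OF *(3)[unfolded eq]] show ?thesis by (simp add: *(1) eq)
  qed
qed

section \<open>Input and output\<close>

text \<open>
  An \<open>n\<close>-vertex graph has vertex set \<open>{..<n}\<close> and is given by its adjacency matrix,
  stored row by row. All cells not holding input are initially 0.
\<close>

definition input_state :: "real \<Rightarrow> nat \<Rightarrow> nat wgraph \<Rightarrow> state" where
  "input_state \<epsilon> n G = (\<lambda>a k.
     if a = ''eps'' \<and> k = 0 then \<epsilon>
     else if a = ''n'' \<and> k = 0 then real n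
     else if a = ''G'' \<and> k < n * n then G (k div n) (k mod n)
     else 0)"

text \<open>The sets are output as indicator vectors, the \<open>i\<close>-th one starting at address \<open>i * n\<close>.\<close>

definition outputs ::
  "state \<Rightarrow> nat \<Rightarrow> nat \<Rightarrow> (nat \<Rightarrow> nat set) \<Rightarrow> (nat \<Rightarrow> nat set) \<Rightarrow> (nat \<Rightarrow> real) \<Rightarrow> bool" where
  "outputs s n r S T c \<longleftrightarrow>
     s ''r'' 0 = real r \<and>
     (\<forall>i<r. s ''c'' i = c i \<and>
        (\<forall>v<n. s ''S'' (i * n + v) = of_bool (v \<in> S i) \<and>
               s ''T'' (i * n + v) = of_bool (v \<in> T i)))"

end

theory Submission
  imports Defs "HOL-Analysis.Convex"
begin

text \<open>
  The algorithm maintains the residual matrix \<open>A = G - d(G) - \<Sum>\<^sub>i c\<^sub>i K\<close>. Whenever sets \<open>S, T\<close> with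
  \<open>|A(S,T)| \<ge> 2\<gamma>n\<^sup>2\<close>, \<open>\<gamma> = \<epsilon>\<^sup>8/300\<close>, are known, subtracting \<open>\<plusminus>\<gamma> K\<^bsub>S,T\<^esub>\<close> lowers the squared Frobenius
  norm \<open>\<Sum> A\<^sub>i\<^sub>j\<^sup>2 \<le> n\<^sup>2/4\<close> by at least \<open>4\<gamma>\<^sup>2n\<^sup>2\<close>, so this happens at most \<open>1/(16\<gamma>\<^sup>2) = O(\<epsilon>\<^sup>-\<^sup>1\<^sup>6)\<close> times.

  To find such sets, scale \<open>A\<close> to a symmetric matrix \<open>N\<close> whose rows have norm at most \<open>\<surd>n\<close>. If the
  cut norm of \<open>A\<close> exceeds \<open>\<epsilon>n\<^sup>2\<close>, then a typical row \<open>N\<^sub>q\<close> correlates with the large part of the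
  spectrum: \<open>N\<^sup>2N\<^sub>q\<close> is long, while \<open>N N\<^sub>q\<close> has entries at most \<open>n\<close>. Two rounds of taking signs
  then turn \<open>N N\<^sub>q\<close> into sets \<open>S, T\<close>, in \<open>O(n\<^sup>2)\<close> time for each \<open>q\<close>.

  A good \<open>q\<close> is found deterministically among \<open>\<epsilon>\<^sup>-\<^sup>O\<^sup>(\<^sup>1\<^sup>)\<close> candidates: it suffices that these represent
  \<open>\<Sum>\<^sub>i N\<^sub>iN\<^sub>i\<^sup>T\<close> up to a Frobenius error \<open>O(\<epsilon>\<^sup>2n\<^sup>2)\<close>. Starting from all rows, one row is chosen from each
  consecutive pair and its weight doubled. Within a batch of \<open>b\<close> pairs the choices are made
  greedily, such that the errors behave like orthogonal vectors, which gives relative error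
  \<open>O(1/\<surd>b)\<close> in time \<open>O(b n)\<close> per pair. As the list is halved each time, \<open>b\<close> can grow
  geometrically, and both the total error and the total time are geometric sums.
\<close>

section \<open>Running time of programs\<close>

text \<open>The machine has no square roots. The scaled matrix \<open>N\<close> is therefore never
  formed: the program uses only squared inner products of its rows, in which the roots of the
  weights cancel, and signs, which ignore positive factors. No eigenvector is computed either; the
  rows themselves serve as start vectors, and a fixed number of products with \<open>N\<close>
  replaces power iteration. A row \<open>N_q\<close> has no useful bound on its entries. One product
  with \<open>N\<close> provides one, because all rows of \<open>N\<close> are short, and only then
  can the vector be traded for signs.

  The exponents arise as follows. A large cut yields a vector \<open>w\<close> with
  \<open>|N w|^2 \<ge> \<rho> |w|^2\<close> for \<open>\<rho> = \<epsilon>^2 n^2 / 4\<close>. Some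
  sampled row then has \<open>|N^2 N_q|^2 \<ge> \<rho>^3 / (4 n)\<close>, and rounding it gives sets
  with \<open>|A(S,T)| \<ge> \<epsilon>^6 n^2 / 512\<close>. For \<open>\<epsilon> < 1/2\<close>
  this exceeds the threshold \<open>\<epsilon>^8 n^2 / 150\<close>.

  An update relies on the measured cut value alone, not on the analysis of the sample; this is why a
  round may continue with outdated weights.\<close>

definition wp :: "program \<Rightarrow> real \<Rightarrow> (state \<Rightarrow> bool) \<Rightarrow> state \<Rightarrow> bool" where
  "wp p T Q s \<longleftrightarrow> (\<exists>t s'. run p s t s' \<and> real t \<le> T \<and> Q s')"

lemma wp_mono:
  assumes "wp p T Q s" "T \<le> T'" "\<And>s'. Q s' \<Longrightarrow> Q' s'"
  shows "wp p T' Q' s"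
  using assms unfolding wp_def by (meson order_trans)

lemma wp_Skip: "1 \<le> T \<Longrightarrow> Q s \<Longrightarrow> wp Skip T Q s"
  unfolding wp_def using run_Skip by fastforce

lemma wp_Write:
  assumes "defined i s" "defined e s" "val i s = real k"
    and "Q (s(a := (s a)(k := val e s)))" "real (1 + cost i + cost e) \<le> T"
  shows "wp (Write a i e) T Q s"
  unfolding wp_def using run_Write[OF assms(1-3), of a] assms(4,5) by blast

lemma wp_Seq:
  assumes "wp p T1 (\<lambda>s'. wp q T2 Q s') s" "T1 + T2 \<le> T"
  shows "wp (Seq p q) T Q s"
proof -
  obtain t s' t' s'' where *: "run p s t s'" "real t \<le> T1" "run q s' t' s''" "real t' \<le> T2" "Q s''"
    using assms(1) unfolding wp_def by blast
  have "real (t + t') \<le> T" using * assms(2) by simp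
  then show ?thesis unfolding wp_def using run_Seq[OF *(1,3)] *(5) by blast
qed

lemma wp_IfElse:
  assumes "test_defined b s"
    and "test_val b s \<Longrightarrow> wp p T1 Q s" "\<not> test_val b s \<Longrightarrow> wp q T1 Q s"
    and "real (1 + test_cost b) + T1 \<le> T"
  shows "wp (IfElse b p q) T Q s"
proof (cases "test_val b s")
  case True
  then obtain t s' where *: "run p s t s'" "real t \<le> T1" "Q s'"
    using assms(2) unfolding wp_def by blast
  have "real (1 + test_cost b + t) \<le> T" using * assms(4) by simp
  then show ?thesis unfolding wp_def using run_If_True[OF assms(1) True *(1)] *(3) by blast
next
  case False
  then obtain t s' where *: "run q s t s'" "real t \<le> T1" "Q s'"
    using assms(3) unfolding wp_def by blast
  have "real (1 + test_cost b + t) \<le> T" using * assms(4) by simp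
  then show ?thesis unfolding wp_def using run_If_False[OF assms(1) False *(1)] *(3) by blast
qed

text \<open>The potential \<open>\<tau>\<close> bounds the remaining running time; as every iteration costs at least 1,
  it also proves termination.\<close>

lemma wp_While:
  assumes "I s"
    and defd: "\<And>s. I s \<Longrightarrow> test_defined b s \<and> real (1 + test_cost b) \<le> \<tau> s"
    and body: "\<And>s. I s \<Longrightarrow> test_val b s \<Longrightarrow>
      wp p (T s) (\<lambda>s'. I s' \<and> real (1 + test_cost b) + T s + \<tau> s' \<le> \<tau> s) s"
    and exit: "\<And>s. I s \<Longrightarrow> \<not> test_val b s \<Longrightarrow> Q s"
    and "\<tau> s \<le> T'"
  shows "wp (While b p) T' Q s"
proof -
  have "wp (While b p) (\<tau> s) Q s" using \<open>I s\<close>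
  proof (induction "nat \<lfloor>\<tau> s\<rfloor>" arbitrary: s rule: less_induct)
    case less
    show ?case
    proof (cases "test_val b s")
      case True
      from body[OF less.prems True] obtain t s' where
        *: "run p s t s'" "real t \<le> T s" "I s'" "real (1 + test_cost b) + T s + \<tau> s' \<le> \<tau> s"
        unfolding wp_def by blast
      have "\<tau> s' \<ge> 1" using defd[OF *(3)] by simp
      moreover have "\<tau> s' + 1 \<le> \<tau> s" using *(2,4) by simp
      ultimately have "nat \<lfloor>\<tau> s'\<rfloor> < nat \<lfloor>\<tau> s\<rfloor>" by linarith
      from less.hyps[OF this *(3)] obtain t' s'' where
        **: "run (While b p) s' t' s''" "real t' \<le> \<tau> s'" "Q s''"
        unfolding wp_def by blast
      have "real (1 + test_cost b + t + t') \<le> \<tau> s" using * ** by simp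
      then show ?thesis unfolding wp_def
        using run_While_True[OF conjunct1[OF defd[OF less.prems]] True *(1) **(1)] **(3) by blast
    next
      case False
      then show ?thesis unfolding wp_def
        using run_While_False[OF conjunct1[OF defd[OF less.prems]] False] defd[OF less.prems]
          exit[OF less.prems] by blast
    qed
  qed
  then show ?thesis using wp_mono assms(5) by blast
qed

section \<open>Counting loops and row-major addresses\<close>

abbreviation V :: "string \<Rightarrow> expr" where
  "V x \<equiv> Read x (Const 0)"

abbreviation Assign :: "string \<Rightarrow> expr \<Rightarrow> program" where
  "Assign x e \<equiv> Write x (Const 0) e"

definition For :: "string \<Rightarrow> expr \<Rightarrow> string \<Rightarrow> program \<Rightarrow> program" where
  "For i e N p = Seq (Assign i e) (While (Less (V i) (V N)) (Seq p (Assign i (Add (V i) (Const 1)))))"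

abbreviation upd :: "state \<Rightarrow> string \<Rightarrow> nat \<Rightarrow> real \<Rightarrow> state" where
  "upd s a k x \<equiv> s(a := (s a)(k := x))"

definition agree :: "string set \<Rightarrow> state \<Rightarrow> state \<Rightarrow> bool" where
  "agree X s s' \<longleftrightarrow> (\<forall>a. a \<notin> X \<longrightarrow> s' a = s a)"

text \<open>The counter is part of the state, so the body has to establish the invariant for the
  state after the increment. Each iteration adds 6 operations for the test and 6 for the increment,
  hence \<open>B + 12\<close>.\<close>

lemma wp_For:
  fixes B :: real
  assumes e: "defined e s" "val e s = real a"
    and N: "\<And>k s'. a \<le> k \<Longrightarrow> k \<le> n \<Longrightarrow> I k s' \<Longrightarrow> s' N 0 = real n"
    and i: "\<And>k s'. a \<le> k \<Longrightarrow> k \<le> n \<Longrightarrow> I k s' \<Longrightarrow> s' i 0 = real k"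
    and "a \<le> n"
    and init: "I a (upd s i 0 (real a))"
    and body: "\<And>k s'. a \<le> k \<Longrightarrow> k < n \<Longrightarrow> I k s' \<Longrightarrow> s' i 0 = real k \<Longrightarrow> s' N 0 = real n \<Longrightarrow>
        wp p B (\<lambda>s''. s'' i 0 = real k \<and> I (Suc k) (upd s'' i 0 (real (Suc k)))) s'"
    and T: "(B + 12) * (real n - real a) + 10 + real (cost e) \<le> T"
    and Q: "\<And>s'. I n s' \<Longrightarrow> Q s'"
  shows "wp (For i e N p) T Q s"
proof -
  define J where "J s' \<longleftrightarrow> (\<exists>k. a \<le> k \<and> k \<le> n \<and> I k s')" for s' :: state
  define \<tau> where "\<tau> s' = (B + 12) * (real n - s' i 0) + 6" for s' :: state
  have W: "wp (While (Less (V i) (V N)) (Seq p (Assign i (Add (V i) (Const 1)))))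
      (\<tau> (upd s i 0 (real a))) Q (upd s i 0 (real a))"
  proof (rule wp_While[where I = J and \<tau> = \<tau> and T = "\<lambda>_. B + 6"])
    show "J (upd s i 0 (real a))" unfolding J_def using init \<open>a \<le> n\<close> by blast
  next
    fix s' assume "J s'"
    then obtain k where k: "a \<le> k" "k \<le> n" "I k s'" unfolding J_def by blast
    \<comment> \<open>While an iteration remains, its run takes a natural number of operations
      bounded by \<open>B\<close>, so \<open>0 \<le> B\<close>. At \<open>k = n\<close> the product
      vanishes.\<close>
    have "0 \<le> (B + 12) * (real n - real k)"
    proof (cases "k = n")
      case False
      then have "k < n" using k by simp
      from body[OF k(1) this k(3) i[OF k] N[OF k]] have "0 \<le> B" unfolding wp_def
        by (meson of_nat_0_le_iff order_trans)
      then show ?thesis using k by simp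
    qed simp
    then show "test_defined (Less (V i) (V N)) s' \<and> real (1 + test_cost (Less (V i) (V N))) \<le> \<tau> s'"
      using i[OF k] by (simp add: \<tau>_def)
  next
    fix s' assume "J s'" and t: "test_val (Less (V i) (V N)) s'"
    then obtain k where k: "a \<le> k" "k \<le> n" "I k s'" unfolding J_def by blast
    note ik = i[OF k] and nk = N[OF k]
    have kn: "k < n" using t ik nk by simp
    show "wp (Seq p (Assign i (Add (V i) (Const 1)))) (B + 6)
        (\<lambda>s''. J s'' \<and> real (1 + test_cost (Less (V i) (V N))) + (B + 6) + \<tau> s'' \<le> \<tau> s') s'"
    proof (rule wp_Seq)
      show "wp p B (\<lambda>s''. wp (Assign i (Add (V i) (Const 1))) 6
        (\<lambda>s''. J s'' \<and> real (1 + test_cost (Less (V i) (V N))) + (B + 6) + \<tau> s'' \<le> \<tau> s') s'') s'"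
      proof (rule wp_mono[OF body[OF k(1) kn k(3) ik nk] order_refl])
        fix s'' assume *: "s'' i 0 = real k \<and> I (Suc k) (upd s'' i 0 (real (Suc k)))"
        then have "J (upd s'' i 0 (real (Suc k)))" unfolding J_def using kn k(1) by (meson Suc_leI le_SucI)
        moreover have "real (Suc k) = 1 + real k" by simp
        ultimately show "wp (Assign i (Add (V i) (Const 1))) 6
          (\<lambda>s''. J s'' \<and> real (1 + test_cost (Less (V i) (V N))) + (B + 6) + \<tau> s'' \<le> \<tau> s') s''"
          using * ik by (intro wp_Write[where k = 0]) (auto simp: \<tau>_def algebra_simps)
      qed
    qed simp
  next
    fix s' assume "J s'" and t: "\<not> test_val (Less (V i) (V N)) s'"
    then obtain k where k: "a \<le> k" "k \<le> n" "I k s'" unfolding J_def by blast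
    then have "k = n" using t i[OF k] N[OF k] by simp
    then show "Q s'" using Q k by simp
  qed simp
  show ?thesis unfolding For_def
    by (rule wp_Seq[where ?T1.0 = "2 + real (cost e)" and ?T2.0 = "(B + 12) * (real n - real a) + 6"],
        rule wp_Write[where k = 0])
       (use e W T in \<open>auto simp: \<tau>_def\<close>)
qed

text \<open>\<open>val\<close> passes every address through a floor and \<open>nat\<close>. These
  rules and the next ones resolve row-major accesses and the pair indices \<open>2 * k\<close>,
  \<open>2 * k + 1\<close>.\<close>

lemma floor_address [simp]:
  "\<lfloor>real i * real n\<rfloor> = int (i * n)" "\<lfloor>2 * real k\<rfloor> = int (2 * k)"
proof -
  have "real i * real n = real (i * n)" "2 * real k = real (2 * k)" by simp_all
  then show "\<lfloor>real i * real n\<rfloor> = int (i * n)" "\<lfloor>2 * real k\<rfloor> = int (2 * k)"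
    by (metis floor_of_nat)+
qed

lemma nat_address [simp]:
  "nat (int i * int n) = i * n" "nat (int i * int n + int j) = i * n + j"
  "nat (2 * int k) = 2 * k" "nat (2 * int k + 1) = 2 * k + 1"
  by (simp_all add: nat_mult_distrib nat_add_distrib)

abbreviation Idx :: "string \<Rightarrow> string \<Rightarrow> expr" where
  "Idx i j \<equiv> Add (Mul (V i) (V ''n'')) (V j)"

definition SumTo :: "string \<Rightarrow> string \<Rightarrow> string \<Rightarrow> expr \<Rightarrow> program" where
  "SumTo acc k N e = Seq (Assign acc (Const 0)) (For k (Const 0) N (Assign acc (Add (V acc) e)))"

lemma wp_SumTo:
  assumes N: "s N 0 = real n" and d: "acc \<noteq> k" "N \<noteq> acc" "N \<noteq> k"
    and e: "\<And>i s'. i < n \<Longrightarrow> agree {acc, k} s s' \<Longrightarrow> s' k 0 = real i \<Longrightarrow> defined e s' \<and> val e s' = g i"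
    and Q: "\<And>s'. agree {acc, k} s s' \<Longrightarrow> s' acc 0 = (\<Sum>i<n. g i) \<Longrightarrow> Q s'"
    and T: "(real (cost e) + 17) * real n + 15 \<le> T"
  shows "wp (SumTo acc k N e) T Q s"
  unfolding SumTo_def
proof (rule wp_Seq, rule wp_Write[where k = 0])
  let ?I = "\<lambda>j s'. agree {acc, k} s s' \<and> s' k 0 = real j \<and> s' acc 0 = (\<Sum>i<j. g i)"
  let ?B = "5 + real (cost e)"
  show "wp (For k (Const 0) N (Assign acc (Add (V acc) e))) ((?B + 12) * real n + 11) Q
    (upd s acc 0 (val (Const 0) s))"
  proof (rule wp_For[where I = ?I and a = 0 and n = n and B = ?B])
    fix j s' assume j: "0 \<le> j" "j < n" "?I j s'" "s' k 0 = real j" "s' N 0 = real n"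
    have "agree {acc, k} s s'" using j(3) by simp
    note * = e[OF j(2) this j(4)]
    show "wp (Assign acc (Add (V acc) e)) ?B
      (\<lambda>s''. s'' k 0 = real j \<and> ?I (Suc j) (upd s'' k 0 (real (Suc j)))) s'"
      by (rule wp_Write[where k = 0]) (use * j d in \<open>auto simp: agree_def\<close>)
  qed (use N d Q in \<open>auto simp: agree_def\<close>)
qed (use T in \<open>auto simp: algebra_simps\<close>)

section \<open>Certifying that all cuts are small\<close>

definition sq :: "nat \<Rightarrow> (nat \<Rightarrow> real) \<Rightarrow> real" where
  "sq n v = (\<Sum>i<n. (v i)\<^sup>2)"

definition mv :: "nat \<Rightarrow> (nat \<Rightarrow> nat \<Rightarrow> real) \<Rightarrow> (nat \<Rightarrow> real) \<Rightarrow> nat \<Rightarrow> real" where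
  "mv n M v i = (\<Sum>j<n. M i j * v j)"

lemma sq_nonneg: "0 \<le> sq n v"
  unfolding sq_def by (simp add: sum_nonneg)

lemma inner_le_sq: "(\<Sum>i<n. v i * w i)\<^sup>2 \<le> sq n v * sq n w"
  unfolding sq_def by (rule Cauchy_Schwarz_ineq_sum)

lemma mv_le_row: "(mv n M v i)\<^sup>2 \<le> sq n (M i) * sq n v"
  unfolding mv_def by (rule inner_le_sq)

lemma sq_mv_le: "sq n (mv n M v) \<le> (\<Sum>i<n. sq n (M i)) * sq n v"
  unfolding sq_def[of n "mv n M v"] sum_distrib_right by (intro sum_mono mv_le_row)

lemma mv_adjoint:
  assumes "\<And>i j. i < n \<Longrightarrow> j < n \<Longrightarrow> M i j = M j i"
  shows "(\<Sum>i<n. mv n M v i * w i) = (\<Sum>i<n. v i * mv n M w i)"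
proof -
  have "(\<Sum>i<n. mv n M v i * w i) = (\<Sum>i<n. \<Sum>j<n. M i j * v j * w i)"
    by (simp add: mv_def sum_distrib_right)
  also have "\<dots> = (\<Sum>j<n. \<Sum>i<n. M i j * v j * w i)" by (rule sum.swap)
  also have "\<dots> = (\<Sum>j<n. v j * mv n M w j)"
    unfolding mv_def sum_distrib_left by (intro sum.cong refl) (use assms in auto)
  finally show ?thesis .
qed

text \<open>The moments \<open>|M\<^sup>k v|\<^sup>2\<close> are log-convex, so the quotient of the first two bounds all later ones.\<close>

lemma moment_growth:
  assumes sym: "\<And>i j. i < n \<Longrightarrow> j < n \<Longrightarrow> M i j = M j i"
    and "0 < \<rho>" "0 < sq n v" "\<rho> * sq n v \<le> sq n (mv n M v)"
  shows "\<rho> * sq n (mv n M v) \<le> sq n (mv n M (mv n M v))"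
proof -
  let ?w = "mv n M v"
  have "(sq n ?w)\<^sup>2 = (\<Sum>i<n. v i * mv n M ?w i)\<^sup>2"
    unfolding sq_def by (simp add: power2_eq_square mv_adjoint[OF sym, symmetric])
  also have "\<dots> \<le> sq n v * sq n (mv n M ?w)" by (rule inner_le_sq)
  finally have *: "sq n ?w * sq n ?w \<le> sq n v * sq n (mv n M ?w)" by (simp add: power2_eq_square)
  have "sq n v * (\<rho> * sq n ?w) = (\<rho> * sq n v) * sq n ?w" by simp
  also have "\<dots> \<le> sq n ?w * sq n ?w" using assms(4) sq_nonneg by (intro mult_right_mono)
  finally have "sq n v * (\<rho> * sq n ?w) \<le> sq n v * sq n (mv n M ?w)" using * by linarith
  then show ?thesis using assms(3) by simp
qed

text \<open>For symmetric \<open>N\<close> and \<open>i < n\<close> this is the squared norm of row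
  \<open>i\<close> of the cube of \<open>N\<close>.\<close>

definition row_energy :: "nat \<Rightarrow> (nat \<Rightarrow> nat \<Rightarrow> real) \<Rightarrow> nat \<Rightarrow> real" where
  "row_energy n N i = sq n (mv n N (mv n N (N i)))"

text \<open>Averaging. For \<open>v2 = N^2 w\<close> symmetry moves both factors \<open>N\<close>
  from \<open>w\<close> to the row: entry \<open>i\<close> of \<open>N v2\<close> is the inner
  product of \<open>N^2 N_i\<close> with \<open>w\<close>, so the row energies bound
  \<open>|N v2|^2\<close>. The moments give \<open>|N v2|^2 \<ge> \<rho>^3 |w|^2\<close>. Passing to
  the sample loses a factor 2, and its total weight is at most \<open>2 n\<close>; this is the
  denominator \<open>4 n\<close>.\<close>

lemma informative_row:
  fixes N :: "nat \<Rightarrow> nat \<Rightarrow> real" and P :: "nat \<Rightarrow> nat"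
  assumes sym: "\<And>i j. i < n \<Longrightarrow> j < n \<Longrightarrow> N i j = N j i"
    and "0 < \<rho>" "0 < sq n w" "\<rho> * sq n w \<le> sq n (mv n N w)"
    and approx: "\<And>v. \<bar>W * (\<Sum>l<L. (mv n N v (P l))\<^sup>2) - sq n (mv n N v)\<bar> \<le> \<rho> / 2 * sq n v"
    and "0 < W" "W * real L \<le> 2 * real n" "0 < n"
  shows "\<exists>l<L. \<rho> ^ 3 / (4 * real n) \<le> row_energy n N (P l)"
proof -
  define v1 where "v1 = mv n N w"
  define v2 where "v2 = mv n N v1"
  have m1: "\<rho> * sq n w \<le> sq n v1" unfolding v1_def by fact
  have p1: "0 < sq n v1" using m1 assms(2,3) by (meson less_le_trans mult_pos_pos)
  have m2: "\<rho> * sq n v1 \<le> sq n v2" unfolding v1_def v2_def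
    by (rule moment_growth[OF sym assms(2-4)])
  have m3: "\<rho> * sq n v2 \<le> sq n (mv n N v2)" unfolding v2_def
    by (rule moment_growth[OF sym assms(2) p1]) (use m2 in \<open>simp_all add: v2_def\<close>)
  have row: "(mv n N v2 i)\<^sup>2 \<le> row_energy n N i * sq n w" for i
  proof -
    have "mv n N v2 i = (\<Sum>j<n. N i j * mv n N v1 j)" unfolding v2_def by (simp add: mv_def[of n N "mv n N v1"])
    also have "\<dots> = (\<Sum>j<n. mv n N (N i) j * mv n N w j)"
      using mv_adjoint[where v = "N i" and w = v1, OF sym] by (simp add: v1_def)
    also have "\<dots> = (\<Sum>j<n. mv n N (mv n N (N i)) j * w j)"
      using mv_adjoint[where v = "mv n N (N i)" and w = w, OF sym] by simp
    finally show ?thesis unfolding row_energy_def using inner_le_sq by simp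
  qed
  have "\<rho> / 2 * sq n v2 \<le> W * (\<Sum>l<L. (mv n N v2 (P l))\<^sup>2)"
    using approx[of v2] m3 unfolding abs_le_iff by linarith
  also have "\<dots> \<le> W * (\<Sum>l<L. row_energy n N (P l) * sq n w)"
    using row \<open>0 < W\<close> by (intro mult_left_mono sum_mono) auto
  also have "\<dots> = W * (\<Sum>l<L. row_energy n N (P l)) * sq n w" by (simp add: sum_distrib_right)
  finally have "\<rho> / 2 * sq n v2 \<le> W * (\<Sum>l<L. row_energy n N (P l)) * sq n w" .
  moreover have "\<rho> / 2 * (\<rho> * (\<rho> * sq n w)) \<le> \<rho> / 2 * sq n v2"
    using m1 m2 \<open>0 < \<rho>\<close> by (intro mult_left_mono) (auto intro: order_trans[rotated])
  ultimately have "\<rho> ^ 3 / 2 * sq n w \<le> W * (\<Sum>l<L. row_energy n N (P l)) * sq n w"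
    by (simp add: power3_eq_cube)
  then have sum: "\<rho> ^ 3 / 2 \<le> W * (\<Sum>l<L. row_energy n N (P l))" using \<open>0 < sq n w\<close> by simp
  show ?thesis
  proof (rule ccontr)
    assume "\<not> ?thesis"
    then have less: "\<And>l. l < L \<Longrightarrow> row_energy n N (P l) < \<rho> ^ 3 / (4 * real n)" by force
    have "L > 0" using sum \<open>0 < \<rho>\<close> by (cases L) auto
    have "(\<Sum>l<L. row_energy n N (P l)) < (\<Sum>l<L. \<rho> ^ 3 / (4 * real n))"
      using less \<open>L > 0\<close> by (intro sum_strict_mono) auto
    then have "W * (\<Sum>l<L. row_energy n N (P l)) < W * (real L * (\<rho> ^ 3 / (4 * real n)))"
      using \<open>0 < W\<close> by (intro mult_strict_left_mono) auto
    then have "W * (\<Sum>l<L. row_energy n N (P l)) < W * real L * (\<rho> ^ 3 / (4 * real n))"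
      by (simp only: mult.assoc)
    also have "\<dots> \<le> 2 * real n * (\<rho> ^ 3 / (4 * real n))"
      using assms(7) \<open>0 < \<rho>\<close> by (intro mult_right_mono) auto
    also have "\<dots> = \<rho> ^ 3 / 2" using \<open>0 < n\<close> by simp
    finally show False using sum by simp
  qed
qed

text \<open>
  With \<open>w\<^sub>i = 1/(1 + |A\<^sub>i|\<^sup>2/n)\<close>, scaling by \<open>\<surd>w\<close> bounds all rows, and it costs only a constant factor
  of the cut norm because \<open>\<Sum>\<^sub>i 1/w\<^sub>i \<le> 2n\<close>. The weight 0 beyond \<open>n\<close> allows one to pad the list of
  rows to a power of 2.
\<close>

definition weight :: "nat \<Rightarrow> (nat \<Rightarrow> nat \<Rightarrow> real) \<Rightarrow> nat \<Rightarrow> real" where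
  "weight n A i = (if i < n then real n / (real n + sq n (A i)) else 0)"

definition normalized :: "nat \<Rightarrow> (nat \<Rightarrow> nat \<Rightarrow> real) \<Rightarrow> nat \<Rightarrow> nat \<Rightarrow> real" where
  "normalized n A i j = sqrt (weight n A i) * A i j * sqrt (weight n A j)"

lemma weight_pos: "i < n \<Longrightarrow> 0 < weight n A i"
  using sq_nonneg[of n "A i"] by (simp add: weight_def divide_pos_pos add_pos_nonneg)

lemma weight_nonneg: "0 \<le> weight n A i"
  using sq_nonneg[of n "A i"] by (simp add: weight_def)

lemma weight_le_1: "weight n A i \<le> 1"
  using sq_nonneg[of n "A i"] by (simp add: weight_def)

text \<open>By construction \<open>1 / weight n A i = 1 + |A_i|^2 / n\<close>, whose sum is at most
  \<open>n + n / 4\<close>.\<close>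

lemma sum_inverse_weight:
  assumes "Z \<subseteq> {..<n}" "(\<Sum>i<n. sq n (A i)) \<le> (real n)\<^sup>2 / 4"
  shows "(\<Sum>i\<in>Z. 1 / weight n A i) \<le> 2 * real n"
proof -
  have "(\<Sum>i\<in>Z. 1 / weight n A i) \<le> (\<Sum>i<n. 1 / weight n A i)"
    using assms(1) by (intro sum_mono2) (auto simp: weight_nonneg)
  also have "\<dots> = (\<Sum>i<n. 1 + sq n (A i) / real n)"
    by (intro sum.cong) (auto simp: weight_def add_divide_distrib)
  also have "\<dots> = real n + (\<Sum>i<n. sq n (A i)) / real n"
    by (simp add: sum.distrib sum_divide_distrib)
  also have "\<dots> \<le> real n + ((real n)\<^sup>2 / 4) / real n"
    using assms(2) by (intro add_left_mono divide_right_mono) auto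
  also have "\<dots> \<le> 2 * real n" by (simp add: power2_eq_square)
  finally show ?thesis .
qed

text \<open>The row factor alone gives \<open>n |A_i|^2 / (n + |A_i|^2)\<close>, at most
  \<open>n\<close>; the column factors are at most 1.\<close>

lemma sq_normalized_le: "sq n (normalized n A i) \<le> real n"
proof (cases "i < n")
  case True
  have "sq n (normalized n A i) \<le> (\<Sum>j<n. weight n A i * (A i j)\<^sup>2)"
    unfolding sq_def normalized_def
  proof (intro sum_mono)
    fix j assume "j \<in> {..<n}"
    have "(sqrt (weight n A i) * A i j * sqrt (weight n A j))\<^sup>2
        = weight n A i * (A i j)\<^sup>2 * weight n A j"
      by (simp add: power_mult_distrib weight_nonneg)
    also have "\<dots> \<le> weight n A i * (A i j)\<^sup>2 * 1"
      by (intro mult_left_mono weight_le_1) (simp add: weight_nonneg)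
    finally show "(sqrt (weight n A i) * A i j * sqrt (weight n A j))\<^sup>2 \<le> weight n A i * (A i j)\<^sup>2"
      by simp
  qed
  also have "\<dots> = weight n A i * sq n (A i)" by (simp add: sq_def sum_distrib_left)
  also have "\<dots> \<le> real n"
  proof -
    have "real n * sq n (A i) \<le> real n * (real n + sq n (A i))" by (simp add: distrib_left)
    then show ?thesis using True sq_nonneg[of n "A i"]
      by (simp add: weight_def divide_le_eq add_pos_nonneg)
  qed
  finally show ?thesis .
qed (simp add: sq_def normalized_def weight_def)

lemma sum_sq_normalized_le: "(\<Sum>i<n. sq n (normalized n A i)) \<le> (\<Sum>i<n. sq n (A i))"
proof (intro sum_mono, unfold sq_def, intro sum_mono)
  fix i j
  have "(normalized n A i j)\<^sup>2 = weight n A i * weight n A j * (A i j)\<^sup>2"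
    by (simp add: normalized_def power_mult_distrib weight_nonneg)
  also have "\<dots> \<le> 1 * (A i j)\<^sup>2"
    by (intro mult_right_mono mult_le_one weight_le_1 weight_nonneg) simp
  finally show "(normalized n A i j)\<^sup>2 \<le> (A i j)\<^sup>2" by simp
qed

text \<open>Dividing the indicators by \<open>sqrt (weight n A i)\<close> cancels the scaling, so
  the bilinear form of the normalized matrix at \<open>p U\<close> and \<open>p Z\<close> is
  \<open>edge_weight A U Z\<close>. Both vectors have squared norm at most \<open>2 n\<close>, only
  twice the bound for plain indicators, and Cauchy-Schwarz leaves a large image of
  \<open>p Z\<close>.\<close>

lemma cut_moment:
  assumes "(\<Sum>i<n. sq n (A i)) \<le> (real n)\<^sup>2 / 4" "U \<subseteq> {..<n}" "Z \<subseteq> {..<n}"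
    and "0 < \<epsilon>" "0 < n" and cut: "\<epsilon> * (real n)\<^sup>2 < \<bar>edge_weight A U Z\<bar>"
  shows "\<exists>w. 0 < sq n w \<and> \<epsilon>\<^sup>2 * (real n)\<^sup>2 / 4 * sq n w \<le> sq n (mv n (normalized n A) w)"
proof -
  define u where "u i = sqrt (weight n A i)" for i
  have u: "0 < u i" "(u i)\<^sup>2 = weight n A i" if "i < n" for i
    using weight_pos[OF that, of A] by (auto simp: u_def)
  define p where "p X i = (if i \<in> X then 1 / u i else 0)" for X :: "nat set" and i
  have sqp: "sq n (p X) \<le> 2 * real n" if "X \<subseteq> {..<n}" for X
  proof -
    have "sq n (p X) = (\<Sum>i\<in>X. 1 / weight n A i)" unfolding sq_def p_def
      using that u by (intro sum.mono_neutral_cong_right) (auto simp: power_divide)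
    then show ?thesis using sum_inverse_weight[OF that assms(1)] by simp
  qed
  let ?N = "normalized n A"
  have "(\<Sum>i<n. p U i * mv n ?N (p Z) i) = (\<Sum>i\<in>U. \<Sum>j\<in>Z. A i j)"
    unfolding p_def mv_def sum_distrib_left
  proof (rule sum.mono_neutral_cong_right)
    fix i assume "i \<in> U"
    then have "i < n" using assms(2) by auto
    show "(\<Sum>j<n. (if i \<in> U then 1 / u i else 0) * (?N i j * (if j \<in> Z then 1 / u j else 0)))
      = (\<Sum>j\<in>Z. A i j)"
    proof (rule sum.mono_neutral_cong_right)
      fix j assume "j \<in> Z"
      then have "j < n" using assms(3) by auto
      then show "(if i \<in> U then 1 / u i else 0) * (?N i j * (if j \<in> Z then 1 / u j else 0)) = A i j"
        using u(1)[OF \<open>i < n\<close>] u(1)[OF \<open>j < n\<close>] \<open>i \<in> U\<close> \<open>j \<in> Z\<close>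
        by (simp add: normalized_def u_def[symmetric])
    qed (use assms(3) in auto)
  qed (use assms(2) in auto)
  then have e: "edge_weight A U Z = (\<Sum>i<n. p U i * mv n ?N (p Z) i)" by (simp add: edge_weight_def)
  have "(\<epsilon> * (real n)\<^sup>2)\<^sup>2 \<le> (edge_weight A U Z)\<^sup>2"
    using cut assms(4) by (intro abs_le_square_iff[THEN iffD1]) auto
  also have "\<dots> \<le> sq n (p U) * sq n (mv n ?N (p Z))" unfolding e by (rule inner_le_sq)
  also have "\<dots> \<le> 2 * real n * sq n (mv n ?N (p Z))"
    by (intro mult_right_mono sqp assms sq_nonneg)
  finally have "(\<epsilon> * (real n)\<^sup>2)\<^sup>2 \<le> 2 * real n * sq n (mv n ?N (p Z))" .
  moreover have "(\<epsilon> * (real n)\<^sup>2)\<^sup>2 = real n * (\<epsilon>\<^sup>2 * (real n) ^ 3)"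
    by (simp add: power2_eq_square power3_eq_cube)
  ultimately have "real n * (\<epsilon>\<^sup>2 * (real n) ^ 3 / 2) \<le> real n * sq n (mv n ?N (p Z))" by simp
  then have m1: "\<epsilon>\<^sup>2 * (real n) ^ 3 / 2 \<le> sq n (mv n ?N (p Z))" using \<open>0 < n\<close> by simp
  have "\<epsilon>\<^sup>2 * (real n)\<^sup>2 / 4 * sq n (p Z) \<le> \<epsilon>\<^sup>2 * (real n)\<^sup>2 / 4 * (2 * real n)"
    by (intro mult_left_mono sqp assms) simp
  also have "\<dots> = \<epsilon>\<^sup>2 * (real n) ^ 3 / 2" by (simp add: power2_eq_square power3_eq_cube)
  also note m1
  finally have "\<epsilon>\<^sup>2 * (real n)\<^sup>2 / 4 * sq n (p Z) \<le> sq n (mv n ?N (p Z))" .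
  moreover have "0 < sq n (p Z)"
  proof (rule ccontr)
    assume "\<not> 0 < sq n (p Z)"
    then have "sq n (p Z) = 0" using sq_nonneg[of n "p Z"] by simp
    then have "sq n (mv n ?N (p Z)) \<le> 0" using sq_mv_le[of n ?N "p Z"] by simp
    then have "\<epsilon>\<^sup>2 * (real n) ^ 3 / 2 \<le> 0" using m1 by simp
    moreover have "0 < \<epsilon>\<^sup>2 * (real n) ^ 3 / 2" using assms(4,5) by simp
    ultimately show False by linarith
  qed
  ultimately show ?thesis by blast
qed

section \<open>Rounding a row to cuts\<close>

definition sgn1 :: "real \<Rightarrow> real" where
  "sgn1 x = (if 0 < x then 1 else - 1)"

text \<open>For symmetric \<open>A\<close> and \<open>q, j < n\<close> the sum is entry
  \<open>j\<close> of \<open>N^2 N_q\<close> up to the positive factor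
  \<open>sqrt (weight n A q * weight n A j)\<close>. The sign does not see this factor, so the
  weights enter without roots.\<close>

definition test_x :: "nat \<Rightarrow> (nat \<Rightarrow> nat \<Rightarrow> real) \<Rightarrow> nat \<Rightarrow> nat \<Rightarrow> real" where
  "test_x n A q j = sgn1 (\<Sum>k<n. A j k * (weight n A k * (\<Sum>l<n. A k l * weight n A l * A q l)))"

definition test_z :: "nat \<Rightarrow> (nat \<Rightarrow> nat \<Rightarrow> real) \<Rightarrow> nat \<Rightarrow> nat \<Rightarrow> real" where
  "test_z n A q j = sgn1 (\<Sum>k<n. A j k * test_x n A q k)"

definition cut_value :: "nat \<Rightarrow> (nat \<Rightarrow> nat \<Rightarrow> real) \<Rightarrow> (nat \<Rightarrow> real) \<Rightarrow> (nat \<Rightarrow> real) \<Rightarrow> real" where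
  "cut_value n A a b = (\<Sum>i<n. a i * (\<Sum>j<n. A i j * b j))"

text \<open>For \<open>\<sigma>\<close> in \<open>{-1, 1}\<close> this is the indicator of the
  positions where a sign vector equals \<open>\<sigma>\<close>. The values of \<open>sgn1\<close>
  are suitable because, unlike \<open>sgn\<close>, it never returns 0.\<close>

definition half :: "real \<Rightarrow> (nat \<Rightarrow> real) \<Rightarrow> nat \<Rightarrow> real" where
  "half \<sigma> x i = (1 + \<sigma> * x i) / 2"

lemma sgn1_mult: "sgn1 x * x = \<bar>x\<bar>"
  by (simp add: sgn1_def)

text \<open>Bilinearity with \<open>x = half 1 x - half (-1) x\<close>: a form that is large at two
  sign vectors is large at one of four pairs of sets.\<close>

lemma cut_value_split:
  "(\<Sum>i<n. x i * (\<Sum>j<n. A i j * z j)) =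
     cut_value n A (half 1 x) (half 1 z) - cut_value n A (half 1 x) (half (-1) z)
   - cut_value n A (half (-1) x) (half 1 z) + cut_value n A (half (-1) x) (half (-1) z)"
proof -
  have "(\<Sum>i<n. \<Sum>j<n. A i j * (x i * z j)) = (\<Sum>i<n. \<Sum>j<n. A i j * (half 1 x i * half 1 z j) -
      A i j * (half 1 x i * half (-1) z j) - A i j * (half (-1) x i * half 1 z j)
      + A i j * (half (-1) x i * half (-1) z j))"
    by (intro sum.cong refl) (simp add: half_def field_simps)
  then show ?thesis
    by (simp add: cut_value_def sum_distrib_left sum.distrib sum_subtractf mult_ac)
qed

text \<open>The entry bound on \<open>g = N^2 N_q\<close> turns its squared norm into a lower bound
  for its l1 norm, which is at most the l1 norm of \<open>a = A y\<close>. The latter is the pairing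
  of \<open>A y\<close> with the signs \<open>x\<close>. Moving \<open>A\<close> over to
  \<open>x\<close> and using \<open>|y_k| \<le> n\<close> replaces \<open>y\<close> by
  \<open>n\<close> times the signs \<open>z\<close> of \<open>A x\<close>. What remains is a
  bilinear form in two sign vectors, at most \<open>4 \<theta>\<close> by
  \<open>cut_value_split\<close>.\<close>

lemma large_cut_of_row:
  assumes sym: "\<And>i j. i < n \<Longrightarrow> j < n \<Longrightarrow> A i j = A j i"
    and energy: "(\<Sum>i<n. sq n (A i)) \<le> (real n)\<^sup>2 / 4" and "0 < n"
    and row: "\<beta> \<le> row_energy n (normalized n A) q" and "0 < \<beta>"
    and small: "\<And>\<sigma> \<tau>. \<sigma> \<in> {-1, 1} \<Longrightarrow> \<tau> \<in> {-1, 1} \<Longrightarrow>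
      \<bar>cut_value n A (half \<sigma> (test_x n A q)) (half \<tau> (test_z n A q))\<bar> < \<theta>"
  shows "2 * \<beta> / (real n) ^ 3 \<le> 4 * \<theta>"
proof -
  define u where "u i = sqrt (weight n A i)" for i
  have u: "0 < u i" "u i * u i = weight n A i" "u i \<le> 1" if "i < n" for i
    using weight_pos[OF that, of A] weight_le_1[of n A i] by (auto simp: u_def)
  let ?N = "normalized n A"
  let ?x = "test_x n A q" and ?z = "test_z n A q"
  have N: "?N i j = u i * A i j * u j" for i j by (simp add: normalized_def u_def)
  \<comment> \<open>Padding rows have weight 0 and hence energy 0, against
    \<open>0 < \<beta>\<close>.\<close>
  have "q < n"
  proof (rule ccontr)
    assume "\<not> q < n"
    then have "?N q = (\<lambda>_. 0)" by (auto simp: normalized_def weight_def)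
    then have "row_energy n ?N q = 0" by (simp add: row_energy_def mv_def sq_def)
    then show False using row \<open>0 < \<beta>\<close> by simp
  qed
  define g where "g = mv n ?N (mv n ?N (?N q))"
  have g_le: "\<bar>g j\<bar> \<le> (real n)\<^sup>2 / 2" for j
  proof -
    have "(g j)\<^sup>2 \<le> sq n (?N j) * sq n (mv n ?N (?N q))" unfolding g_def by (rule mv_le_row)
    also have "\<dots> \<le> sq n (?N j) * ((\<Sum>i<n. sq n (?N i)) * sq n (?N q))"
      by (intro mult_left_mono sq_mv_le sq_nonneg)
    also have "\<dots> \<le> real n * ((real n)\<^sup>2 / 4 * real n)"
      using energy sum_sq_normalized_le[of n A]
      by (intro mult_mono sq_normalized_le mult_nonneg_nonneg sum_nonneg sq_nonneg) auto
    also have "\<dots> = ((real n)\<^sup>2 / 2)\<^sup>2" by (simp add: power2_eq_square)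
    finally have "\<bar>g j\<bar> \<le> \<bar>(real n)\<^sup>2 / 2\<bar>" by (rule abs_le_square_iff[THEN iffD2])
    then show ?thesis by simp
  qed
  have "\<beta> \<le> (\<Sum>j<n. \<bar>g j\<bar> * \<bar>g j\<bar>)" using row
    unfolding row_energy_def g_def[symmetric] sq_def by (simp add: power2_eq_square)
  also have "\<dots> \<le> (\<Sum>j<n. \<bar>g j\<bar> * ((real n)\<^sup>2 / 2))"
    by (intro sum_mono mult_left_mono g_le) auto
  finally have g_sum: "\<beta> \<le> (\<Sum>j<n. \<bar>g j\<bar>) * ((real n)\<^sup>2 / 2)"
    unfolding sum_distrib_right .
  define y where "y k = u k * mv n ?N (?N q) k" for k
  have y: "u q * (weight n A k * (\<Sum>l<n. A k l * weight n A l * A q l)) = y k" if "k < n" for k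
  proof -
    have "mv n ?N (?N q) k = (\<Sum>l<n. u k * u q * (A k l * (u l * u l) * A q l))"
      unfolding mv_def N by (intro sum.cong) (auto simp: mult_ac)
    also have "\<dots> = u k * u q * (\<Sum>l<n. A k l * weight n A l * A q l)"
      by (simp add: u sum_distrib_left)
    finally show ?thesis using u(2)[OF that] by (simp add: y_def mult_ac)
  qed
  \<comment> \<open>This bound is the purpose of the scaling: both rows in the inner product have
    squared norm at most \<open>n\<close>.\<close>
  have y_le: "\<bar>y k\<bar> \<le> real n" if "k < n" for k
  proof -
    have "(mv n ?N (?N q) k)\<^sup>2 \<le> sq n (?N k) * sq n (?N q)" by (rule mv_le_row)
    also have "\<dots> \<le> real n * real n" by (intro mult_mono sq_normalized_le sq_nonneg) auto
    finally have "\<bar>mv n ?N (?N q) k\<bar> \<le> \<bar>real n\<bar>"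
      by (intro abs_le_square_iff[THEN iffD2]) (simp add: power2_eq_square)
    then have "u k * \<bar>mv n ?N (?N q) k\<bar> \<le> 1 * real n"
      using u[OF that] by (intro mult_mono) auto
    then show ?thesis using u[OF that] by (simp add: y_def abs_mult)
  qed
  define a where "a j = (\<Sum>k<n. A j k * y k)" for j
  have ag: "g j = u j * a j" if "j < n" for j
    unfolding g_def mv_def[of n ?N "mv n ?N (?N q)"] a_def y_def N sum_distrib_left
    by (intro sum.cong) (auto simp: mult_ac)
  have x: "?x j * a j = \<bar>a j\<bar>" for j
  proof -
    let ?b = "\<Sum>k<n. A j k * (weight n A k * (\<Sum>l<n. A k l * weight n A l * A q l))"
    have "a j = u q * ?b" unfolding a_def
    proof (subst sum_distrib_left, rule sum.cong[OF refl])
      fix k assume "k \<in> {..<n}"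
      then have "k < n" by simp
      show "A j k * y k = u q * (A j k * (weight n A k * (\<Sum>l<n. A k l * weight n A l * A q l)))"
        unfolding y[OF \<open>k < n\<close>, symmetric] by (rule mult.left_commute)
    qed
    then show ?thesis using u(1)[OF \<open>q < n\<close>] sgn1_mult[of ?b]
      by (simp add: test_x_def abs_mult mult.left_commute)
  qed
  define b where "b k = (\<Sum>j<n. A k j * ?x j)" for k
  have z: "?z k * b k = \<bar>b k\<bar>" for k unfolding b_def test_z_def by (rule sgn1_mult)
  have "(\<Sum>j<n. \<bar>g j\<bar>) \<le> (\<Sum>j<n. \<bar>a j\<bar>)"
  proof (intro sum_mono)
    fix j assume "j \<in> {..<n}"
    then show "\<bar>g j\<bar> \<le> \<bar>a j\<bar>" using ag u(1,3)[of j] mult_right_mono[of "u j" 1 "\<bar>a j\<bar>"]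
      by (simp add: abs_mult)
  qed
  also have "\<dots> = (\<Sum>j<n. ?x j * mv n A y j)" by (simp add: mv_def x flip: a_def)
  also have "\<dots> = (\<Sum>k<n. mv n A ?x k * y k)" by (rule mv_adjoint[OF sym, symmetric])
  also have "\<dots> \<le> (\<Sum>k<n. \<bar>b k\<bar> * real n)"
  proof (intro sum_mono)
    fix k assume "k \<in> {..<n}"
    have "mv n A ?x k * y k \<le> \<bar>b k * y k\<bar>" unfolding mv_def b_def by (rule abs_ge_self)
    also have "\<dots> \<le> \<bar>b k\<bar> * real n" unfolding abs_mult
      using y_le \<open>k \<in> {..<n}\<close> by (intro mult_left_mono) auto
    finally show "mv n A ?x k * y k \<le> \<bar>b k\<bar> * real n" .
  qed
  also have "\<dots> = (\<Sum>k<n. ?z k * mv n A ?x k) * real n"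
    by (simp add: sum_distrib_right mv_def z flip: b_def)
  also have "(\<Sum>k<n. ?z k * mv n A ?x k) = (\<Sum>k<n. mv n A ?z k * ?x k)"
    by (rule mv_adjoint[OF sym, symmetric])
  also have "\<dots> = (\<Sum>k<n. ?x k * (\<Sum>j<n. A k j * ?z j))" by (simp add: mv_def mult.commute)
  also have "\<dots> * real n \<le> 4 * \<theta> * real n"
    unfolding cut_value_split using small[of 1 1] small[of 1 "-1"] small[of "-1" 1] small[of "-1" "-1"]
    by (intro mult_right_mono) auto
  finally have s: "(\<Sum>j<n. \<bar>g j\<bar>) \<le> 4 * \<theta> * real n" .
  have "\<beta> \<le> 4 * \<theta> * real n * ((real n)\<^sup>2 / 2)"
    using g_sum mult_right_mono[OF s, of "(real n)\<^sup>2 / 2"] by simp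
  also have "\<dots> = 4 * \<theta> * ((real n) ^ 3 / 2)" by (simp add: power2_eq_square power3_eq_cube)
  finally show ?thesis using \<open>0 < n\<close> by (simp add: field_simps)
qed

theorem exhausted_imp_small_cut:
  fixes A :: "nat \<Rightarrow> nat \<Rightarrow> real" and P :: "nat \<Rightarrow> nat"
  assumes sym: "\<And>i j. i < n \<Longrightarrow> j < n \<Longrightarrow> A i j = A j i"
    and energy: "(\<Sum>i<n. sq n (A i)) \<le> (real n)\<^sup>2 / 4" and "0 < n" "0 < \<epsilon>"
    and approx: "\<And>v. \<bar>W * (\<Sum>l<L. (mv n (normalized n A) v (P l))\<^sup>2) - sq n (mv n (normalized n A) v)\<bar>
        \<le> \<epsilon>\<^sup>2 * (real n)\<^sup>2 / 8 * sq n v"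
    and W: "0 < W" "W * real L \<le> 2 * real n"
    and small: "\<And>l \<sigma> \<tau>. l < L \<Longrightarrow> \<sigma> \<in> {-1, 1} \<Longrightarrow> \<tau> \<in> {-1, 1} \<Longrightarrow>
      \<bar>cut_value n A (half \<sigma> (test_x n A (P l))) (half \<tau> (test_z n A (P l)))\<bar>
        < \<epsilon> ^ 8 / 150 * (real n)\<^sup>2"
    and UZ: "U \<subseteq> {..<n}" "Z \<subseteq> {..<n}"
  shows "\<bar>edge_weight A U Z\<bar> \<le> \<epsilon> * (real n)\<^sup>2"
proof (rule ccontr)
  assume "\<not> ?thesis"
  then have cut: "\<epsilon> * (real n)\<^sup>2 < \<bar>edge_weight A U Z\<bar>" by simp
  let ?N = "normalized n A"
  have Nsym: "?N i j = ?N j i" if "i < n" "j < n" for i j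
    using sym[OF that] by (simp add: normalized_def)
  \<comment> \<open>For \<open>\<epsilon> \<ge> 1/2\<close> Cauchy-Schwarz suffices: the Frobenius
    norm is at most \<open>n / 2\<close>, which bounds every cut by \<open>n^2 / 2\<close>.\<close>
  have half: "\<epsilon> < 1 / 2"
  proof (rule ccontr)
    assume "\<not> \<epsilon> < 1 / 2"
    let ?i = "\<lambda>X i. if i \<in> X then 1 else 0 :: real"
    have ind: "sq n (?i X) \<le> real n" if "X \<subseteq> {..<n}" for X
    proof -
      have "sq n (?i X) \<le> (\<Sum>i<n. 1)" unfolding sq_def by (intro sum_mono) auto
      then show ?thesis by simp
    qed
    have "edge_weight A U Z = (\<Sum>i<n. ?i U i * mv n A (?i Z) i)"
    proof -
      have "(\<Sum>j\<in>Z. A i j) = mv n A (?i Z) i" for i unfolding mv_def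
        by (intro sum.mono_neutral_cong_left) (use UZ in auto)
      then show ?thesis unfolding edge_weight_def
        by (intro sum.mono_neutral_cong_left) (use UZ in auto)
    qed
    then have "(edge_weight A U Z)\<^sup>2 \<le> sq n (?i U) * sq n (mv n A (?i Z))"
      by (simp only: inner_le_sq)
    also have "\<dots> \<le> sq n (?i U) * ((\<Sum>i<n. sq n (A i)) * sq n (?i Z))"
      by (intro mult_left_mono sq_mv_le sq_nonneg)
    also have "\<dots> \<le> real n * ((real n)\<^sup>2 / 4 * real n)"
      using UZ energy by (intro mult_mono ind mult_nonneg_nonneg sum_nonneg sq_nonneg) auto
    also have "\<dots> = (1 / 2 * (real n)\<^sup>2)\<^sup>2" by (simp add: power2_eq_square)
    also have "\<dots> \<le> (\<epsilon> * (real n)\<^sup>2)\<^sup>2"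
      using \<open>\<not> \<epsilon> < 1 / 2\<close> by (intro power_mono mult_right_mono) auto
    finally have "\<bar>edge_weight A U Z\<bar> \<le> \<bar>\<epsilon> * (real n)\<^sup>2\<bar>"
      by (rule abs_le_square_iff[THEN iffD2])
    then show False using cut \<open>0 < \<epsilon>\<close> by simp
  qed
  define \<rho> where "\<rho> = \<epsilon>\<^sup>2 * (real n)\<^sup>2 / 4"
  have "0 < \<rho>" using \<open>0 < n\<close> \<open>0 < \<epsilon>\<close> by (simp add: \<rho>_def)
  obtain w where w: "0 < sq n w" "\<rho> * sq n w \<le> sq n (mv n ?N w)"
    using cut_moment[OF energy UZ \<open>0 < \<epsilon>\<close> \<open>0 < n\<close> cut] unfolding \<rho>_def by blast
  have "\<exists>l<L. \<rho> ^ 3 / (4 * real n) \<le> row_energy n ?N (P l)"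
  proof (rule informative_row[OF Nsym \<open>0 < \<rho>\<close> w _ W \<open>0 < n\<close>])
    have "\<epsilon>\<^sup>2 * (real n)\<^sup>2 / 8 = \<rho> / 2" by (simp add: \<rho>_def)
    then show "\<bar>W * (\<Sum>l<L. (mv n ?N v (P l))\<^sup>2) - sq n (mv n ?N v)\<bar> \<le> \<rho> / 2 * sq n v" for v
      using approx[of v] by simp
  qed
  then obtain l where l: "l < L" "\<rho> ^ 3 / (4 * real n) \<le> row_energy n ?N (P l)" by blast
  have "2 * (\<rho> ^ 3 / (4 * real n)) / (real n) ^ 3 \<le> 4 * (\<epsilon> ^ 8 / 150 * (real n)\<^sup>2)"
    by (rule large_cut_of_row[OF sym energy \<open>0 < n\<close> l(2)])
       (use \<open>0 < \<rho>\<close> \<open>0 < n\<close> small[OF l(1)] in auto)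
  moreover have "2 * (\<rho> ^ 3 / (4 * real n)) / (real n) ^ 3 = \<epsilon> ^ 6 / 128 * (real n)\<^sup>2"
    using \<open>0 < n\<close> by (simp add: \<rho>_def field_simps eval_nat_numeral)
  ultimately have "\<epsilon> ^ 6 / 128 * (real n)\<^sup>2 \<le> 4 * \<epsilon> ^ 8 / 150 * (real n)\<^sup>2"
    by linarith
  then have "\<epsilon> ^ 6 / 128 \<le> 4 * \<epsilon> ^ 8 / 150" using \<open>0 < n\<close> by simp
  also have "\<dots> = 4 * \<epsilon>\<^sup>2 / 150 * \<epsilon> ^ 6" by (simp add: eval_nat_numeral)
  finally have "(1 / 128 - 4 * \<epsilon>\<^sup>2 / 150) * \<epsilon> ^ 6 \<le> 0" by (simp add: algebra_simps)
  \<comment> \<open>Even at \<open>\<epsilon> = 1/2\<close> the bracket is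
    \<open>1/128 - 1/150\<close>, which is positive.\<close>
  moreover have "\<epsilon>\<^sup>2 \<le> (1 / 2)\<^sup>2" using half \<open>0 < \<epsilon>\<close> by (intro power_mono) auto
  ultimately show False using \<open>0 < \<epsilon>\<close> by (simp add: mult_le_0_iff power2_eq_square)
qed

section \<open>Deterministic sampling of rows\<close>

definition gram2 :: "nat \<Rightarrow> (nat \<Rightarrow> nat \<Rightarrow> real) \<Rightarrow> nat \<Rightarrow> nat \<Rightarrow> real" where
  "gram2 n N i j = (\<Sum>k<n. N i k * N j k)\<^sup>2"

text \<open>The matrix \<open>v v^T\<close> as a vector indexed by pairs, so that Euclidean norms
  are Frobenius norms. Inner products of such vectors are squares of inner products in dimension
  \<open>n\<close>: they cost \<open>O(n)\<close> and are nonnegative.\<close>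

definition tensor :: "nat \<Rightarrow> (nat \<Rightarrow> real) \<Rightarrow> nat \<times> nat \<Rightarrow> real" where
  "tensor n v = (\<lambda>(k, l). v k * v l)"

abbreviation square :: "nat \<Rightarrow> (nat \<times> nat) set" where
  "square n \<equiv> {..<n} \<times> {..<n}"

lemma tensor_inner: "(\<Sum>x\<in>square n. tensor n v x * tensor n w x) = (\<Sum>k<n. v k * w k)\<^sup>2"
proof -
  have "(\<Sum>x\<in>square n. tensor n v x * tensor n w x) = (\<Sum>k<n. \<Sum>l<n. (v k * w k) * (v l * w l))"
    unfolding sum.cartesian_product by (intro sum.cong) (auto simp: tensor_def mult_ac)
  then show ?thesis by (simp add: power2_eq_square sum_product)
qed

lemma tensor_gram2: "(\<Sum>x\<in>square n. tensor n (N i) x * tensor n (N j) x) = gram2 n N i j"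
  by (simp add: tensor_inner gram2_def)

lemma tensor_mv: "(\<Sum>x\<in>square n. tensor n (N i) x * tensor n v x) = (mv n N v i)\<^sup>2"
  by (simp add: tensor_inner mv_def)

lemma tensor_norm: "(\<Sum>x\<in>square n. (tensor n v x)\<^sup>2) = (sq n v)\<^sup>2"
  using tensor_inner[of n v v] by (simp add: sq_def power2_eq_square)

text \<open>
  Row \<open>C j\<close> is chosen and row \<open>R j\<close> rejected from the \<open>j\<close>-th pair. The sign of \<open>drift\<close> tells which
  choice for the pair \<open>p, q\<close> has a nonpositive inner product with the imbalance so far.
\<close>

definition imbalance ::
  "nat \<Rightarrow> (nat \<Rightarrow> nat \<Rightarrow> real) \<Rightarrow> (nat \<Rightarrow> nat) \<Rightarrow> (nat \<Rightarrow> nat) \<Rightarrow> nat set \<Rightarrow> nat \<times> nat \<Rightarrow> real" where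
  "imbalance n N C R J x = (\<Sum>j\<in>J. tensor n (N (C j)) x - tensor n (N (R j)) x)"

definition drift :: "nat \<Rightarrow> (nat \<Rightarrow> nat \<Rightarrow> real) \<Rightarrow> (nat \<Rightarrow> nat) \<Rightarrow> (nat \<Rightarrow> nat) \<Rightarrow> nat set
    \<Rightarrow> nat \<Rightarrow> nat \<Rightarrow> real" where
  "drift n N C R J p q = (\<Sum>j\<in>J. gram2 n N p (C j) - gram2 n N q (C j)
      - gram2 n N p (R j) + gram2 n N q (R j))"

text \<open>The imbalance consists of \<open>n^2\<close> numbers and is never stored. Its inner
  product with the current difference decides the choice, and that expands into values of
  \<open>gram2\<close>.\<close>

lemma drift_eq:
  "drift n N C R J p q
    = (\<Sum>x\<in>square n. imbalance n N C R J x * (tensor n (N p) x - tensor n (N q) x))"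
proof -
  have "drift n N C R J p q = (\<Sum>j\<in>J. \<Sum>x\<in>square n.
     (tensor n (N (C j)) x - tensor n (N (R j)) x) * (tensor n (N p) x - tensor n (N q) x))"
    unfolding drift_def tensor_gram2[symmetric] sum_subtractf[symmetric] sum.distrib[symmetric]
    by (intro sum.cong refl) (simp add: algebra_simps)
  also have "\<dots> = (\<Sum>x\<in>square n. imbalance n N C R J x * (tensor n (N p) x - tensor n (N q) x))"
    unfolding imbalance_def sum_distrib_right by (rule sum.swap)
  finally show ?thesis .
qed

text \<open>The choice makes the cross term nonpositive, so squared norms at most add, as for
  orthogonal vectors. A single difference contributes \<open>2 n^2\<close> rather than
  \<open>4 n^2\<close>, because the tensors of two rows never form an obtuse angle.\<close>

lemma imbalance_step:
  assumes "finite J" "k \<notin> J" "\<And>i. sq n (N i) \<le> real n"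
    and choice: "if 0 < drift n N C R J p q then c = q \<and> r = p else c = p \<and> r = q"
  shows "(\<Sum>x\<in>square n. (imbalance n N (C(k := c)) (R(k := r)) (insert k J) x)\<^sup>2)
    \<le> (\<Sum>x\<in>square n. (imbalance n N C R J x)\<^sup>2) + 2 * (real n)\<^sup>2"
proof -
  let ?E = "imbalance n N C R J" and ?d = "\<lambda>x. tensor n (N c) x - tensor n (N r) x"
  have ins: "imbalance n N (C(k := c)) (R(k := r)) (insert k J) x = ?E x + ?d x" for x
  proof -
    have "(\<Sum>j\<in>J. tensor n (N ((C(k := c)) j)) x - tensor n (N ((R(k := r)) j)) x) = ?E x"
      unfolding imbalance_def using assms(2) by (intro sum.cong refl) auto
    then show ?thesis using assms(1,2) by (simp add: imbalance_def)
  qed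
  have neg: "(\<Sum>x\<in>square n. ?E x * ?d x) \<le> 0"
  proof (cases "0 < drift n N C R J p q")
    case True
    have "(\<Sum>x\<in>square n. ?E x * (tensor n (N q) x - tensor n (N p) x)) = - drift n N C R J p q"
      unfolding drift_eq sum_negf[symmetric] by (intro sum.cong refl) (simp add: algebra_simps)
    then show ?thesis using True choice by simp
  next
    case False
    then show ?thesis using choice by (simp add: drift_eq)
  qed
  have len: "(sq n (N i))\<^sup>2 \<le> (real n)\<^sup>2" for i
    using assms(3) sq_nonneg by (intro power_mono)
  have "(\<Sum>x\<in>square n. (?d x)\<^sup>2) = (\<Sum>x\<in>square n. (tensor n (N c) x)\<^sup>2)
      + (\<Sum>x\<in>square n. (tensor n (N r) x)\<^sup>2) - 2 * (\<Sum>x\<in>square n. tensor n (N c) x * tensor n (N r) x)"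
    by (simp add: power2_diff sum.distrib sum_subtractf sum_distrib_left mult.assoc)
  also have "\<dots> \<le> 2 * (real n)\<^sup>2"
  proof -
    have "0 \<le> gram2 n N c r" by (simp add: gram2_def)
    then show ?thesis unfolding tensor_norm tensor_gram2 using len[of c] len[of r] by linarith
  qed
  finally have d: "(\<Sum>x\<in>square n. (?d x)\<^sup>2) \<le> 2 * (real n)\<^sup>2" .
  have "(\<Sum>x\<in>square n. (?E x + ?d x)\<^sup>2)
    = (\<Sum>x\<in>square n. (?E x)\<^sup>2) + (\<Sum>x\<in>square n. (?d x)\<^sup>2) + 2 * (\<Sum>x\<in>square n. ?E x * ?d x)"
    by (simp add: power2_sum sum.distrib sum_distrib_left mult.assoc)
  then show ?thesis unfolding ins using d neg by linarith
qed

text \<open>The sum is the quadratic form of the imbalance matrix at \<open>v\<close>, that is, its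
  Frobenius inner product with \<open>v v^T\<close>, which has norm \<open>sq n v\<close>.\<close>

lemma imbalance_functional:
  "\<bar>\<Sum>j\<in>J. (mv n N v (C j))\<^sup>2 - (mv n N v (R j))\<^sup>2\<bar>
    \<le> sqrt (\<Sum>x\<in>square n. (imbalance n N C R J x)\<^sup>2) * sq n v"
proof -
  have "(\<Sum>j\<in>J. (mv n N v (C j))\<^sup>2 - (mv n N v (R j))\<^sup>2)
    = (\<Sum>j\<in>J. \<Sum>x\<in>square n. (tensor n (N (C j)) x - tensor n (N (R j)) x) * tensor n v x)"
    unfolding tensor_mv[symmetric] sum_subtractf[symmetric]
    by (intro sum.cong refl) (simp add: algebra_simps)
  also have "\<dots> = (\<Sum>x\<in>square n. imbalance n N C R J x * tensor n v x)"
    unfolding imbalance_def sum_distrib_right by (rule sum.swap)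
  finally have "(\<Sum>j\<in>J. (mv n N v (C j))\<^sup>2 - (mv n N v (R j))\<^sup>2)\<^sup>2
      \<le> (\<Sum>x\<in>square n. (imbalance n N C R J x)\<^sup>2) * (sq n v)\<^sup>2"
    unfolding tensor_norm[symmetric] by (simp only: Cauchy_Schwarz_ineq_sum)
  then have "sqrt ((\<Sum>j\<in>J. (mv n N v (C j))\<^sup>2 - (mv n N v (R j))\<^sup>2)\<^sup>2)
      \<le> sqrt ((\<Sum>x\<in>square n. (imbalance n N C R J x)\<^sup>2) * (sq n v)\<^sup>2)"
    by (rule real_sqrt_le_mono)
  then show ?thesis by (simp add: real_sqrt_mult sq_nonneg)
qed

text \<open>The pairs below \<open>bs\<close> lie in closed batches, those from \<open>bs\<close> to \<open>k\<close> in the current one.\<close>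

definition balanced :: "nat \<Rightarrow> (nat \<Rightarrow> nat \<Rightarrow> real) \<Rightarrow> real \<Rightarrow> (nat \<Rightarrow> nat) \<Rightarrow> (nat \<Rightarrow> nat)
    \<Rightarrow> nat \<Rightarrow> nat \<Rightarrow> bool" where
  "balanced n N t C R bs k \<longleftrightarrow> bs \<le> k \<and>
     (\<Sum>x\<in>square n. (imbalance n N C R {bs..<k} x)\<^sup>2) \<le> 2 * real (k - bs) * (real n)\<^sup>2 \<and>
     (\<forall>v. \<bar>\<Sum>j<bs. (mv n N v (C j))\<^sup>2 - (mv n N v (R j))\<^sup>2\<bar>
        \<le> real bs * (sqrt 2 / t) * real n * sq n v)"

lemma balanced_0: "balanced n N t C R 0 0"
  by (simp add: balanced_def imbalance_def)

lemma balanced_batch: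
  assumes "balanced n N t C R bs k"
  shows "\<bar>\<Sum>j<k. (mv n N v (C j))\<^sup>2 - (mv n N v (R j))\<^sup>2\<bar>
    \<le> (real bs * (sqrt 2 / t) + sqrt (2 * real (k - bs))) * real n * sq n v"
proof -
  let ?f = "\<lambda>j. (mv n N v (C j))\<^sup>2 - (mv n N v (R j))\<^sup>2"
  have "bs \<le> k" using assms by (simp add: balanced_def)
  then have split: "(\<Sum>j<k. ?f j) = (\<Sum>j<bs. ?f j) + (\<Sum>j\<in>{bs..<k}. ?f j)"
    using sum.atLeastLessThan_concat[of 0 bs k ?f] by (simp add: atLeast0LessThan)
  have "\<bar>\<Sum>j\<in>{bs..<k}. ?f j\<bar> \<le> sqrt (\<Sum>x\<in>square n. (imbalance n N C R {bs..<k} x)\<^sup>2) * sq n v"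
    by (rule imbalance_functional)
  also have "\<dots> \<le> sqrt (2 * real (k - bs) * (real n)\<^sup>2) * sq n v"
    using assms unfolding balanced_def by (intro mult_right_mono real_sqrt_le_mono sq_nonneg) blast
  also have "\<dots> = sqrt (2 * real (k - bs)) * real n * sq n v" by (simp add: real_sqrt_mult)
  finally have "\<bar>\<Sum>j\<in>{bs..<k}. ?f j\<bar> \<le> sqrt (2 * real (k - bs)) * real n * sq n v" .
  moreover have "\<bar>\<Sum>j<bs. ?f j\<bar> \<le> real bs * (sqrt 2 / t) * real n * sq n v"
    using assms by (simp add: balanced_def)
  moreover have "(real bs * (sqrt 2 / t) + sqrt (2 * real (k - bs))) * real n * sq n v
    = real bs * (sqrt 2 / t) * real n * sq n v + sqrt (2 * real (k - bs)) * real n * sq n v"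
    by (simp add: distrib_right)
  ultimately show ?thesis unfolding split by linarith
qed

text \<open>A batch of \<open>d\<close> pairs has error proportional to \<open>sqrt (2 d)\<close>.
  For \<open>d \<ge> t^2\<close> this is at most \<open>sqrt 2 / t\<close> per pair, and errors
  counted per pair simply add up over the closed batches.\<close>

lemma balanced_close:
  assumes b: "balanced n N t C R bs k" and "0 < t" "t\<^sup>2 \<le> real (k - bs)"
  shows "balanced n N t C R k k"
proof -
  let ?d = "real (k - bs)"
  have "sqrt (2 * ?d) \<le> ?d * (sqrt 2 / t)"
  proof -
    have "t \<le> sqrt ?d" using assms(2,3) by (simp add: real_le_rsqrt)
    then have "sqrt ?d * t \<le> sqrt ?d * sqrt ?d" by (intro mult_left_mono) auto
    then have "sqrt ?d * t \<le> ?d" by simp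
    then have "sqrt 2 * (sqrt ?d * t) \<le> sqrt 2 * ?d" by (intro mult_left_mono) auto
    then show ?thesis using \<open>0 < t\<close> by (simp add: real_sqrt_mult field_simps)
  qed
  moreover have "real bs + ?d = real k" using b by (simp add: balanced_def)
  then have "real bs * (sqrt 2 / t) + ?d * (sqrt 2 / t) = real k * (sqrt 2 / t)"
    by (metis distrib_right)
  ultimately have le: "real bs * (sqrt 2 / t) + sqrt (2 * ?d) \<le> real k * (sqrt 2 / t)" by linarith
  have "\<bar>\<Sum>j<k. (mv n N v (C j))\<^sup>2 - (mv n N v (R j))\<^sup>2\<bar> \<le> real k * (sqrt 2 / t) * real n * sq n v" for v
  proof -
    have "(real bs * (sqrt 2 / t) + sqrt (2 * ?d)) * real n * sq n v
        \<le> real k * (sqrt 2 / t) * real n * sq n v"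
      by (intro mult_right_mono le sq_nonneg) simp
    then show ?thesis using balanced_batch[OF b, of v] by linarith
  qed
  then show ?thesis by (simp add: balanced_def imbalance_def)
qed

lemma balanced_step:
  assumes b: "balanced n N t C R bs k" and rows: "\<And>i. sq n (N i) \<le> real n"
    and choice: "if 0 < drift n N C R {bs..<k} p q then c = q \<and> r = p else c = p \<and> r = q"
  shows "balanced n N t (C(k := c)) (R(k := r)) bs (Suc k)"
proof -
  have "bs \<le> k" using b by (simp add: balanced_def)
  then have ins: "{bs..<Suc k} = insert k {bs..<k}" by auto
  have "(\<Sum>x\<in>square n. (imbalance n N (C(k := c)) (R(k := r)) {bs..<Suc k} x)\<^sup>2)
      \<le> 2 * real (k - bs) * (real n)\<^sup>2 + 2 * (real n)\<^sup>2"
  proof -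
    have "(\<Sum>x\<in>square n. (imbalance n N C R {bs..<k} x)\<^sup>2) \<le> 2 * real (k - bs) * (real n)\<^sup>2"
      using b unfolding balanced_def by blast
    then show ?thesis
      using imbalance_step[where k = k, OF _ _ rows choice] unfolding ins by fastforce
  qed
  also have "\<dots> = 2 * real (Suc k - bs) * (real n)\<^sup>2"
    using \<open>bs \<le> k\<close> by (simp add: Suc_diff_le algebra_simps)
  finally have 1: "(\<Sum>x\<in>square n. (imbalance n N (C(k := c)) (R(k := r)) {bs..<Suc k} x)\<^sup>2)
      \<le> 2 * real (Suc k - bs) * (real n)\<^sup>2" .
  have "(\<Sum>j<bs. (mv n N v ((C(k := c)) j))\<^sup>2 - (mv n N v ((R(k := r)) j))\<^sup>2)
    = (\<Sum>j<bs. (mv n N v (C j))\<^sup>2 - (mv n N v (R j))\<^sup>2)" for v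
    using \<open>bs \<le> k\<close> by (intro sum.cong) auto
  then show ?thesis using 1 b by (simp add: balanced_def)
qed

text \<open>\<open>P\<close> lists \<open>L\<close> representatives, each of weight \<open>H / L\<close>.\<close>

definition represents :: "nat \<Rightarrow> (nat \<Rightarrow> nat \<Rightarrow> real) \<Rightarrow> nat \<Rightarrow> (nat \<Rightarrow> nat) \<Rightarrow> nat \<Rightarrow> real \<Rightarrow> bool" where
  "represents n N H P L e \<longleftrightarrow> (\<forall>v.
     \<bar>real H / real L * (\<Sum>l<L. (mv n N v (P l))\<^sup>2) - sq n (mv n N v)\<bar> \<le> e * (real n * real H) * sq n v)"

lemma represents_all:
  assumes "n \<le> H" "0 < H" "\<And>i k. n \<le> i \<Longrightarrow> N i k = 0"
  shows "represents n N H (\<lambda>i. i) H 0"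
proof -
  have "(\<Sum>l<H. (mv n N v l)\<^sup>2) = sq n (mv n N v)" for v
    unfolding sq_def using assms by (intro sum.mono_neutral_right) (auto simp: mv_def)
  then show ?thesis using assms(2) by (simp add: represents_def)
qed

text \<open>Twice the sum over the chosen rows is the sum over all pairs plus the imbalance, so
  halving the list while doubling the weight costs only the imbalance. Closed batches contribute
  \<open>1 / t\<close>; the open last batch has at most \<open>l\<close> pairs and contributes
  \<open>1 / sqrt l\<close>.\<close>

lemma represents_halve:
  assumes P: "represents n N H P (2 * l) e"
    and CR: "\<And>j. j < l \<Longrightarrow> (C j, R j) = (P (2 * j), P (2 * j + 1)) \<or> (C j, R j) = (P (2 * j + 1), P (2 * j))"
    and bal: "balanced n N t C R bs l" and "0 < l" "0 < t"
  shows "represents n N H C l (e + (1 / t + 1 / sqrt (real l)))"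
  unfolding represents_def
proof
  fix v
  let ?f = "\<lambda>i. (mv n N v i)\<^sup>2"
  have "(\<Sum>j<l. ?f (C j) + ?f (R j)) = (\<Sum>j<l. ?f (P (2 * j)) + ?f (P (2 * j + 1)))"
  proof (intro sum.cong refl)
    fix j assume "j \<in> {..<l}"
    then have "j < l" by simp
    then show "?f (C j) + ?f (R j) = ?f (P (2 * j)) + ?f (P (2 * j + 1))"
      using CR[OF \<open>j < l\<close>] by (elim disjE) (simp_all add: add.commute)
  qed
  also have "\<dots> = (\<Sum>j<2 * l. ?f (P j))" by (induction l) auto
  finally have pairs: "(\<Sum>j<2 * l. ?f (P j)) = (\<Sum>j<l. ?f (C j)) + (\<Sum>j<l. ?f (R j))"
    by (simp add: sum.distrib)
  let ?D = "\<Sum>j<l. ?f (C j) - ?f (R j)"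
  define W where "W = real H / (2 * real l)"
  have eq: "real H / real l * (\<Sum>j<l. ?f (C j)) = W * (\<Sum>j<2 * l. ?f (P j)) + W * ?D"
  proof -
    have "real H / real l = 2 * W" by (simp add: W_def)
    then show ?thesis unfolding pairs sum_subtractf by (simp only: algebra_simps)
  qed
  have "bs \<le> l" using bal by (simp add: balanced_def)
  have "\<bar>?D\<bar> \<le> (real bs * (sqrt 2 / t) + sqrt (2 * real (l - bs))) * real n * sq n v"
    by (rule balanced_batch[OF bal])
  also have "\<dots> \<le> (real l * (sqrt 2 / t) + sqrt (2 * real l)) * real n * sq n v"
    using \<open>bs \<le> l\<close> \<open>0 < t\<close> by (intro mult_right_mono add_mono sq_nonneg real_sqrt_le_mono) auto
  finally have "W * \<bar>?D\<bar> \<le> W * ((real l * (sqrt 2 / t) + sqrt (2 * real l)) * real n * sq n v)"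
    by (intro mult_left_mono) (auto simp: W_def)
  also have "\<dots> = (sqrt 2 / 2 * (1 / t + 1 / sqrt (real l))) * (real n * real H) * sq n v"
  proof -
    have "sqrt (real l) * sqrt (real l) = real l" by simp
    then have "W * (real l * (sqrt 2 / t) + sqrt (2 * real l))
        = real H * (sqrt 2 / 2 * (1 / t + 1 / sqrt (real l)))"
      unfolding W_def using \<open>0 < l\<close> \<open>0 < t\<close> by (simp add: real_sqrt_mult field_simps)
    then show ?thesis by (simp add: mult_ac)
  qed
  also have "\<dots> \<le> (1 * (1 / t + 1 / sqrt (real l))) * (real n * real H) * sq n v"
    using \<open>0 < t\<close> sqrt2_less_2 by (intro mult_right_mono sq_nonneg) auto
  finally have "\<bar>W * ?D\<bar> \<le> (1 / t + 1 / sqrt (real l)) * (real n * real H) * sq n v"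
    by (simp add: abs_mult W_def)
  moreover have "\<bar>W * (\<Sum>j<2 * l. ?f (P j)) - sq n (mv n N v)\<bar> \<le> e * (real n * real H) * sq n v"
    using P by (simp add: represents_def W_def)
  ultimately show "\<bar>real H / real l * (\<Sum>j<l. ?f (C j)) - sq n (mv n N v)\<bar>
      \<le> (e + (1 / t + 1 / sqrt (real l))) * (real n * real H) * sq n v"
    unfolding eq distrib_right by linarith
qed

lemma represents_mono: "represents n N H P L e \<Longrightarrow> e \<le> e' \<Longrightarrow> represents n N H P L e'"
  unfolding represents_def
  by (meson mult_right_mono order_trans sq_nonneg mult_nonneg_nonneg of_nat_0_le_iff)

text \<open>The remaining error of the halving process: the batch size \<open>t\<^sup>2\<close> grows by \<open>25/16\<close> and the
  length is halved in every round, so both contributions are geometric sums.\<close>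

definition error_potential :: "real \<Rightarrow> real \<Rightarrow> real \<Rightarrow> real" where
  "error_potential L0 t len = 5 / t + max 0 (6 / sqrt L0 - 4 / sqrt len)"

text \<open>For \<open>t\<close> the geometric sum is exact: \<open>1/t + 5/(5t/4) = 5/t\<close>.
  For the lengths put \<open>a = 1 / sqrt l\<close> and \<open>b = 1 / sqrt L0\<close>; a round
  starts only if \<open>L0 < 2 * l\<close>, so \<open>a \<le> sqrt 2 * b\<close>. With
  \<open>sqrt 2 \<le> 3/2\<close> the coefficients 6 and 4 fit both branches of the maximum:
  \<open>4 a \<le> 6 b\<close> and \<open>2 sqrt 2 a \<le> 3 a\<close>. The maximum keeps the
  potential nonnegative for lists that are short from the start.\<close>

lemma error_potential_step:
  assumes "0 < t" "0 < L0" "L0 < 2 * l"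
  shows "1 / t + 1 / sqrt l + error_potential L0 (5 / 4 * t) l \<le> error_potential L0 t (2 * l)"
proof -
  have "0 < l" using assms by simp
  define a b r where "a = 1 / sqrt l" and "b = 1 / sqrt L0" and "r = sqrt 2"
  have pos: "0 < a" "0 < b" using assms \<open>0 < l\<close> by (auto simp: a_def b_def)
  have "sqrt L0 \<le> r * sqrt l" unfolding r_def using assms by (simp flip: real_sqrt_mult)
  then have ab: "a \<le> r * b" using assms \<open>0 < l\<close> by (simp add: a_def b_def field_simps)
  have "4 / sqrt (2 * l) = 4 * a / r" by (simp add: a_def r_def real_sqrt_mult)
  also have "\<dots> = 2 * (r * a)" by (simp add: r_def field_simps)
  finally have q: "4 / sqrt (2 * l) = 2 * (r * a)" .
  have "r \<le> 3 / 2" "r \<ge> 0" unfolding r_def by (rule real_le_lsqrt) (auto simp: power2_eq_square)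
  then have ra: "r * a \<le> 3 / 2 * a" and rb: "r * b \<le> 3 / 2 * b" using pos by (auto intro: mult_right_mono)
  have "a + max 0 (6 * b - 4 * a) \<le> 6 * b - 2 * (r * a)"
  proof -
    have "a \<le> 6 * b - 2 * (r * a)" "a + (6 * b - 4 * a) \<le> 6 * b - 2 * (r * a)"
      using ra rb ab pos by linarith+
    then show ?thesis by (simp only: max_def split: if_split) auto
  qed
  moreover have "1 / t + 5 / (5 / 4 * t) = 5 / t" using assms by (simp add: field_simps)
  moreover have "6 / sqrt L0 = 6 * b" "4 / sqrt l = 4 * a" "1 / sqrt l = a" by (auto simp: a_def b_def)
  ultimately show ?thesis unfolding error_potential_def q by simp
qed

section \<open>The sampling program\<close>

lemma wp_Assign_Seq:
  assumes "defined e s" "wp q T2 Q (upd s x 0 (val e s))" "real (2 + cost e) + T2 \<le> T"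
  shows "wp (Seq (Assign x e) q) T Q s"
  by (rule wp_Seq[where ?T1.0 = "real (2 + cost e)" and ?T2.0 = T2], rule wp_Write[where k = 0])
     (use assms in auto)

lemma wp_Assign:
  assumes "defined e s" "Q (upd s x 0 (val e s))" "real (2 + cost e) \<le> T"
  shows "wp (Assign x e) T Q s"
  by (rule wp_Write[where k = 0]) (use assms in auto)

lemma agree_refl [simp]: "agree X s s"
  by (simp add: agree_def)

lemma agree_trans: "agree X s s' \<Longrightarrow> agree Y s' s'' \<Longrightarrow> X \<subseteq> Z \<Longrightarrow> Y \<subseteq> Z \<Longrightarrow> agree Z s s''"
  unfolding agree_def by (metis subsetD)

lemma agree_upd: "agree X s s' \<Longrightarrow> a \<in> X \<Longrightarrow> agree X s (upd s' a k x)"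
  by (auto simp: agree_def)

lemma agreeD: "agree X s s' \<Longrightarrow> a \<notin> X \<Longrightarrow> s' a = s a"
  by (simp add: agree_def)

text \<open>Row indices are not restricted to \<open>i < n\<close>, since the padded list of rows
  contains larger ones. Whatever the memory holds there is harmless, as these rows have weight
  0.\<close>

definition env :: "nat \<Rightarrow> (nat \<Rightarrow> nat \<Rightarrow> real) \<Rightarrow> state \<Rightarrow> bool" where
  "env n A s \<longleftrightarrow> s ''n'' 0 = real n \<and> (\<forall>i. \<forall>j<n. s ''A'' (i * n + j) = A i j)
     \<and> (\<forall>i. s ''V'' i = weight n A i)"

lemma env_agree: "env n A s \<Longrightarrow> agree X s s' \<Longrightarrow> X \<inter> {''n'', ''A'', ''V''} = {} \<Longrightarrow> env n A s'"
  by (auto simp: env_def agree_def)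

lemma env_upd [simp]: "a \<notin> {''n'', ''A'', ''V''} \<Longrightarrow> env n A (s(a := f)) \<longleftrightarrow> env n A s"
  by (auto simp: env_def)

section \<open>Computing the drift of a pair\<close>

definition AddKernel :: "string \<Rightarrow> string \<Rightarrow> int \<Rightarrow> program" where
  "AddKernel x y \<sigma> = Seq
     (SumTo ''acc'' ''k'' ''n''
       (Mul (Mul (Read ''V'' (V ''k'')) (Read ''A'' (Idx x ''k''))) (Read ''A'' (Idx y ''k''))))
     (Assign ''h'' (Add (V ''h'') (Mul (Const \<sigma>)
       (Mul (Mul (Read ''V'' (V x)) (Read ''V'' (V y))) (Mul (V ''acc'') (V ''acc''))))))"

text \<open>Squaring removes the roots of the weights of \<open>p\<close> and \<open>q\<close>, and
  the root for each \<open>k\<close> occurs twice. Hence field operations suffice to evaluate the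
  kernel.\<close>

lemma gram2_normalized:
  "gram2 n (normalized n A) p q = weight n A p * weight n A q * (\<Sum>k<n. weight n A k * A p k * A q k)\<^sup>2"
proof -
  have "(\<Sum>k<n. normalized n A p k * normalized n A q k)
    = sqrt (weight n A p) * sqrt (weight n A q) * (\<Sum>k<n. weight n A k * A p k * A q k)"
    unfolding sum_distrib_left normalized_def
  proof (intro sum.cong refl)
    fix k
    define a where "a = sqrt (weight n A k)"
    have *: "weight n A k = a * a" by (simp add: a_def weight_nonneg)
    show "sqrt (weight n A p) * A p k * sqrt (weight n A k) * (sqrt (weight n A q) * A q k * sqrt (weight n A k))
      = sqrt (weight n A p) * sqrt (weight n A q) * (weight n A k * A p k * A q k)"
      unfolding a_def[symmetric] unfolding * by (simp only: mult_ac)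
  qed
  then show ?thesis by (simp add: gram2_def power_mult_distrib weight_nonneg)
qed

lemma wp_AddKernel:
  assumes "env n A s" "s x 0 = real p" "s y 0 = real q" "1 \<le> n" "\<sigma> \<in> {1, -1}"
    and xy: "{x, y} \<inter> {''acc'', ''k'', ''h''} = {}"
    and Q: "\<And>s'. agree {''acc'', ''k'', ''h''} s s' \<Longrightarrow>
      s' ''h'' 0 = s ''h'' 0 + of_int \<sigma> * gram2 n (normalized n A) p q \<Longrightarrow> Q s'"
  shows "wp (AddKernel x y \<sigma>) (100 * real n) Q s"
  unfolding AddKernel_def
proof (rule wp_Seq[where ?T1.0 = "40 * real n + 15" and ?T2.0 = 25])
  let ?h = "Assign ''h'' (Add (V ''h'') (Mul (Const \<sigma>)
       (Mul (Mul (Read ''V'' (V x)) (Read ''V'' (V y))) (Mul (V ''acc'') (V ''acc'')))))"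
  have s: "s ''n'' 0 = real n" "\<And>i j. j < n \<Longrightarrow> s ''A'' (i * n + j) = A i j" "\<And>i. s ''V'' i = weight n A i"
    using assms(1) by (auto simp: env_def)
  have ne: "x \<noteq> ''acc''" "x \<noteq> ''k''" "x \<noteq> ''h''" "y \<noteq> ''acc''" "y \<noteq> ''k''" "y \<noteq> ''h''" using xy by auto
  show "wp (SumTo ''acc'' ''k'' ''n''
       (Mul (Mul (Read ''V'' (V ''k'')) (Read ''A'' (Idx x ''k''))) (Read ''A'' (Idx y ''k''))))
     (40 * real n + 15) (\<lambda>s'. wp ?h 25 Q s') s"
  proof (rule wp_SumTo[where n = n and g = "\<lambda>k. weight n A k * A p k * A q k"])
    fix k s' assume s': "k < n" "agree {''acc'', ''k''} s s'" "s' ''k'' 0 = real k"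
    have "s' x = s x" "s' y = s y" "s' ''A'' = s ''A''" "s' ''V'' = s ''V''" "s' ''n'' = s ''n''"
      by (rule agreeD[OF s'(2)], simp add: ne)+
    then show "defined (Mul (Mul (Read ''V'' (V ''k'')) (Read ''A'' (Idx x ''k''))) (Read ''A'' (Idx y ''k''))) s' \<and>
      val (Mul (Mul (Read ''V'' (V ''k'')) (Read ''A'' (Idx x ''k''))) (Read ''A'' (Idx y ''k''))) s'
        = weight n A k * A p k * A q k"
      by (simp add: s s'(1,3) assms(2,3))
  next
    fix s' assume s': "agree {''acc'', ''k''} s s'"
      "s' ''acc'' 0 = (\<Sum>k<n. weight n A k * A p k * A q k)"
    have eq: "s' x = s x" "s' y = s y" "s' ''V'' = s ''V''" "s' ''h'' = s ''h''"
      by (rule agreeD[OF s'(1)], simp add: ne)+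
    show "wp ?h 25 Q s'"
    proof (rule wp_Assign, goal_cases)
      case 1
      show ?case by (simp add: eq s assms(2,3))
    next
      case 2
      show ?case
      proof (rule Q)
        show "agree {''acc'', ''k'', ''h''} s (upd s' ''h'' 0 (val (Add (V ''h'') (Mul (Const \<sigma>)
            (Mul (Mul (Read ''V'' (V x)) (Read ''V'' (V y))) (Mul (V ''acc'') (V ''acc''))))) s'))"
          using s'(1) by (auto simp: agree_def)
      qed (simp add: eq s s'(2) assms(2,3) gram2_normalized power2_eq_square)
    qed simp
  qed (use s assms(4) in simp_all)
qed (use assms in auto)

definition AddDrift :: program where
  "AddDrift = Seq (Assign ''y'' (Read ''P'' (V ''j''))) (Seq (Assign ''z'' (Read ''R'' (V ''j'')))
     (Seq (AddKernel ''p'' ''y'' 1) (Seq (AddKernel ''q'' ''y'' (-1))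
     (Seq (AddKernel ''p'' ''z'' (-1)) (AddKernel ''q'' ''z'' 1)))))"

lemma wp_AddDrift:
  assumes e: "env n A s" and "1 \<le> n" "s ''j'' 0 = real j" "s ''P'' j = real c" "s ''R'' j = real r"
    and "s ''p'' 0 = real p" "s ''q'' 0 = real q"
    and Q: "\<And>s'. agree {''acc'', ''k'', ''h'', ''y'', ''z''} s s' \<Longrightarrow>
      s' ''h'' 0 = s ''h'' 0 + (gram2 n (normalized n A) p c - gram2 n (normalized n A) q c
        - gram2 n (normalized n A) p r + gram2 n (normalized n A) q r) \<Longrightarrow> Q s'"
  shows "wp AddDrift (410 * real n) Q s"
  unfolding AddDrift_def
proof (rule wp_Assign_Seq[where ?T2.0 = "400 * real n + 5"])
  let ?X = "{''acc'', ''k'', ''h''}"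
  let ?two = "Seq (AddKernel ''p'' ''z'' (-1)) (AddKernel ''q'' ''z'' 1)"
  let ?three = "Seq (AddKernel ''q'' ''y'' (-1)) ?two"
  let ?four = "Seq (AddKernel ''p'' ''y'' 1) ?three"
  let ?s = "upd (upd s ''y'' 0 (real c)) ''z'' 0 (real r)"
  have 0: "env n A s'" "s' ''y'' 0 = real c" "s' ''z'' 0 = real r" "s' ''p'' 0 = real p" "s' ''q'' 0 = real q"
    if "agree ?X ?s s'" for s'
    using that assms(1-7) by (auto simp: env_def agree_def)
  show "wp (Seq (Assign ''z'' (Read ''R'' (V ''j'')))
     ?four) (400 * real n + 5) Q
     (upd s ''y'' 0 (val (Read ''P'' (V ''j'')) s))"
  proof (rule wp_Assign_Seq[where ?T2.0 = "400 * real n"])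
    have "wp ?four (400 * real n) Q ?s"
    proof (rule wp_Seq[where ?T1.0 = "100 * real n" and ?T2.0 = "300 * real n"],
        rule wp_AddKernel[OF 0(1,4,2)[OF agree_refl]])
      fix s1 assume 1: "agree ?X ?s s1" "s1 ''h'' 0 = ?s ''h'' 0 + of_int 1 * gram2 n (normalized n A) p c"
      show "wp ?three (300 * real n) Q s1"
      proof (rule wp_Seq[where ?T1.0 = "100 * real n" and ?T2.0 = "200 * real n"],
          rule wp_AddKernel[OF 0(1,5,2)[OF 1(1)]])
        fix s2 assume 2: "agree ?X s1 s2" "s2 ''h'' 0 = s1 ''h'' 0 + of_int (-1) * gram2 n (normalized n A) q c"
        have a2: "agree ?X ?s s2" by (rule agree_trans[OF 1(1) 2(1)]) auto
        show "wp ?two (200 * real n) Q s2"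
        proof (rule wp_Seq[where ?T1.0 = "100 * real n" and ?T2.0 = "100 * real n"],
            rule wp_AddKernel[OF 0(1,4,3)[OF a2]])
          fix s3 assume 3: "agree ?X s2 s3" "s3 ''h'' 0 = s2 ''h'' 0 + of_int (-1) * gram2 n (normalized n A) p r"
          have a3: "agree ?X ?s s3" by (rule agree_trans[OF a2 3(1)]) auto
          show "wp (AddKernel ''q'' ''z'' 1) (100 * real n) Q s3"
          proof (rule wp_AddKernel[OF 0(1,5,3)[OF a3]])
            fix s4 assume 4: "agree ?X s3 s4" "s4 ''h'' 0 = s3 ''h'' 0 + of_int 1 * gram2 n (normalized n A) q r"
            have a4: "agree ?X ?s s4" by (rule agree_trans[OF a3 4(1)]) auto
            show "Q s4"
            proof (rule Q)
              show "agree {''acc'', ''k'', ''h'', ''y'', ''z''} s s4" using a4 by (auto simp: agree_def)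
            qed (use 1 2 3 4 in simp)
          qed (use assms in auto)
        qed (use assms in auto)
      qed (use assms in auto)
    qed (use assms in auto)
    then show "wp ?four (400 * real n) Q
     (upd (upd s ''y'' 0 (val (Read ''P'' (V ''j'')) s)) ''z'' 0
       (val (Read ''R'' (V ''j'')) (upd s ''y'' 0 (val (Read ''P'' (V ''j'')) s))))"
      using assms(3-5) by simp
  qed (use assms in auto)
qed (use assms in auto)

text \<open>The chosen rows overwrite the list in place: cells of \<open>P\<close> below
  \<open>i\<close> hold chosen rows, cells from \<open>2 * i\<close> on the original list, and those
  in between are stale. The pair is saved in \<open>p\<close> and \<open>q\<close> before cell
  \<open>i\<close> is written. A batch that has reached \<open>t^2\<close> pairs is closed before
  the choice, so that the new pair opens the next one.\<close>

definition PairStep :: program where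
  "PairStep = Seq (Assign ''p'' (Read ''P'' (Mul (Const 2) (V ''i''))))
     (Seq (Assign ''q'' (Read ''P'' (Add (Mul (Const 2) (V ''i'')) (Const 1))))
     (Seq (IfElse (Less (Sub (V ''i'') (V ''bs'')) (Mul (V ''t'') (V ''t''))) Skip (Assign ''bs'' (V ''i'')))
     (Seq (Assign ''h'' (Const 0))
     (Seq (For ''j'' (V ''bs'') ''i'' AddDrift)
     (IfElse (Less (Const 0) (V ''h''))
        (Seq (Write ''P'' (V ''i'') (V ''q'')) (Write ''R'' (V ''i'') (V ''p'')))
        (Seq (Write ''P'' (V ''i'') (V ''p'')) (Write ''R'' (V ''i'') (V ''q''))))))))"

definition level_inv ::
  "nat \<Rightarrow> (nat \<Rightarrow> nat \<Rightarrow> real) \<Rightarrow> real \<Rightarrow> (nat \<Rightarrow> nat) \<Rightarrow> nat \<Rightarrow> nat \<Rightarrow> state \<Rightarrow> bool" where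
  "level_inv n A t P l k s \<longleftrightarrow> (\<exists>C R bs. s ''bs'' 0 = real bs \<and>
     balanced n (normalized n A) t C R bs k \<and>
     (\<forall>j<k. s ''P'' j = real (C j) \<and> s ''R'' j = real (R j) \<and>
       ((C j, R j) = (P (2 * j), P (2 * j + 1)) \<or> (C j, R j) = (P (2 * j + 1), P (2 * j)))) \<and>
     (\<forall>j. 2 * k \<le> j \<and> j < 2 * l \<longrightarrow> s ''P'' j = real (P j)))"

abbreviation pair_vars :: "string set" where
  "pair_vars \<equiv> {''acc'', ''k'', ''h'', ''y'', ''z'', ''j'', ''p'', ''q'', ''bs'', ''P'', ''R''}"

lemma wp_PairStep:
  assumes e: "env n A s" and "1 \<le> n" and t: "s ''t'' 0 = t" "1 \<le> t" and k: "s ''i'' 0 = real k" "k < l"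
    and inv: "level_inv n A t P l k s"
    and Q: "\<And>s'. agree pair_vars s s' \<Longrightarrow> level_inv n A t P l (Suc k) s' \<Longrightarrow> Q s'"
  shows "wp PairStep (540 * real n * t\<^sup>2) Q s"
proof -
  let ?N = "normalized n A"
  obtain C R bs0 where bs0: "s ''bs'' 0 = real bs0" and bal0: "balanced n ?N t C R bs0 k"
    and CR: "\<And>j. j < k \<Longrightarrow> s ''P'' j = real (C j) \<and> s ''R'' j = real (R j) \<and>
       ((C j, R j) = (P (2 * j), P (2 * j + 1)) \<or> (C j, R j) = (P (2 * j + 1), P (2 * j)))"
    and P: "\<And>j. 2 * k \<le> j \<Longrightarrow> j < 2 * l \<Longrightarrow> s ''P'' j = real (P j)"
    using inv unfolding level_inv_def by blast
  have "bs0 \<le> k" using bal0 by (simp add: balanced_def)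
  define p q where "p = P (2 * k)" and "q = P (2 * k + 1)"
  have pq: "s ''P'' (2 * k) = real p" "s ''P'' (2 * k + 1) = real q"
    using P[of "2 * k"] P[of "2 * k + 1"] k by (auto simp: p_def q_def)
  define bs where "bs = (if real k - real bs0 < t * t then bs0 else k)"
  have bsk: "bs \<le> k" using \<open>bs0 \<le> k\<close> by (simp add: bs_def)
  have bal: "balanced n ?N t C R bs k"
    using balanced_close[OF bal0] bal0 \<open>bs0 \<le> k\<close> t(2)
    by (auto simp: bs_def power2_eq_square of_nat_diff)
  \<comment> \<open>A batch that stays open has fewer than \<open>t^2\<close> pairs, and otherwise a
    new one starts empty; this limits the cost of a pair to \<open>O(n t^2)\<close>.\<close>
  have small: "real k - real bs \<le> t\<^sup>2" using t(2) by (auto simp: bs_def power2_eq_square)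
  let ?s = "upd (upd (upd (upd s ''p'' 0 (real p)) ''q'' 0 (real q)) ''bs'' 0 (real bs)) ''h'' 0 0"
  have 4: "wp (IfElse (Less (Const 0) (V ''h''))
        (Seq (Write ''P'' (V ''i'') (V ''q'')) (Write ''R'' (V ''i'') (V ''p'')))
        (Seq (Write ''P'' (V ''i'') (V ''p'')) (Write ''R'' (V ''i'') (V ''q'')))) 20 Q s'"
    if a: "agree {''acc'', ''k'', ''h'', ''y'', ''z'', ''j''} ?s s'" and h: "s' ''h'' 0 = drift n ?N C R {bs..<k} p q" for s'
  proof -
    define c r where "c = (if 0 < s' ''h'' 0 then q else p)" and "r = (if 0 < s' ''h'' 0 then p else q)"
    have s': "s' ''i'' 0 = real k" "s' ''p'' 0 = real p" "s' ''q'' 0 = real q" "s' ''bs'' 0 = real bs"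
      "s' ''P'' = s ''P''" "s' ''R'' = s ''R''"
      using a k by (auto simp: agree_def)
    have "balanced n ?N t (C(k := c)) (R(k := r)) bs (Suc k)"
      by (rule balanced_step[OF bal sq_normalized_le]) (auto simp: c_def r_def h)
    then have "level_inv n A t P l (Suc k) (upd (upd s' ''P'' k (real c)) ''R'' k (real r))"
      unfolding level_inv_def using CR P k(2) s'
      by (intro exI[of _ "C(k := c)"] exI[of _ "R(k := r)"] exI[of _ bs])
         (auto simp: c_def r_def p_def q_def less_Suc_eq)
    moreover have "agree pair_vars s (upd (upd s' ''P'' k (real c)) ''R'' k (real r))"
      using a by (auto simp: agree_def)
    ultimately have fin: "Q (upd (upd s' ''P'' k (real c)) ''R'' k (real r))" by (rule Q[rotated])
    show ?thesis
    proof (rule wp_IfElse[where ?T1.0 = 12], goal_cases)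
      case 2
      show ?case
        by (rule wp_Seq[where ?T1.0 = 6 and ?T2.0 = 6], rule wp_Write[where k = k],
            simp, simp, simp add: s', rule wp_Write[where k = k])
           (use 2 s' fin in \<open>auto simp: c_def r_def\<close>)
    next
      case 3
      show ?case
        by (rule wp_Seq[where ?T1.0 = 6 and ?T2.0 = 6], rule wp_Write[where k = k],
            simp, simp, simp add: s', rule wp_Write[where k = k])
           (use 3 s' fin in \<open>auto simp: c_def r_def\<close>)
    qed auto
  qed
  define T where "T = (410 * real n + 12) * (real k - real bs) + 12"
  let ?I = "\<lambda>j s'. agree {''acc'', ''k'', ''h'', ''y'', ''z'', ''j''} ?s s' \<and> s' ''j'' 0 = real j \<and>
      s' ''h'' 0 = drift n ?N C R {bs..<j} p q"
  have 3: "wp (For ''j'' (V ''bs'') ''i'' AddDrift) T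
     (\<lambda>s'. agree {''acc'', ''k'', ''h'', ''y'', ''z'', ''j''} ?s s' \<and> s' ''h'' 0 = drift n ?N C R {bs..<k} p q) ?s"
  proof (rule wp_For[where a = bs and n = k and B = "410 * real n" and
      I = "?I"])
    fix j s'
    assume j: "bs \<le> j" "j < k" and I: "?I j s'" and "s' ''j'' 0 = real j"
    have s': "s' ''p'' 0 = real p" "s' ''q'' 0 = real q"
      "s' ''P'' = s ''P''" "s' ''R'' = s ''R''" "env n A s'"
      using I e by (auto simp: agree_def env_def)
    show "wp AddDrift (410 * real n) (\<lambda>s''. s'' ''j'' 0 = real j \<and>
       ?I (Suc j) (upd s'' ''j'' 0 (real (Suc j)))) s'"
    proof (rule wp_AddDrift[where j = j and c = "C j" and r = "R j" and p = p and q = q])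
      fix s'' assume *: "agree {''acc'', ''k'', ''h'', ''y'', ''z''} s' s''"
        "s'' ''h'' 0 = s' ''h'' 0 + (gram2 n ?N p (C j) - gram2 n ?N q (C j)
        - gram2 n ?N p (R j) + gram2 n ?N q (R j))"
      have "agree {''acc'', ''k'', ''h'', ''y'', ''z'', ''j''} ?s s''"
        by (rule agree_trans[OF conjunct1[OF I] *(1)]) auto
      from agree_upd[OF this, of "''j''" 0 "real (Suc j)"]
      show "s'' ''j'' 0 = real j \<and>
       ?I (Suc j) (upd s'' ''j'' 0 (real (Suc j)))"
        using * I j by (intro conjI) (simp_all add: agreeD[OF *(1)] drift_def)
    qed (use s' I CR j \<open>1 \<le> n\<close> in auto)
  qed (use bsk k(1) in \<open>auto simp: agree_def drift_def T_def\<close>)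
  have "T \<le> (410 * real n + 12) * t\<^sup>2 + 12"
    unfolding T_def using small by (intro add_mono mult_left_mono) auto
  also have "\<dots> + 70 \<le> 540 * real n * t\<^sup>2"
  proof -
    have "1 \<le> t\<^sup>2" using t(2) by simp
    moreover have "1 * t\<^sup>2 \<le> real n * t\<^sup>2" using \<open>1 \<le> n\<close> by (intro mult_right_mono) auto
    ultimately show ?thesis by (simp add: distrib_right)
  qed
  finally have T: "T + 70 \<le> 540 * real n * t\<^sup>2" by simp
  let ?s3 = "upd (upd (upd s ''p'' 0 (real p)) ''q'' 0 (real q)) ''bs'' 0 (real bs)"
  let ?choose = "IfElse (Less (Const 0) (V ''h''))
        (Seq (Write ''P'' (V ''i'') (V ''q'')) (Write ''R'' (V ''i'') (V ''p'')))
        (Seq (Write ''P'' (V ''i'') (V ''p'')) (Write ''R'' (V ''i'') (V ''q'')))"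
  let ?rest = "Seq (Assign ''h'' (Const 0)) (Seq (For ''j'' (V ''bs'') ''i'' AddDrift) ?choose)"
  have 2: "wp ?rest (T + 30) Q ?s3"
  proof (rule wp_Assign_Seq[where ?T2.0 = "T + 20"])
    have "wp (Seq (For ''j'' (V ''bs'') ''i'' AddDrift) ?choose) (T + 20) Q ?s"
      by (rule wp_Seq[where ?T1.0 = T and ?T2.0 = 20], rule wp_mono[OF 3 order_refl]) (use 4 in auto)
    then show "wp (Seq (For ''j'' (V ''bs'') ''i'' AddDrift) ?choose) (T + 20) Q
        (upd ?s3 ''h'' 0 (val (Const 0) ?s3))" by simp
  qed auto
  let ?if = "IfElse (Less (Sub (V ''i'') (V ''bs'')) (Mul (V ''t'') (V ''t''))) Skip (Assign ''bs'' (V ''i''))"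
  let ?s2 = "upd (upd s ''p'' 0 (real p)) ''q'' 0 (real q)"
  have 1: "wp ?if 20 (\<lambda>s'. s' = ?s3) ?s2"
  proof (rule wp_IfElse[where ?T1.0 = 5], goal_cases)
    case 2
    then have "bs = bs0" using k bs0 t by (simp add: bs_def)
    then have "?s2 = ?s3" using bs0 by (auto simp: fun_eq_iff)
    then show ?case by (intro wp_Skip) auto
  next
    case 3
    then have "bs = k" using k bs0 t by (simp add: bs_def)
    then show ?case using k by (intro wp_Assign) auto
  qed auto
  have "wp (Seq ?if ?rest) (T + 50) Q ?s2"
    by (rule wp_Seq[where ?T1.0 = 20 and ?T2.0 = "T + 30"], rule wp_mono[OF 1 order_refl])
       (use 2 in auto)
  then show ?thesis unfolding PairStep_def
    by (intro wp_Assign_Seq[where ?T2.0 = "T + 60"] wp_Assign_Seq[where ?T2.0 = "T + 50"])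
       (use k pq T in auto)
qed

section \<open>Halving the list\<close>

definition HalveStep :: program where
  "HalveStep = Seq (Assign ''half'' (Div (V ''len'') (Const 2))) (Seq (Assign ''bs'' (Const 0))
     (Seq (For ''i'' (Const 0) ''half'' PairStep) (Seq (Assign ''len'' (V ''half''))
     (Assign ''t'' (Mul (Div (Const 5) (Const 4)) (V ''t''))))))"

abbreviation halve_vars :: "string set" where
  "halve_vars \<equiv> pair_vars \<union> {''half'', ''i'', ''len'', ''t''}"

lemma wp_HalveStep:
  assumes e: "env n A s" and "1 \<le> n" and t: "s ''t'' 0 = t" "1 \<le> t"
    and len: "s ''len'' 0 = real (2 * l)" "0 < l" and P: "\<And>j. j < 2 * l \<Longrightarrow> s ''P'' j = real (P j)"
    and rep: "represents n (normalized n A) H P (2 * l) e"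
    and Q: "\<And>s' C. agree halve_vars s s' \<Longrightarrow> s' ''t'' 0 = 5 / 4 * t \<Longrightarrow> s' ''len'' 0 = real l \<Longrightarrow>
      (\<And>j. j < l \<Longrightarrow> s' ''P'' j = real (C j)) \<Longrightarrow>
      represents n (normalized n A) H C l (e + (1 / t + 1 / sqrt (real l))) \<Longrightarrow> Q s'"
  shows "wp HalveStep (610 * real n * t\<^sup>2 * real l) Q s"
proof -
  let ?s = "upd (upd s ''half'' 0 (real l)) ''bs'' 0 0"
  let ?X = "pair_vars \<union> {''i''}"
  define T where "T = (540 * real n * t\<^sup>2 + 12) * real l + 11"
  have 1: "wp (For ''i'' (Const 0) ''half'' PairStep) T
     (\<lambda>s'. agree ?X ?s s' \<and> level_inv n A t P l l s') ?s"
  proof (rule wp_For[where a = 0 and n = l and B = "540 * real n * t\<^sup>2" and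
      I = "\<lambda>k s'. agree ?X ?s s' \<and> s' ''i'' 0 = real k \<and> level_inv n A t P l k s'"])
    have "level_inv n A t P l 0 (upd ?s ''i'' 0 (real 0))"
      unfolding level_inv_def using balanced_0 P by (intro exI[of _ "\<lambda>_. 0"] exI[of _ 0]) auto
    then show "agree ?X ?s (upd ?s ''i'' 0 (real 0)) \<and> upd ?s ''i'' 0 (real 0) ''i'' 0 = real 0
        \<and> level_inv n A t P l 0 (upd ?s ''i'' 0 (real 0))"
      by (auto simp: agree_def)
  next
    fix k s'
    assume k: "k < l" and I: "agree ?X ?s s' \<and> s' ''i'' 0 = real k \<and> level_inv n A t P l k s'"
    note a = conjunct1[OF I]
    have es: "env n A s'" by (rule env_agree[OF _ a]) (use e in auto)
    have ts: "s' ''t'' 0 = t" using agreeD[OF a, of "''t''"] t by simp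
    show "wp PairStep (540 * real n * t\<^sup>2) (\<lambda>s''. s'' ''i'' 0 = real k \<and>
       agree ?X ?s (upd s'' ''i'' 0 (real (Suc k))) \<and>
       upd s'' ''i'' 0 (real (Suc k)) ''i'' 0 = real (Suc k) \<and>
       level_inv n A t P l (Suc k) (upd s'' ''i'' 0 (real (Suc k)))) s'"
    proof (rule wp_PairStep[OF es \<open>1 \<le> n\<close> ts t(2) _ k])
      fix s'' assume a2: "agree pair_vars s' s''" and lev: "level_inv n A t P l (Suc k) s''"
      have "agree ?X ?s s''" by (rule agree_trans[OF a a2]) auto
      from agree_upd[OF this, of "''i''" 0 "real (Suc k)"]
      show "s'' ''i'' 0 = real k \<and>
       agree ?X ?s (upd s'' ''i'' 0 (real (Suc k))) \<and>
       upd s'' ''i'' 0 (real (Suc k)) ''i'' 0 = real (Suc k) \<and>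
       level_inv n A t P l (Suc k) (upd s'' ''i'' 0 (real (Suc k)))"
        using lev I agreeD[OF a2, of "''i''"] by (intro conjI) (simp_all add: level_inv_def)
    qed (use I in auto)
  qed (auto simp: T_def agree_def)
  have 2: "wp (Seq (Assign ''len'' (V ''half'')) (Assign ''t'' (Mul (Div (Const 5) (Const 4)) (V ''t'')))) 12 Q s'"
    if s': "agree ?X ?s s'" "level_inv n A t P l l s'" for s'
  proof -
    have eq: "s' ''half'' 0 = real l" "s' ''t'' 0 = t"
      using agreeD[OF s'(1), of "''half''"] agreeD[OF s'(1), of "''t''"] t by simp_all
    obtain C R bs where C: "balanced n (normalized n A) t C R bs l"
      "\<And>j. j < l \<Longrightarrow> s' ''P'' j = real (C j) \<and>
       ((C j, R j) = (P (2 * j), P (2 * j + 1)) \<or> (C j, R j) = (P (2 * j + 1), P (2 * j)))"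
      using s'(2) unfolding level_inv_def by blast
    have rep': "represents n (normalized n A) H C l (e + (1 / t + 1 / sqrt (real l)))"
      by (rule represents_halve[OF rep _ C(1) len(2)]) (use C(2) t in auto)
    have a: "agree halve_vars s s'" using s'(1) by (auto simp: agree_def)
    let ?f = "upd (upd s' ''len'' 0 (real l)) ''t'' 0 (5 / 4 * t)"
    have "agree halve_vars s ?f" by (intro agree_upd a) auto
    then have "Q ?f" by (rule Q[where C = C]) (use C(2) rep' in auto)
    then show ?thesis by (intro wp_Assign_Seq[where ?T2.0 = 8] wp_Assign) (use eq in auto)
  qed
  have T: "T + 35 \<le> 610 * real n * t\<^sup>2 * real l"
  proof -
    have "1 * 1 \<le> real n * t\<^sup>2" using \<open>1 \<le> n\<close> t by (intro mult_mono) auto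
    then have "real l * 1 \<le> real l * (real n * t\<^sup>2)" by (intro mult_left_mono) auto
    moreover have "1 \<le> real l" using len by simp
    moreover have "T = 540 * (real l * (real n * t\<^sup>2)) + 12 * real l + 11"
      by (simp add: T_def algebra_simps)
    moreover have "610 * real n * t\<^sup>2 * real l = 610 * (real l * (real n * t\<^sup>2))" by simp
    ultimately show ?thesis by linarith
  qed
  have "wp (Seq (For ''i'' (Const 0) ''half'' PairStep) (Seq (Assign ''len'' (V ''half''))
     (Assign ''t'' (Mul (Div (Const 5) (Const 4)) (V ''t''))))) (T + 12) Q ?s"
    by (rule wp_Seq[where ?T1.0 = T and ?T2.0 = 12], rule wp_mono[OF 1 order_refl]) (use 2 in auto)
  then show ?thesis unfolding HalveStep_def
    by (intro wp_Assign_Seq[where ?T2.0 = "T + 20"] wp_Assign_Seq[where ?T2.0 = "T + 12"])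
       (use len T in auto)
qed

text \<open>
  The numbers are chosen such that \<open>5/t = 1/(32m\<^sup>2)\<close> and \<open>6/\<surd>L0 = 1/(32m\<^sup>2)\<close>, where \<open>m\<close> is an
  integer approximating \<open>1/\<epsilon>\<close> from above.
\<close>

definition Sample :: program where
  "Sample = Seq (Assign ''t'' (Mul (Const 160) (Mul (V ''m'') (V ''m''))))
     (Seq (Assign ''L0'' (Mul (Const 36864) (Mul (Mul (V ''m'') (V ''m'')) (Mul (V ''m'') (V ''m'')))))
     (Seq (Assign ''len'' (Const 1))
     (Seq (While (Less (V ''len'') (V ''n'')) (Assign ''len'' (Mul (Const 2) (V ''len''))))
     (Seq (For ''i'' (Const 0) ''len'' (Write ''P'' (V ''i'') (V ''i'')))
     (While (Less (V ''L0'') (V ''len'')) HalveStep)))))"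

abbreviation sample_vars :: "string set" where
  "sample_vars \<equiv> halve_vars \<union> {''L0''}"

lemma wp_doubling:
  assumes "s ''n'' 0 = real n" "1 \<le> n" "s ''len'' 0 = 1"
    and Q: "\<And>s' a. agree {''len''} s s' \<Longrightarrow> s' ''len'' 0 = real (2 ^ a) \<Longrightarrow> n \<le> 2 ^ a \<Longrightarrow> 2 ^ a \<le> 2 * n \<Longrightarrow> Q s'"
  shows "wp (While (Less (V ''len'') (V ''n'')) (Assign ''len'' (Mul (Const 2) (V ''len'')))) (24 * real n + 6) Q s"
proof -
  let ?I = "\<lambda>s'. agree {''len''} s s' \<and> (\<exists>a. s' ''len'' 0 = real (2 ^ a) \<and> 2 ^ a \<le> 2 * n)"
  \<comment> \<open>A potential linear in the length is enough: doubling adds at least 1, and time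
    \<open>O(n)\<close> is affordable.\<close>
  let ?\<tau> = "\<lambda>s'. 12 * (2 * real n - s' ''len'' 0) + 6 :: real" and ?b = "Less (V ''len'') (V ''n'')"
  show ?thesis
  proof (rule wp_While[where
      I = "?I" and
      \<tau> = "?\<tau>" and T = "\<lambda>_. 6"])
    show "?I s"
      using assms by (auto intro: exI[of _ 0])
  next
    fix s' assume I: "?I s'"
    then obtain a where a: "s' ''len'' 0 = real (2 ^ a)" "2 ^ a \<le> 2 * n" by blast
    have n: "s' ''n'' 0 = real n" using agreeD[OF conjunct1[OF I], of "''n''"] assms by simp
    have "real (2 ^ a) \<le> real (2 * n)" using a(2) of_nat_le_iff by blast
    then show "test_defined ?b s' \<and>
        real (1 + test_cost ?b) \<le> ?\<tau> s'"
      using a by simp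
    show "wp (Assign ''len'' (Mul (Const 2) (V ''len''))) 6
       (\<lambda>s''. ?I s'' \<and>
         real (1 + test_cost ?b) + 6 + ?\<tau> s''
         \<le> ?\<tau> s') s'" if "test_val ?b s'"
    proof (rule wp_Assign, goal_cases)
      case 2
      have "real (2 ^ a) < real n" using that a n by simp
      then have "2 ^ Suc a \<le> 2 * n" using of_nat_less_iff by simp
      moreover have "(1::real) \<le> 2 ^ a" by simp
      moreover have "agree {''len''} s (upd s' ''len'' 0 (2 * real (2 ^ a)))"
        using I by (intro agree_upd) auto
      ultimately show ?case using a by (auto intro!: exI[of _ "Suc a"])
    qed auto
    show "Q s'" if "\<not> test_val ?b s'"
    proof (rule Q[where a = a])
      have "real n \<le> real (2 ^ a)" using that a n by simp
      then show "n \<le> 2 ^ a" using of_nat_le_iff by blast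
    qed (use I a in auto)
  qed (use assms in auto)
qed

lemma error_potential_init:
  assumes "1 \<le> m" "0 < H"
  shows "error_potential (36864 * real m ^ 4) (160 * (real m)\<^sup>2) (real H) \<le> 1 / (16 * (real m)\<^sup>2)"
proof -
  have "sqrt (36864 * real m ^ 4) = 192 * (real m)\<^sup>2"
    by (intro real_sqrt_unique) (auto simp: power2_eq_square eval_nat_numeral)
  then have "error_potential (36864 * real m ^ 4) (160 * (real m)\<^sup>2) (real H)
      = 5 / (160 * (real m)\<^sup>2) + max 0 (6 / (192 * (real m)\<^sup>2) - 4 / sqrt (real H))"
    by (simp only: error_potential_def)
  also have "\<dots> \<le> 5 / (160 * (real m)\<^sup>2) + 6 / (192 * (real m)\<^sup>2)"
    by (intro add_left_mono max.boundedI) auto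
  also have "\<dots> = 1 / (16 * (real m)\<^sup>2)" using assms by (simp add: field_simps)
  finally show ?thesis .
qed

lemma wp_Sample:
  assumes e: "env n A s" and "1 \<le> n" and m: "s ''m'' 0 = real m" "1 \<le> m"
    and Q: "\<And>s' P L H. agree sample_vars s s' \<Longrightarrow> s' ''len'' 0 = real L \<Longrightarrow> 0 < L \<Longrightarrow>
      real L \<le> 36864 * real m ^ 4 \<Longrightarrow> (\<And>j. j < L \<Longrightarrow> s' ''P'' j = real (P j)) \<Longrightarrow>
      0 < H \<Longrightarrow> H \<le> 2 * n \<Longrightarrow>
      represents n (normalized n A) H P L (1 / (16 * (real m)\<^sup>2)) \<Longrightarrow> Q s'"
  shows "wp Sample (82000000 * real m ^ 4 * (real n)\<^sup>2) Q s"
proof -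
  let ?N = "normalized n A"
  define t0 where "t0 = 160 * (real m)\<^sup>2"
  define L0 where "L0 = 36864 * real m ^ 4"
  have "1 \<le> real m" using m by simp
  then have "1 \<le> (real m)\<^sup>2" "1 \<le> real m ^ 4" by simp_all
  then have t0: "1 \<le> t0" and L0: "1 \<le> L0" by (simp_all add: t0_def L0_def)
  have loop: "wp (While (Less (V ''L0'') (V ''len'')) HalveStep) (81920000 * real m ^ 4 * (real n)\<^sup>2 + 10) Q s1"
    if s1: "agree sample_vars s s1" "s1 ''t'' 0 = t0" "s1 ''L0'' 0 = L0" "s1 ''len'' 0 = real (2 ^ h)"
      "n \<le> 2 ^ h" "2 ^ h \<le> 2 * n" "\<And>j. j < 2 ^ h \<Longrightarrow> s1 ''P'' j = real j" for s1 h
  proof -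
    define E where "E = error_potential L0 t0 (real (2 ^ h))"
    define J where "J s' \<longleftrightarrow> agree sample_vars s s' \<and> s' ''L0'' 0 = L0 \<and> (\<exists>a t P e.
      s' ''len'' 0 = real (2 ^ a) \<and> s' ''t'' 0 = t \<and> 1 \<le> t \<and> (\<forall>j<2 ^ a. s' ''P'' j = real (P j)) \<and>
      represents n ?N (2 ^ h) P (2 ^ a) e \<and> e + error_potential L0 t (real (2 ^ a)) \<le> E)" for s' :: state
    \<comment> \<open>For a list of length \<open>2 l\<close> a round takes
      \<open>610 n t^2 l\<close> operations. It multiplies \<open>t^2\<close> by
      \<open>25/16\<close> and halves the length, so the potential falls from
      \<open>3200 n t^2 l\<close> to \<open>2500 n t^2 l\<close> (plus 10), which pays for the
      round. The initial values \<open>t = 160 m^2\<close> and length at most \<open>2 n\<close>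
      give the total.\<close>
    define \<tau> where "\<tau> s' = 1600 * real n * s' ''len'' 0 * (s' ''t'' 0)\<^sup>2 + 10" for s' :: state
    show ?thesis
    proof (rule wp_While[where I = J and \<tau> = \<tau> and
        T = "\<lambda>s'. 610 * real n * (s' ''t'' 0)\<^sup>2 * (s' ''len'' 0 / 2)"])
      \<comment> \<open>The padded list of all rows is exact: the rows from \<open>n\<close> on
        vanish. The error therefore starts at 0.\<close>
      have "represents n ?N (2 ^ h) (\<lambda>i. i) (2 ^ h) 0"
        using s1(5) by (intro represents_all) (auto simp: normalized_def weight_def)
      then show "J s1" unfolding J_def using s1 t0
        by (intro conjI exI[of _ h] exI[of _ t0] exI[of _ "\<lambda>i. i"] exI[of _ 0]) (auto simp: E_def)
    next
      have "real (2 ^ h) \<le> real (2 * n)" using s1(6) of_nat_le_iff by blast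
      then have "1600 * real n * real (2 ^ h) * t0\<^sup>2 \<le> 1600 * real n * (2 * real n) * t0\<^sup>2"
        by (intro mult_right_mono mult_left_mono) auto
      also have "\<dots> = 81920000 * real m ^ 4 * (real n)\<^sup>2"
        by (simp add: t0_def power2_eq_square eval_nat_numeral)
      finally show "\<tau> s1 \<le> 81920000 * real m ^ 4 * (real n)\<^sup>2 + 10" using s1 by (simp add: \<tau>_def)
    next
      fix s' assume "J s'"
      then obtain a t P e where J: "agree sample_vars s s'" "s' ''L0'' 0 = L0"
        "s' ''len'' 0 = real (2 ^ a)" "s' ''t'' 0 = t" "1 \<le> t" "\<And>j. j < 2 ^ a \<Longrightarrow> s' ''P'' j = real (P j)"
        "represents n ?N (2 ^ h) P (2 ^ a) e" "e + error_potential L0 t (real (2 ^ a)) \<le> E"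
        unfolding J_def by blast
      have pot: "0 \<le> error_potential L0 t (real (2 ^ a))" using J(5) by (simp add: error_potential_def)
      show "test_defined (Less (V ''L0'') (V ''len'')) s' \<and>
          real (1 + test_cost (Less (V ''L0'') (V ''len''))) \<le> \<tau> s'"
        using J by (simp add: \<tau>_def)
      show "wp HalveStep (610 * real n * (s' ''t'' 0)\<^sup>2 * (s' ''len'' 0 / 2)) (\<lambda>s''. J s'' \<and>
          real (1 + test_cost (Less (V ''L0'') (V ''len'')))
          + 610 * real n * (s' ''t'' 0)\<^sup>2 * (s' ''len'' 0 / 2) + \<tau> s'' \<le> \<tau> s') s'"
        if "test_val (Less (V ''L0'') (V ''len'')) s'"
      proof -
        have gt: "L0 < real (2 ^ a)" using that J by simp
        have "a \<noteq> 0"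
        proof
          assume "a = 0"
          then show False using gt L0 by simp
        qed
        then obtain b where b: "a = Suc b" using not0_implies_Suc by blast
        define l :: nat where "l = 2 ^ b"
        have l: "2 ^ a = 2 * l" "0 < l" by (simp_all add: b l_def)
        have len: "s' ''len'' 0 = real (2 * l)" using J(3) l by simp
        have es: "env n A s'" by (rule env_agree[OF e J(1)]) auto
        have "wp HalveStep (610 * real n * t\<^sup>2 * real l) (\<lambda>s''. J s'' \<and> 6 + 610 * real n * t\<^sup>2 * real l + \<tau> s'' \<le> \<tau> s') s'"
        proof (rule wp_HalveStep[OF es \<open>1 \<le> n\<close> J(4,5) len l(2) J(6)[unfolded l(1)] J(7)[unfolded l(1)]])
          fix s'' C assume *: "agree halve_vars s' s''" "s'' ''t'' 0 = 5 / 4 * t" "s'' ''len'' 0 = real l"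
            "\<And>j. j < l \<Longrightarrow> s'' ''P'' j = real (C j)"
            "represents n ?N (2 ^ h) C l (e + (1 / t + 1 / sqrt (real l)))"
          have "1 / t + 1 / sqrt (real l) + error_potential L0 (5 / 4 * t) (real l)
              \<le> error_potential L0 t (2 * real l)"
            by (rule error_potential_step) (use gt l L0 J(5) in auto)
          then have "e + (1 / t + 1 / sqrt (real l)) + error_potential L0 (5 / 4 * t) (real l) \<le> E"
            using J(8) l by simp
          moreover have "agree sample_vars s s''" by (rule agree_trans[OF J(1) *(1)]) auto
          ultimately have "J s''" unfolding J_def using * J(2,5) agreeD[OF *(1), of "''L0''"]
            by (intro conjI exI[of _ b] exI[of _ "5 / 4 * t"] exI[of _ C] exI[of _ "e + (1 / t + 1 / sqrt (real l))"])
               (auto simp: l_def)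
          moreover have "6 + 610 * real n * t\<^sup>2 * real l + \<tau> s'' \<le> \<tau> s'"
          proof -
            have "1 * 1 * 1 \<le> real n * t\<^sup>2 * real l"
              using \<open>1 \<le> n\<close> J(5) l(2) by (intro mult_mono) auto
            then have "6 + 610 * (real n * t\<^sup>2 * real l) + (2500 * (real n * t\<^sup>2 * real l) + 10)
                \<le> 3200 * (real n * t\<^sup>2 * real l) + 10" by linarith
            then show ?thesis unfolding \<tau>_def *(2,3) J(4) len
              by (simp add: power_mult_distrib power_divide mult_ac)
          qed
          ultimately show "J s'' \<and> 6 + 610 * real n * t\<^sup>2 * real l + \<tau> s'' \<le> \<tau> s'" by simp
        qed
        then show ?thesis using J(4) len by simp
      qed
      show "Q s'" if "\<not> test_val (Less (V ''L0'') (V ''len'')) s'"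
      proof (rule Q[OF J(1,3)])
        show "real (2 ^ a) \<le> 36864 * real m ^ 4" using that J by (simp add: L0_def)
        have "e \<le> 1 / (16 * (real m)\<^sup>2)"
          using J(8) pot error_potential_init[OF m(2), of "2 ^ h"] by (simp add: E_def L0_def t0_def)
        then show "represents n ?N (2 ^ h) P (2 ^ a) (1 / (16 * (real m)\<^sup>2))"
          using J(7) by (rule represents_mono[rotated])
      qed (use J s1 in auto)
    qed
  qed
  let ?loop = "While (Less (V ''L0'') (V ''len'')) HalveStep"
  let ?init = "For ''i'' (Const 0) ''len'' (Write ''P'' (V ''i'') (V ''i''))"
  let ?T = "81920000 * real m ^ 4 * (real n)\<^sup>2"
  have init: "wp (Seq ?init ?loop) (?T + 34 * real n + 30) Q s1"
    if s1: "agree sample_vars s s1" "s1 ''t'' 0 = t0" "s1 ''L0'' 0 = L0" "s1 ''len'' 0 = real (2 ^ h)"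
      "n \<le> 2 ^ h" "2 ^ h \<le> 2 * n" for s1 h
  proof (rule wp_Seq[where ?T1.0 = "34 * real n + 20" and ?T2.0 = "?T + 10"])
    have "real (2 ^ h) \<le> real (2 * n)" using s1(6) of_nat_le_iff by blast
    then have T: "(5 + 12) * (real (2 ^ h) - real 0) + 10 + real (cost (Const 0)) \<le> 34 * real n + 20" by simp
    show "wp ?init (34 * real n + 20) (wp ?loop (?T + 10) Q) s1"
    proof (rule wp_For[where a = 0 and n = "2 ^ h" and B = 5 and I = "\<lambda>k s'. agree {''P'', ''i''} s1 s' \<and>
        s' ''i'' 0 = real k \<and> (\<forall>j<k. s' ''P'' j = real j)", OF _ _ _ _ _ _ _ T])
      fix k s' assume k: "k < 2 ^ h" and I: "agree {''P'', ''i''} s1 s' \<and> s' ''i'' 0 = real k \<and> (\<forall>j<k. s' ''P'' j = real j)"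
      have "agree {''P'', ''i''} s1 (upd (upd s' ''P'' k (real k)) ''i'' 0 (real (Suc k)))"
        using I by (intro agree_upd) auto
      then show "wp (Write ''P'' (V ''i'') (V ''i'')) 5 (\<lambda>s''. s'' ''i'' 0 = real k \<and>
          agree {''P'', ''i''} s1 (upd s'' ''i'' 0 (real (Suc k))) \<and>
          upd s'' ''i'' 0 (real (Suc k)) ''i'' 0 = real (Suc k) \<and>
          (\<forall>j<Suc k. upd s'' ''i'' 0 (real (Suc k)) ''P'' j = real j)) s'"
        using I by (intro wp_Write[where k = k]) (auto simp: less_Suc_eq)
    next
      fix s' assume I: "agree {''P'', ''i''} s1 s' \<and> s' ''i'' 0 = real (2 ^ h) \<and> (\<forall>j<2 ^ h. s' ''P'' j = real j)"
      note a = conjunct1[OF I]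
      show "wp ?loop (?T + 10) Q s'"
      proof (rule loop[where h = h])
        show "agree sample_vars s s'" by (rule agree_trans[OF s1(1) a]) auto
      qed (use I s1 agreeD[OF a, of "''t''"] agreeD[OF a, of "''L0''"] agreeD[OF a, of "''len''"] in auto)
    qed (use s1 in \<open>auto simp: agree_def\<close>)
  qed simp
  let ?double = "While (Less (V ''len'') (V ''n'')) (Assign ''len'' (Mul (Const 2) (V ''len'')))"
  let ?s = "upd (upd (upd s ''t'' 0 t0) ''L0'' 0 L0) ''len'' 0 1"
  have "wp (Seq ?double (Seq ?init ?loop)) (?T + 58 * real n + 40) Q ?s"
  proof (rule wp_Seq[where ?T1.0 = "24 * real n + 6" and ?T2.0 = "?T + 34 * real n + 30"])
    show "wp ?double (24 * real n + 6) (wp (Seq ?init ?loop) (?T + 34 * real n + 30) Q) ?s"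
    proof (rule wp_doubling[OF _ \<open>1 \<le> n\<close>])
      fix s' a assume *: "agree {''len''} ?s s'" "s' ''len'' 0 = real (2 ^ a)" "n \<le> 2 ^ a" "2 ^ a \<le> 2 * n"
      have 0: "agree sample_vars s ?s" by (intro agree_upd agree_refl) auto
      show "wp (Seq ?init ?loop) (?T + 34 * real n + 30) Q s'"
      proof (rule init[where h = a])
        show "agree sample_vars s s'" by (rule agree_trans[OF 0 *(1)]) auto
      qed (use * agreeD[OF *(1), of "''t''"] agreeD[OF *(1), of "''L0''"] in auto)
    qed (use e in \<open>auto simp: env_def\<close>)
  qed simp
  moreover have "?T + 58 * real n + 100 \<le> 82000000 * real m ^ 4 * (real n)\<^sup>2"
  proof -
    have "real n * 1 \<le> real n * real n" "1 * 1 \<le> real n * real n"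
      using \<open>1 \<le> n\<close> by (intro mult_left_mono mult_mono; simp)+
    moreover have "1 * (real n)\<^sup>2 \<le> real m ^ 4 * (real n)\<^sup>2"
      using \<open>1 \<le> real m ^ 4\<close> by (intro mult_right_mono) auto
    ultimately show ?thesis unfolding power2_eq_square[of "real n"] by linarith
  qed
  ultimately show ?thesis unfolding Sample_def
    by (intro wp_Assign_Seq[where ?T2.0 = "?T + 58 * real n + 80"] wp_Assign_Seq[where ?T2.0 = "?T + 58 * real n + 60"]
        wp_Assign_Seq[where ?T2.0 = "?T + 58 * real n + 40"])
       (use m in \<open>auto simp: t0_def L0_def power2_eq_square eval_nat_numeral mult_ac\<close>)
qed

section \<open>Searching for a cut and updating the approximation\<close>

lemma le_square_bounds:
  assumes "1 \<le> n"
  shows "real n \<le> (real n)\<^sup>2" "1 \<le> (real n)\<^sup>2"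
  using assms by (simp_all add: power2_eq_square mult_le_cancel_left1 flip: of_nat_mult)

definition ForSum :: "expr \<Rightarrow> program \<Rightarrow> program" where
  "ForSum e w = For ''j'' (Const 0) ''n'' (Seq (SumTo ''acc'' ''k'' ''n'' e) w)"

text \<open>\<open>e\<close> is evaluated while \<open>a\<close> is only partly filled; its value
  must therefore be the same in all states that differ from \<open>s\<close> in \<open>a\<close> and
  the work variables.\<close>

lemma wp_ForSum:
  assumes n: "s ''n'' 0 = real n" and a: "a \<notin> {''n'', ''acc'', ''k'', ''j''}"
    and e: "\<And>j k s'. j < n \<Longrightarrow> k < n \<Longrightarrow> agree {''acc'', ''k'', ''j'', a} s s' \<Longrightarrow> s' ''j'' 0 = real j \<Longrightarrow>
      s' ''k'' 0 = real k \<Longrightarrow> defined e s' \<and> val e s' = g j k"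
    and w: "\<And>j s'. j < n \<Longrightarrow> agree {''acc'', ''k'', ''j'', a} s s' \<Longrightarrow> s' ''j'' 0 = real j \<Longrightarrow>
      s' ''acc'' 0 = (\<Sum>k<n. g j k) \<Longrightarrow> wp w B (\<lambda>s''. s'' = upd s' a j (F j)) s'"
    and T: "1 \<le> n" "0 \<le> B" "real (cost e) + B + 55 \<le> t"
    and Q: "\<And>s'. agree {''acc'', ''k'', ''j'', a} s s' \<Longrightarrow> (\<And>j. j < n \<Longrightarrow> s' a j = F j) \<Longrightarrow>
      (\<And>j. n \<le> j \<Longrightarrow> s' a j = s a j) \<Longrightarrow> Q s'"
  shows "wp (ForSum e w) (t * (real n)\<^sup>2) Q s"
proof -
  let ?I = "\<lambda>j s'. agree {''acc'', ''k'', ''j'', a} s s' \<and> s' ''j'' 0 = real j \<and>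
      (\<forall>i<j. s' a i = F i) \<and> (\<forall>i\<ge>n. s' a i = s a i)"
  show ?thesis unfolding ForSum_def
  proof (rule wp_For[where a = 0 and n = n and B = "(real (cost e) + 17) * real n + 15 + B" and
      I = "?I"])
    fix j s'
    assume j: "j < n" and I: "?I j s'" and n': "s' ''n'' 0 = real n"
    show "wp (Seq (SumTo ''acc'' ''k'' ''n'' e) w) ((real (cost e) + 17) * real n + 15 + B)
      (\<lambda>s''. s'' ''j'' 0 = real j \<and> ?I (Suc j) (upd s'' ''j'' 0 (real (Suc j)))) s'"
    proof (rule wp_Seq[where ?T1.0 = "(real (cost e) + 17) * real n + 15" and ?T2.0 = B],
        rule wp_SumTo[where n = n and g = "g j"])
      fix k s'' assume k: "k < n" "agree {''acc'', ''k''} s' s''" "s'' ''k'' 0 = real k"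
      have ag: "agree {''acc'', ''k'', ''j'', a} s s''" by (rule agree_trans[OF conjunct1[OF I] k(2)]) auto
      have "s'' ''j'' 0 = real j" using I agreeD[OF k(2), of "''j''"] by simp
      from e[OF j k(1) ag this k(3)] show "defined e s'' \<and> val e s'' = g j k" .
    next
      fix s'' assume s'': "agree {''acc'', ''k''} s' s''" "s'' ''acc'' 0 = sum (g j) {..<n}"
      have ag: "agree {''acc'', ''k'', ''j'', a} s s''" by (rule agree_trans[OF conjunct1[OF I] s''(1)]) auto
      have eq: "s'' ''j'' = s' ''j''" "s'' a = s' a" using agreeD[OF s''(1)] a by auto
      have "agree {''acc'', ''k'', ''j'', a} s (upd (upd s'' a j (F j)) ''j'' 0 (real (Suc j)))"
        using ag by (intro agree_upd) auto
      then show "wp w B (\<lambda>s''. s'' ''j'' 0 = real j \<and> ?I (Suc j) (upd s'' ''j'' 0 (real (Suc j)))) s''"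
        using I a eq j by (intro wp_mono[OF w[OF j ag] order_refl]) (auto simp: s'' less_Suc_eq)
    qed (use n' in auto)
  next
    have "real n * (B + 27) \<le> (real n)\<^sup>2 * (B + 27)" "1 * 11 \<le> (real n)\<^sup>2 * 11"
      using le_square_bounds[OF T(1)] T(2) by (intro mult_right_mono; simp)+
    moreover have "(real (cost e) + B + 55) * (real n)\<^sup>2 \<le> t * (real n)\<^sup>2"
      using T(3) by (intro mult_right_mono) auto
    moreover have "((real (cost e) + 17) * real n + 15 + B + 12) * real n
        = (real (cost e) + 17) * (real n)\<^sup>2 + real n * (B + 27)"
      by (simp add: power2_eq_square algebra_simps)
    ultimately show "((real (cost e) + 17) * real n + 15 + B + 12) * (real n - real 0) + 10 + real (cost (Const 0))
        \<le> t * (real n)\<^sup>2"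
      by (simp add: algebra_simps)
  next
    fix s' assume "?I n s'"
    then show "Q s'" by (intro Q) auto
  next
    show "agree {''acc'', ''k'', ''j'', a} s (upd s ''j'' 0 (real 0)) \<and> upd s ''j'' 0 (real 0) ''j'' 0 = real 0 \<and>
        (\<forall>i<0. upd s ''j'' 0 (real 0) a i = F i) \<and> (\<forall>i\<ge>n. upd s ''j'' 0 (real 0) a i = s a i)"
      using a by (simp add: agree_upd)
  next
    fix k s' assume "?I k s'"
    then have "s' ''n'' = s ''n''" using a by (intro agreeD[of "{''acc'', ''k'', ''j'', a}"]) auto
    then show "s' ''n'' 0 = real n" using n by simp
  qed simp_all
qed

abbreviation Amat :: "nat \<Rightarrow> state \<Rightarrow> nat \<Rightarrow> nat \<Rightarrow> real" where
  "Amat n s \<equiv> (\<lambda>i j. s ''A'' (i * n + j))"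

section \<open>Weights and sign vectors\<close>

definition Weights :: program where
  "Weights = ForSum (Mul (Read ''A'' (Idx ''j'' ''k'')) (Read ''A'' (Idx ''j'' ''k'')))
     (Write ''V'' (V ''j'') (Div (V ''n'') (Add (V ''n'') (V ''acc''))))"

lemma wp_Weights:
  assumes n: "s ''n'' 0 = real n" "1 \<le> n" and V: "\<And>i. n \<le> i \<Longrightarrow> s ''V'' i = 0"
    and Q: "\<And>s'. agree {''acc'', ''k'', ''j'', ''V''} s s' \<Longrightarrow> env n (Amat n s) s' \<Longrightarrow> Q s'"
  shows "wp Weights (110 * (real n)\<^sup>2) Q s"
  unfolding Weights_def
proof (rule wp_ForSum[where n = n and a = "''V''" and B = 11 and
    g = "\<lambda>j k. (Amat n s j k)\<^sup>2" and F = "weight n (Amat n s)"])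
  fix j s' assume *: "j < n" "agree {''acc'', ''k'', ''j'', ''V''} s s'" "s' ''j'' 0 = real j"
    "s' ''acc'' 0 = (\<Sum>k<n. (Amat n s j k)\<^sup>2)"
  have "s' ''n'' 0 = real n" using agreeD[OF *(2), of "''n''"] n by simp
  moreover have "real n + (\<Sum>k<n. (Amat n s j k)\<^sup>2) \<noteq> 0"
    using n(2) sum_nonneg[of "{..<n}" "\<lambda>k. (Amat n s j k)\<^sup>2"] by simp
  ultimately show "wp (Write ''V'' (V ''j'') (Div (V ''n'') (Add (V ''n'') (V ''acc'')))) 11
     (\<lambda>s''. s'' = upd s' ''V'' j (weight n (Amat n s) j)) s'"
    using * by (intro wp_Write[where k = j]) (auto simp: weight_def sq_def)
next
  fix s' assume "agree {''acc'', ''k'', ''j'', ''V''} s s'"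
    "\<And>j. j < n \<Longrightarrow> s' ''V'' j = weight n (Amat n s) j" "\<And>j. n \<le> j \<Longrightarrow> s' ''V'' j = s ''V'' j"
  then show "Q s'" using n V by (intro Q) (auto simp: env_def agree_def weight_def)
next
  fix j k s' assume *: "j < n" "k < n" "agree {''acc'', ''k'', ''j'', ''V''} s s'"
    "s' ''j'' 0 = real j" "s' ''k'' 0 = real k"
  have "s' ''A'' = s ''A''" "s' ''n'' = s ''n''" by (rule agreeD[OF *(3)], simp)+
  then show "defined (Mul (Read ''A'' (Idx ''j'' ''k'')) (Read ''A'' (Idx ''j'' ''k''))) s' \<and>
    val (Mul (Read ''A'' (Idx ''j'' ''k'')) (Read ''A'' (Idx ''j'' ''k''))) s' = (Amat n s j k)\<^sup>2"
    by (simp add: * n power2_eq_square)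
qed (use n in auto)

text \<open>If \<open>V\<close> holds the current weights and \<open>q < n\<close>, this is the
  vector \<open>y\<close> of \<open>large_cut_of_row\<close> divided by
  \<open>sqrt (weight n A q)\<close>.\<close>

definition RowY :: program where
  "RowY = ForSum (Mul (Mul (Read ''A'' (Idx ''j'' ''k'')) (Read ''V'' (V ''k''))) (Read ''A'' (Idx ''q'' ''k'')))
     (Write ''Y'' (V ''j'') (Mul (Read ''V'' (V ''j'')) (V ''acc'')))"

definition SignProduct :: "string \<Rightarrow> string \<Rightarrow> program" where
  "SignProduct x y = ForSum (Mul (Read ''A'' (Idx ''j'' ''k'')) (Read x (V ''k'')))
     (IfElse (Less (Const 0) (V ''acc'')) (Write y (V ''j'') (Const 1)) (Write y (V ''j'') (Const (-1))))"

lemma wp_RowY: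
  assumes n: "s ''n'' 0 = real n" "1 \<le> n" and q: "s ''q'' 0 = real q"
    and Q: "\<And>s'. agree {''acc'', ''k'', ''j'', ''Y''} s s' \<Longrightarrow>
      (\<And>j. j < n \<Longrightarrow> s' ''Y'' j = s ''V'' j * (\<Sum>k<n. Amat n s j k * s ''V'' k * Amat n s q k)) \<Longrightarrow> Q s'"
  shows "wp RowY (100 * (real n)\<^sup>2) Q s"
  unfolding RowY_def
proof (rule wp_ForSum[where n = n and a = "''Y''" and B = 10 and
    g = "\<lambda>j k. Amat n s j k * s ''V'' k * Amat n s q k" and
    F = "\<lambda>j. s ''V'' j * (\<Sum>k<n. Amat n s j k * s ''V'' k * Amat n s q k)"])
  fix j s' assume *: "j < n" "agree {''acc'', ''k'', ''j'', ''Y''} s s'" "s' ''j'' 0 = real j"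
    "s' ''acc'' 0 = (\<Sum>k<n. Amat n s j k * s ''V'' k * Amat n s q k)"
  show "wp (Write ''Y'' (V ''j'') (Mul (Read ''V'' (V ''j'')) (V ''acc''))) 10
     (\<lambda>s''. s'' = upd s' ''Y'' j (s ''V'' j * (\<Sum>k<n. Amat n s j k * s ''V'' k * Amat n s q k))) s'"
    using * agreeD[OF *(2), of "''V''"] by (intro wp_Write[where k = j]) auto
next
  fix j k s' assume *: "j < n" "k < n" "agree {''acc'', ''k'', ''j'', ''Y''} s s'"
    "s' ''j'' 0 = real j" "s' ''k'' 0 = real k"
  have "s' ''A'' = s ''A''" "s' ''V'' = s ''V''" "s' ''q'' = s ''q''" "s' ''n'' = s ''n''"
    by (rule agreeD[OF *(3)], simp)+
  then show "defined (Mul (Mul (Read ''A'' (Idx ''j'' ''k'')) (Read ''V'' (V ''k''))) (Read ''A'' (Idx ''q'' ''k''))) s' \<and>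
    val (Mul (Mul (Read ''A'' (Idx ''j'' ''k'')) (Read ''V'' (V ''k''))) (Read ''A'' (Idx ''q'' ''k''))) s'
      = Amat n s j k * s ''V'' k * Amat n s q k"
    by (simp add: * n q)
qed (use n Q in auto)

lemma wp_SignProduct:
  assumes n: "s ''n'' 0 = real n" "1 \<le> n"
    and xy: "x \<notin> {''n'', ''acc'', ''k'', ''j'', ''A'', y}" "y \<notin> {''n'', ''acc'', ''k'', ''j'', ''A''}"
    and Q: "\<And>s'. agree {''acc'', ''k'', ''j'', y} s s' \<Longrightarrow>
      (\<And>j. j < n \<Longrightarrow> s' y j = sgn1 (\<Sum>k<n. Amat n s j k * s x k)) \<Longrightarrow> Q s'"
  shows "wp (SignProduct x y) (100 * (real n)\<^sup>2) Q s"
  unfolding SignProduct_def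
proof (rule wp_ForSum[where n = n and a = y and B = 20 and
    g = "\<lambda>j k. Amat n s j k * s x k" and F = "\<lambda>j. sgn1 (\<Sum>k<n. Amat n s j k * s x k)"])
  fix j s' assume *: "j < n" "agree {''acc'', ''k'', ''j'', y} s s'" "s' ''j'' 0 = real j"
    "s' ''acc'' 0 = (\<Sum>k<n. Amat n s j k * s x k)"
  show "wp (IfElse (Less (Const 0) (V ''acc'')) (Write y (V ''j'') (Const 1)) (Write y (V ''j'') (Const (-1)))) 20
     (\<lambda>s''. s'' = upd s' y j (sgn1 (\<Sum>k<n. Amat n s j k * s x k))) s'"
    using * by (intro wp_IfElse[where ?T1.0 = 8] wp_Write[where k = j]) (auto simp: sgn1_def)
next
  fix j k s' assume *: "j < n" "k < n" "agree {''acc'', ''k'', ''j'', y} s s'"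
    "s' ''j'' 0 = real j" "s' ''k'' 0 = real k"
  have "s' ''A'' = s ''A''" "s' x = s x" "s' ''n'' = s ''n''"
    by (rule agreeD[OF *(3)], use xy in auto)+
  then show "defined (Mul (Read ''A'' (Idx ''j'' ''k'')) (Read x (V ''k''))) s' \<and>
    val (Mul (Read ''A'' (Idx ''j'' ''k'')) (Read x (V ''k''))) s' = Amat n s j k * s x k"
    by (simp add: * n)
qed (use n xy Q in auto)

section \<open>The invariant of the approximation\<close>

definition residual :: "nat \<Rightarrow> nat wgraph \<Rightarrow> (nat \<Rightarrow> nat set) \<Rightarrow> (nat \<Rightarrow> nat set) \<Rightarrow> (nat \<Rightarrow> real) \<Rightarrow> nat
    \<Rightarrow> nat wgraph" where
  "residual n G S T c r x y = G x y - (edge_density {..<n} G + (\<Sum>i<r. c i * K_graph (S i) (T i) x y))"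

text \<open>The energy bound doubles as a counter of the updates. Weights, sample and sign vectors
  do not occur, since every round recomputes them.\<close>

definition good :: "real \<Rightarrow> nat \<Rightarrow> nat wgraph \<Rightarrow> nat \<Rightarrow> state \<Rightarrow> bool" where
  "good \<gamma> n G r s \<longleftrightarrow> s ''n'' 0 = real n \<and> s ''gam'' 0 = \<gamma> \<and> s ''theta'' 0 = 2 * \<gamma> * (real n)\<^sup>2 \<and>
     (\<Sum>i<n. sq n (Amat n s i)) \<le> (real n)\<^sup>2 / 4 - 4 * real r * \<gamma>\<^sup>2 * (real n)\<^sup>2 \<and>
     (\<exists>S T c. outputs s n r S T c \<and>
       (\<forall>i<r. S i \<subseteq> {..<n} \<and> T i \<subseteq> {..<n} \<and> c i \<in> {- \<gamma>, \<gamma>}) \<and>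
       (\<forall>x<n. \<forall>y<n. Amat n s x y = residual n G S T c r x y))"

lemma address_less:
  assumes "i < r" "v < n"
  shows "i * n + v < r * (n::nat)"
proof -
  have "i * n + v < Suc i * n" using assms by simp
  also have "\<dots> \<le> r * n" using assms by (intro mult_le_mono1) simp
  finally show ?thesis .
qed

text \<open>The cells of \<open>S\<close> and \<open>T\<close> from \<open>r * n\<close> on do not
  belong to the output yet. They are scratch space for the pair under test, which an update accepts
  by incrementing \<open>r\<close>, without copying.\<close>

lemma good_frame:
  assumes g: "good \<gamma> n G r s" and a: "agree X s s'" "X \<inter> {''n'', ''gam'', ''theta'', ''A'', ''r'', ''c''} = {}"
    and ST: "\<And>i. i < r * n \<Longrightarrow> s' ''S'' i = s ''S'' i \<and> s' ''T'' i = s ''T'' i"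
  shows "good \<gamma> n G r s'"
proof -
  have eq: "s' ''n'' = s ''n''" "s' ''gam'' = s ''gam''" "s' ''theta'' = s ''theta''" "s' ''A'' = s ''A''"
    "s' ''r'' = s ''r''" "s' ''c'' = s ''c''"
    by (rule agreeD[OF a(1)], use a(2) in auto)+
  have "outputs s' n r S T c" if "outputs s n r S T c" for S T c
    using that ST address_less unfolding outputs_def eq by simp
  then show ?thesis using g unfolding good_def eq by blast
qed

lemma symmetric_residual:
  assumes "graph {..<n} G" "x < n" "y < n"
  shows "residual n G S T c r x y = residual n G S T c r y x"
proof -
  have "G x y = G y x" using assms by (simp add: graph_def weighted_graph_def)
  moreover have "K_graph (S i) (T i) x y = K_graph (S i) (T i) y x" for i
    unfolding K_graph_def by (simp only: conj_commute add.commute)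
  ultimately show ?thesis by (simp add: residual_def)
qed

text \<open>When the square is expanded, the linear term is \<open>- 4 c\<close> times the cut
  value, because \<open>A\<close> is symmetric and \<open>K\<close> is a rank one matrix plus its
  transpose. The quadratic term is at most \<open>4 c^2 n^2\<close>, as the entries of
  \<open>K\<close> are at most 2. The threshold \<open>2 c^2 n^2\<close> makes the gain at least
  twice this loss.\<close>

lemma energy_step:
  assumes sym: "\<And>i j. i < n \<Longrightarrow> j < n \<Longrightarrow> A i j = A j i"
    and ab: "\<And>i. i < n \<Longrightarrow> a i \<in> {0, 1}" "\<And>i. i < n \<Longrightarrow> b i \<in> {0, 1}"
    and c: "c * cut_value n A a b \<ge> 2 * c\<^sup>2 * (real n)\<^sup>2"
  shows "(\<Sum>i<n. sq n (\<lambda>j. A i j - c * (a i * b j + b i * a j)))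
    \<le> (\<Sum>i<n. sq n (A i)) - 4 * c\<^sup>2 * (real n)\<^sup>2"
proof -
  let ?K = "\<lambda>i j. a i * b j + b i * a j"
  have "(\<Sum>i<n. \<Sum>j<n. A i j * (b i * a j)) = (\<Sum>j<n. \<Sum>i<n. A i j * (b i * a j))" by (rule sum.swap)
  also have "\<dots> = (\<Sum>j<n. \<Sum>i<n. A j i * (a j * b i))"
    by (intro sum.cong refl) (use sym in auto)
  finally have "(\<Sum>i<n. \<Sum>j<n. A i j * ?K i j) = 2 * (\<Sum>i<n. \<Sum>j<n. A i j * (a i * b j))"
    by (simp add: distrib_left sum.distrib)
  moreover have "(\<Sum>i<n. \<Sum>j<n. A i j * (a i * b j)) = cut_value n A a b"
    unfolding cut_value_def sum_distrib_left by (intro sum.cong refl) simp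
  ultimately have AK: "(\<Sum>i<n. \<Sum>j<n. A i j * ?K i j) = 2 * cut_value n A a b" by simp
  have "(?K i j)\<^sup>2 \<le> 4" if "i < n" "j < n" for i j
    using ab(1)[OF that(1)] ab(2)[OF that(1)] ab(1)[OF that(2)] ab(2)[OF that(2)] by auto
  then have "(\<Sum>i<n. \<Sum>j<n. (?K i j)\<^sup>2) \<le> (\<Sum>i<n. \<Sum>j<n. 4)" by (intro sum_mono) auto
  then have K: "(\<Sum>i<n. \<Sum>j<n. (?K i j)\<^sup>2) \<le> 4 * (real n)\<^sup>2" by (simp add: power2_eq_square)
  have "(\<Sum>i<n. sq n (\<lambda>j. A i j - c * ?K i j))
    = (\<Sum>i<n. \<Sum>j<n. (A i j)\<^sup>2 - 2 * c * (A i j * ?K i j) + c\<^sup>2 * (?K i j)\<^sup>2)"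
    unfolding sq_def by (intro sum.cong refl) (simp add: power2_eq_square algebra_simps)
  also have "\<dots> = (\<Sum>i<n. sq n (A i)) - 2 * c * (\<Sum>i<n. \<Sum>j<n. A i j * ?K i j)
      + c\<^sup>2 * (\<Sum>i<n. \<Sum>j<n. (?K i j)\<^sup>2)"
    unfolding sq_def sum.distrib sum_subtractf sum_distrib_left by simp
  also have "\<dots> \<le> (\<Sum>i<n. sq n (A i)) - 4 * (c * cut_value n A a b) + c\<^sup>2 * (4 * (real n)\<^sup>2)"
    unfolding AK using K by (intro add_mono mult_left_mono) auto
  also have "\<dots> \<le> (\<Sum>i<n. sq n (A i)) - 4 * c\<^sup>2 * (real n)\<^sup>2" using c by simp
  finally show ?thesis .
qed

section \<open>Testing a pair of sets\<close>

definition Indicators :: "int \<Rightarrow> int \<Rightarrow> program" where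
  "Indicators \<sigma> \<tau> = For ''v'' (Const 0) ''n''
     (Seq (Write ''S'' (Idx ''r'' ''v'') (Div (Add (Const 1) (Mul (Const \<sigma>) (Read ''X'' (V ''v'')))) (Const 2)))
          (Write ''T'' (Idx ''r'' ''v'') (Div (Add (Const 1) (Mul (Const \<tau>) (Read ''Z'' (V ''v'')))) (Const 2))))"

lemma wp_Indicators:
  assumes n: "s ''n'' 0 = real n" and r: "s ''r'' 0 = real r"
    and Q: "\<And>s'. agree {''v'', ''S'', ''T''} s s' \<Longrightarrow>
      (\<And>v. v < n \<Longrightarrow> s' ''S'' (r * n + v) = half (of_int \<sigma>) (s ''X'') v) \<Longrightarrow>
      (\<And>v. v < n \<Longrightarrow> s' ''T'' (r * n + v) = half (of_int \<tau>) (s ''Z'') v) \<Longrightarrow>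
      (\<And>i. i < r * n \<Longrightarrow> s' ''S'' i = s ''S'' i \<and> s' ''T'' i = s ''T'' i) \<Longrightarrow> Q s'"
  shows "wp (Indicators \<sigma> \<tau>) (50 * real n + 11) Q s"
proof -
  let ?I = "\<lambda>j s'. agree {''v'', ''S'', ''T''} s s' \<and> s' ''v'' 0 = real j \<and>
    (\<forall>v<j. s' ''S'' (r * n + v) = half (of_int \<sigma>) (s ''X'') v \<and>
      s' ''T'' (r * n + v) = half (of_int \<tau>) (s ''Z'') v) \<and>
    (\<forall>i<r * n. s' ''S'' i = s ''S'' i \<and> s' ''T'' i = s ''T'' i)"
  show ?thesis unfolding Indicators_def
  proof (rule wp_For[where a = 0 and n = n and B = 36 and I = "?I"])
    fix j s' assume j: "j < n" and I: "?I j s'"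
    note a = conjunct1[OF I]
    have eq: "s' ''n'' = s ''n''" "s' ''r'' = s ''r''" "s' ''X'' = s ''X''" "s' ''Z'' = s ''Z''"
      by (rule agreeD[OF a], simp)+
    let ?f = "upd (upd s' ''S'' (r * n + j) (half (of_int \<sigma>) (s ''X'') j)) ''T'' (r * n + j) (half (of_int \<tau>) (s ''Z'') j)"
    have "agree {''v'', ''S'', ''T''} s (upd ?f ''v'' 0 (real (Suc j)))"
      using a by (intro agree_upd) auto
    then have fin: "?f ''v'' 0 = real j \<and> ?I (Suc j) (upd ?f ''v'' 0 (real (Suc j)))"
      using I by (simp add: less_Suc_eq)
    show "wp (Seq (Write ''S'' (Idx ''r'' ''v'') (Div (Add (Const 1) (Mul (Const \<sigma>) (Read ''X'' (V ''v'')))) (Const 2)))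
            (Write ''T'' (Idx ''r'' ''v'') (Div (Add (Const 1) (Mul (Const \<tau>) (Read ''Z'' (V ''v'')))) (Const 2)))) 36
      (\<lambda>s''. s'' ''v'' 0 = real j \<and> ?I (Suc j) (upd s'' ''v'' 0 (real (Suc j)))) s'"
      (is "wp _ _ ?Q s'")
    proof (rule wp_Seq[where ?T1.0 = 18 and ?T2.0 = 18], rule wp_Write[where k = "r * n + j"], goal_cases)
      case 4
      have v1: "val (Div (Add (Const 1) (Mul (Const \<sigma>) (Read ''X'' (V ''v'')))) (Const 2)) s' = half (of_int \<sigma>) (s ''X'') j"
        using I by (simp add: eq half_def)
      show ?case unfolding v1
      proof (rule wp_Write[where k = "r * n + j"], goal_cases)
        case 4
        have v2: "val (Div (Add (Const 1) (Mul (Const \<tau>) (Read ''Z'' (V ''v'')))) (Const 2))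
          (upd s' ''S'' (r * n + j) (half (of_int \<sigma>) (s ''X'') j)) = half (of_int \<tau>) (s ''Z'') j"
          using I by (simp add: eq half_def)
        show ?case unfolding v2 by (rule fin)
      qed (use I in \<open>auto simp: eq n r\<close>)
    qed (use I in \<open>auto simp: eq n r\<close>)
  next
    fix s' assume I: "?I n s'"
    then show "Q s'" by (intro Q) auto
  qed (use n in \<open>auto simp: agree_def\<close>)
qed

definition RowB :: program where
  "RowB = ForSum (Mul (Read ''A'' (Idx ''j'' ''k'')) (Read ''T'' (Idx ''r'' ''k'')))
     (Write ''B'' (V ''j'') (Mul (Read ''S'' (Idx ''r'' ''j'')) (V ''acc'')))"

definition CutValue :: program where
  "CutValue = Seq RowB (SumTo ''val'' ''k'' ''n'' (Read ''B'' (V ''k'')))"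

lemma wp_CutValue:
  assumes n: "s ''n'' 0 = real n" "1 \<le> n" and r: "s ''r'' 0 = real r"
    and Q: "\<And>s'. agree {''acc'', ''k'', ''j'', ''B'', ''val''} s s' \<Longrightarrow>
      s' ''val'' 0 = cut_value n (Amat n s) (\<lambda>v. s ''S'' (r * n + v)) (\<lambda>v. s ''T'' (r * n + v)) \<Longrightarrow> Q s'"
  shows "wp CutValue (130 * (real n)\<^sup>2) Q s"
  unfolding CutValue_def
proof (rule wp_Seq[where ?T1.0 = "90 * (real n)\<^sup>2" and ?T2.0 = "20 * real n + 15"])
  let ?F = "\<lambda>j. s ''S'' (r * n + j) * (\<Sum>k<n. Amat n s j k * s ''T'' (r * n + k))"
  show "wp RowB (90 * (real n)\<^sup>2) (wp (SumTo ''val'' ''k'' ''n'' (Read ''B'' (V ''k''))) (20 * real n + 15) Q) s"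
    unfolding RowB_def
  proof (rule wp_ForSum[where n = n and a = "''B''" and B = 15 and
      g = "\<lambda>j k. Amat n s j k * s ''T'' (r * n + k)" and F = ?F])
    fix j k s' assume *: "j < n" "k < n" "agree {''acc'', ''k'', ''j'', ''B''} s s'"
      "s' ''j'' 0 = real j" "s' ''k'' 0 = real k"
    have "s' ''A'' = s ''A''" "s' ''T'' = s ''T''" "s' ''n'' = s ''n''" "s' ''r'' = s ''r''"
      by (rule agreeD[OF *(3)], simp)+
    then show "defined (Mul (Read ''A'' (Idx ''j'' ''k'')) (Read ''T'' (Idx ''r'' ''k''))) s' \<and>
      val (Mul (Read ''A'' (Idx ''j'' ''k'')) (Read ''T'' (Idx ''r'' ''k''))) s'
        = Amat n s j k * s ''T'' (r * n + k)"
      by (simp add: * n r)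
  next
    fix j s' assume *: "j < n" "agree {''acc'', ''k'', ''j'', ''B''} s s'" "s' ''j'' 0 = real j"
      "s' ''acc'' 0 = (\<Sum>k<n. Amat n s j k * s ''T'' (r * n + k))"
    have "s' ''S'' = s ''S''" "s' ''n'' = s ''n''" "s' ''r'' = s ''r''"
      by (rule agreeD[OF *(2)], simp)+
    then show "wp (Write ''B'' (V ''j'') (Mul (Read ''S'' (Idx ''r'' ''j'')) (V ''acc''))) 15
       (\<lambda>s''. s'' = upd s' ''B'' j (?F j)) s'"
      using * by (intro wp_Write[where k = j]) (auto simp: n r)
  next
    fix s' assume s': "agree {''acc'', ''k'', ''j'', ''B''} s s'" and B: "\<And>j. j < n \<Longrightarrow> s' ''B'' j = ?F j"
    have n': "s' ''n'' 0 = real n" using agreeD[OF s', of "''n''"] n by simp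
    show "wp (SumTo ''val'' ''k'' ''n'' (Read ''B'' (V ''k''))) (20 * real n + 15) Q s'"
    proof (rule wp_SumTo[where n = n and g = ?F])
      fix i s'' assume "i < n" "agree {''val'', ''k''} s' s''" "s'' ''k'' 0 = real i"
      then show "defined (Read ''B'' (V ''k'')) s'' \<and> val (Read ''B'' (V ''k'')) s'' = ?F i"
        using agreeD[of "{''val'', ''k''}" s' s'' "''B''"] B by simp
    next
      show "s' ''n'' 0 = real n" by (rule n')
    next
      fix s'' assume *: "agree {''val'', ''k''} s' s''" "s'' ''val'' 0 = (\<Sum>i<n. ?F i)"
      have "agree {''acc'', ''k'', ''j'', ''B'', ''val''} s s''" by (rule agree_trans[OF s' *(1)]) auto
      then show "Q s''" by (rule Q) (simp add: *(2) cut_value_def)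
    qed auto
  qed (use n in auto)
  show "90 * (real n)\<^sup>2 + (20 * real n + 15) \<le> 130 * (real n)\<^sup>2"
    using le_square_bounds[OF n(2)] by linarith
qed

definition Update :: program where
  "Update = Seq (For ''i'' (Const 0) ''n'' (For ''j'' (Const 0) ''n'' (Write ''A'' (Idx ''i'' ''j'')
       (Sub (Read ''A'' (Idx ''i'' ''j'')) (Mul (V ''cc'')
         (Add (Mul (Read ''S'' (Idx ''r'' ''i'')) (Read ''T'' (Idx ''r'' ''j'')))
              (Mul (Read ''T'' (Idx ''r'' ''i'')) (Read ''S'' (Idx ''r'' ''j'')))))))))
     (Seq (Write ''c'' (V ''r'') (V ''cc'')) (Seq (Assign ''r'' (Add (V ''r'') (Const 1))) (Assign ''go'' (Const 1))))"

lemma matrix_address: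
  assumes "j < n" "j' < (n::nat)"
  shows "i * n + j = i' * n + j' \<longleftrightarrow> i = i' \<and> j = j'"
proof
  assume eq: "i * n + j = i' * n + j'"
  have "(i * n + j) div n = i" "(i' * n + j') div n = i'" using assms by auto
  then have "i = i'" using eq by simp
  then show "i = i' \<and> j = j'" using eq by simp
qed simp

lemma wp_Update:
  assumes n: "s ''n'' 0 = real n" "1 \<le> n" and r: "s ''r'' 0 = real r" and cc: "s ''cc'' 0 = c"
    and a: "a = (\<lambda>v. s ''S'' (r * n + v))" and b: "b = (\<lambda>v. s ''T'' (r * n + v))"
    and Q: "\<And>s'. agree {''i'', ''j'', ''A'', ''c'', ''r'', ''go''} s s' \<Longrightarrow>
      (\<And>i j. i < n \<Longrightarrow> j < n \<Longrightarrow> Amat n s' i j = Amat n s i j - c * (a i * b j + b i * a j)) \<Longrightarrow>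
      s' ''c'' = (s ''c'')(r := c) \<Longrightarrow> s' ''r'' 0 = real (Suc r) \<Longrightarrow> s' ''go'' 0 = 1 \<Longrightarrow> Q s'"
  shows "wp Update (140 * (real n)\<^sup>2) Q s"
proof -
  let ?X = "{''i'', ''j'', ''A''}"
  let ?new = "\<lambda>i j. Amat n s i j - c * (a i * b j + b i * a j)"
  \<comment> \<open>Progress in row-major order: the rows before \<open>i\<close> and the first
    \<open>j\<close> entries of row \<open>i\<close> are new. A new entry depends only on the old
    value of the same cell, so updating in place is sound.\<close>
  let ?upto = "\<lambda>i j s'. \<forall>x<n. \<forall>y<n. Amat n s' x y = (if x < i \<or> x = i \<and> y < j then ?new x y else Amat n s x y)"
  let ?e = "Sub (Read ''A'' (Idx ''i'' ''j'')) (Mul (V ''cc'')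
         (Add (Mul (Read ''S'' (Idx ''r'' ''i'')) (Read ''T'' (Idx ''r'' ''j'')))
              (Mul (Read ''T'' (Idx ''r'' ''i'')) (Read ''S'' (Idx ''r'' ''j'')))))"
  let ?inner = "For ''j'' (Const 0) ''n'' (Write ''A'' (Idx ''i'' ''j'') ?e)"
  have inner: "wp ?inner (90 * real n + 11)
      (\<lambda>s''. agree ?X s s'' \<and> s'' ''i'' 0 = real i \<and> ?upto (Suc i) 0 s'') s'"
    if i: "i < n" "agree ?X s s'" "s' ''i'' 0 = real i" "?upto i 0 s'" for i s'
  proof (rule wp_For[where a = 0 and n = n and B = 70 and I = "\<lambda>j s''. agree ?X s s'' \<and>
      s'' ''i'' 0 = real i \<and> s'' ''j'' 0 = real j \<and> ?upto i j s''"])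
    fix j s'' assume j: "j < n" and I: "agree ?X s s'' \<and> s'' ''i'' 0 = real i \<and> s'' ''j'' 0 = real j \<and> ?upto i j s''"
    note ag = conjunct1[OF I]
    have eq: "s'' ''n'' = s ''n''" "s'' ''r'' = s ''r''" "s'' ''S'' = s ''S''" "s'' ''T'' = s ''T''" "s'' ''cc'' = s ''cc''"
      by (rule agreeD[OF ag], simp)+
    have val: "defined ?e s''" "val ?e s'' = ?new i j"
      using I i(1) j by (simp_all add: eq n r cc a b)
    let ?f = "upd (upd s'' ''A'' (i * n + j) (?new i j)) ''j'' 0 (real (Suc j))"
    have "agree ?X s ?f" using ag by (intro agree_upd) auto
    moreover have "?upto i (Suc j) ?f"
      using I j by (auto simp: matrix_address less_Suc_eq)
    ultimately show "wp (Write ''A'' (Idx ''i'' ''j'') ?e) 70 (\<lambda>s''. s'' ''j'' 0 = real j \<and>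
       agree ?X s (upd s'' ''j'' 0 (real (Suc j))) \<and> upd s'' ''j'' 0 (real (Suc j)) ''i'' 0 = real i \<and>
       upd s'' ''j'' 0 (real (Suc j)) ''j'' 0 = real (Suc j) \<and> ?upto i (Suc j) (upd s'' ''j'' 0 (real (Suc j)))) s''"
      unfolding val(2)[symmetric]
      by (intro wp_Write[where k = "i * n + j"] val(1)) (use I in \<open>simp_all add: eq n r del: val.simps(4)\<close>)
  next
    fix s'' assume "agree ?X s s'' \<and> s'' ''i'' 0 = real i \<and> s'' ''j'' 0 = real n \<and> ?upto i n s''"
    then show "agree ?X s s'' \<and> s'' ''i'' 0 = real i \<and> ?upto (Suc i) 0 s''" by (auto simp: less_Suc_eq)
  next
    fix k s'' assume I: "agree ?X s s'' \<and> s'' ''i'' 0 = real i \<and> s'' ''j'' 0 = real k \<and> ?upto i k s''"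
    show "s'' ''n'' 0 = real n" using agreeD[OF conjunct1[OF I], of "''n''"] n by simp
  qed (use i in \<open>auto intro: agree_upd\<close>)
  have outer: "wp (For ''i'' (Const 0) ''n'' ?inner) (90 * (real n)\<^sup>2 + 23 * real n + 11)
      (\<lambda>s'. agree ?X s s' \<and> ?upto n 0 s') s"
  proof (rule wp_For[where a = 0 and n = n and B = "90 * real n + 11" and I = "\<lambda>i s'. agree ?X s s' \<and>
      s' ''i'' 0 = real i \<and> ?upto i 0 s'"])
    fix i s' assume i: "i < n" and I: "agree ?X s s' \<and> s' ''i'' 0 = real i \<and> ?upto i 0 s'"
    show "wp ?inner (90 * real n + 11) (\<lambda>s''. s'' ''i'' 0 = real i \<and> agree ?X s (upd s'' ''i'' 0 (real (Suc i))) \<and>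
       upd s'' ''i'' 0 (real (Suc i)) ''i'' 0 = real (Suc i) \<and> ?upto (Suc i) 0 (upd s'' ''i'' 0 (real (Suc i)))) s'"
      by (rule wp_mono[OF inner[OF i] order_refl]) (use I in \<open>auto intro: agree_upd\<close>)
  next
    fix k s' assume I: "agree ?X s s' \<and> s' ''i'' 0 = real k \<and> ?upto k 0 s'"
    show "s' ''n'' 0 = real n" using agreeD[OF conjunct1[OF I], of "''n''"] n by simp
  qed (auto intro: agree_upd simp: power2_eq_square algebra_simps)
  have "wp (Seq (Write ''c'' (V ''r'') (V ''cc'')) (Seq (Assign ''r'' (Add (V ''r'') (Const 1))) (Assign ''go'' (Const 1)))) 16 Q s'"
    if I: "agree ?X s s' \<and> ?upto n 0 s'" for s'
  proof -
    note ag = conjunct1[OF I]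
    have eq: "s' ''r'' = s ''r''" "s' ''c'' = s ''c''" "s' ''cc'' = s ''cc''" by (rule agreeD[OF ag], simp)+
    let ?f = "upd (upd (upd s' ''c'' r c) ''r'' 0 (real (Suc r))) ''go'' 0 1"
    have "agree {''i'', ''j'', ''A'', ''c'', ''r'', ''go''} s s'" using ag by (auto simp: agree_def)
    then have "agree {''i'', ''j'', ''A'', ''c'', ''r'', ''go''} s ?f" by (intro agree_upd) auto
    then have "Q ?f" by (rule Q) (use I in \<open>auto simp: eq\<close>)
    then show ?thesis
      by (intro wp_Seq[where ?T1.0 = 5 and ?T2.0 = 11] wp_Write[where k = r] wp_Assign_Seq[where ?T2.0 = 3] wp_Assign)
         (auto simp: eq r cc add.commute)
  qed
  note final = this
  have "90 * (real n)\<^sup>2 + 23 * real n + 11 + 16 \<le> 140 * (real n)\<^sup>2"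
    using le_square_bounds[OF n(2)] by linarith
  then show ?thesis unfolding Update_def
    by (rule wp_Seq[rotated]) (rule wp_mono[OF outer order_refl final])
qed

definition Try :: "int \<Rightarrow> int \<Rightarrow> program" where
  "Try \<sigma> \<tau> = Seq (Indicators \<sigma> \<tau>) (Seq CutValue
     (Seq (Assign ''cc'' (V ''gam'')) (Seq (IfElse (Less (V ''val'') (Const 0))
         (Seq (Assign ''cc'' (Sub (Const 0) (V ''gam''))) (Assign ''val'' (Sub (Const 0) (V ''val'')))) Skip)
     (IfElse (Less (V ''val'') (V ''theta'')) Skip Update))))"

abbreviation try_vars :: "string set" where
  "try_vars \<equiv> {''v'', ''S'', ''T'', ''acc'', ''k'', ''j'', ''B'', ''val'', ''cc'', ''i'', ''A'', ''c'', ''r'', ''go''}"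

text \<open>
  After an update the weights, the sample and the sign vectors of the current round are out of
  date. This is harmless: the test before an update always uses the current matrix, and after an
  update another round follows.
\<close>

definition progress :: "real \<Rightarrow> nat \<Rightarrow> nat wgraph \<Rightarrow> nat \<Rightarrow> state \<Rightarrow> bool \<Rightarrow> nat \<Rightarrow> state \<Rightarrow> bool" where
  "progress \<gamma> n G r s F r' s' \<longleftrightarrow> good \<gamma> n G r' s' \<and>
     (s' ''go'' 0 = 1 \<and> r < r' \<or> r' = r \<and> s' ''A'' = s ''A'' \<and> s' ''go'' 0 = s ''go'' 0 \<and> F)"

text \<open>\<open>F\<close> concerns a matrix that has not changed. It can be strengthened step by
  step as long as no update occurs, and is void afterwards.\<close>

lemma progress_trans:
  assumes "progress \<gamma> n G r s F r1 s1" "progress \<gamma> n G r1 s1 F1 r2 s2"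
    and "s1 ''A'' = s ''A'' \<Longrightarrow> F \<Longrightarrow> F1 \<Longrightarrow> F2"
  shows "progress \<gamma> n G r s F2 r2 s2"
  using assms by (auto simp: progress_def)

lemma good_update:
  assumes g: "good \<gamma> n G r s" and G: "graph {..<n} G"
    and ab: "\<And>v. v < n \<Longrightarrow> s ''S'' (r * n + v) \<in> {0, 1}" "\<And>v. v < n \<Longrightarrow> s ''T'' (r * n + v) \<in> {0, 1}"
    and a: "a = (\<lambda>v. s ''S'' (r * n + v))" and b: "b = (\<lambda>v. s ''T'' (r * n + v))"
    and c: "c \<in> {- \<gamma>, \<gamma>}" and cut: "2 * \<gamma>\<^sup>2 * (real n)\<^sup>2 \<le> c * cut_value n (Amat n s) a b"
    and ag: "agree X s s'" "X \<inter> {''n'', ''gam'', ''theta'', ''S'', ''T''} = {}"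
    and A: "\<And>i j. i < n \<Longrightarrow> j < n \<Longrightarrow> Amat n s' i j = Amat n s i j - c * (a i * b j + b i * a j)"
    and s': "s' ''c'' = (s ''c'')(r := c)" "s' ''r'' 0 = real (Suc r)"
  shows "good \<gamma> n G (Suc r) s'"
proof -
  obtain S T d where out: "outputs s n r S T d"
    and sets: "\<And>i. i < r \<Longrightarrow> S i \<subseteq> {..<n} \<and> T i \<subseteq> {..<n} \<and> d i \<in> {- \<gamma>, \<gamma>}"
    and res: "\<And>x y. x < n \<Longrightarrow> y < n \<Longrightarrow> Amat n s x y = residual n G S T d r x y"
    and en: "(\<Sum>i<n. sq n (Amat n s i)) \<le> (real n)\<^sup>2 / 4 - 4 * real r * \<gamma>\<^sup>2 * (real n)\<^sup>2"
    and vars: "s ''n'' 0 = real n" "s ''gam'' 0 = \<gamma>" "s ''theta'' 0 = 2 * \<gamma> * (real n)\<^sup>2"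
    using g unfolding good_def by blast
  have eq: "s' ''n'' = s ''n''" "s' ''gam'' = s ''gam''" "s' ''theta'' = s ''theta''"
    "s' ''S'' = s ''S''" "s' ''T'' = s ''T''"
    by (rule agreeD[OF ag(1)], use ag(2) in auto)+
  define S' T' d' where "S' = S(r := {v. v < n \<and> a v = 1})" and "T' = T(r := {v. v < n \<and> b v = 1})"
    and "d' = d(r := c)"
  have a01: "a v = of_bool (v \<in> S' r)" and b01: "b v = of_bool (v \<in> T' r)" if "v < n" for v
    using ab[OF that] that by (auto simp: S'_def T'_def a b)
  have out': "outputs s' n (Suc r) S' T' d'"
    using out a01 b01 unfolding outputs_def
    by (auto simp: eq s' S'_def T'_def d'_def a b less_Suc_eq)
  have res': "Amat n s' x y = residual n G S' T' d' (Suc r) x y" if xy: "x < n" "y < n" for x y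
  proof -
    have "(\<Sum>i<r. d' i * K_graph (S' i) (T' i) x y) = (\<Sum>i<r. d i * K_graph (S i) (T i) x y)"
      by (intro sum.cong) (auto simp: S'_def T'_def d'_def)
    moreover have "d' r * K_graph (S' r) (T' r) x y = c * (a x * b y + b x * a y)"
      unfolding K_graph_def by (simp add: a01 b01 xy d'_def)
    ultimately show ?thesis unfolding A[OF xy] res[OF xy] by (simp add: residual_def)
  qed
  have sets': "S' i \<subseteq> {..<n} \<and> T' i \<subseteq> {..<n} \<and> d' i \<in> {- \<gamma>, \<gamma>}" if "i < Suc r" for i
    using sets[of i] that c by (auto simp: S'_def T'_def d'_def less_Suc_eq)
  have c2: "c\<^sup>2 = \<gamma>\<^sup>2" using c by auto
  have "(\<Sum>i<n. sq n (Amat n s' i)) = (\<Sum>i<n. sq n (\<lambda>j. Amat n s i j - c * (a i * b j + b i * a j)))"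
    unfolding sq_def by (intro sum.cong refl) (simp add: A)
  also have "\<dots> \<le> (\<Sum>i<n. sq n (Amat n s i)) - 4 * c\<^sup>2 * (real n)\<^sup>2"
  proof (rule energy_step)
    show "Amat n s i j = Amat n s j i" if "i < n" "j < n" for i j
      using that res symmetric_residual[OF G that] by simp
  qed (use ab cut c2 in \<open>auto simp: a b\<close>)
  also have "\<dots> \<le> (real n)\<^sup>2 / 4 - 4 * real (Suc r) * \<gamma>\<^sup>2 * (real n)\<^sup>2"
    using en by (simp add: c2 algebra_simps)
  finally show ?thesis unfolding good_def using vars out' res' sets' eq by (auto simp: eq)
qed

lemma wp_Try:
  assumes g: "good \<gamma> n G r s" and G: "graph {..<n} G" and "1 \<le> n" "0 < \<gamma>" and \<sigma>\<tau>: "\<sigma> \<in> {-1, 1}" "\<tau> \<in> {-1, 1}"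
    and xz: "\<And>v. v < n \<Longrightarrow> s ''X'' v \<in> {-1, 1}" "\<And>v. v < n \<Longrightarrow> s ''Z'' v \<in> {-1, 1}"
    and Q: "\<And>s' r'. agree try_vars s s' \<Longrightarrow> progress \<gamma> n G r s
      (\<bar>cut_value n (Amat n s) (half (of_int \<sigma>) (s ''X'')) (half (of_int \<tau>) (s ''Z''))\<bar> < 2 * \<gamma> * (real n)\<^sup>2) r' s' \<Longrightarrow> Q s'"
  shows "wp (Try \<sigma> \<tau>) (400 * (real n)\<^sup>2) Q s"
proof -
  have n: "s ''n'' 0 = real n" and th: "s ''theta'' 0 = 2 * \<gamma> * (real n)\<^sup>2" and gam: "s ''gam'' 0 = \<gamma>"
    using g by (auto simp: good_def)
  have r: "s ''r'' 0 = real r" using g by (auto simp: good_def outputs_def)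
  let ?x = "half (of_int \<sigma>) (s ''X'')" and ?z = "half (of_int \<tau>) (s ''Z'')"
  let ?c = "cut_value n (Amat n s) ?x ?z"
  let ?X1 = "{''v'', ''S'', ''T''}" and ?X2 = "{''acc'', ''k'', ''j'', ''B'', ''val''}"
  let ?decide = "IfElse (Less (V ''val'') (V ''theta'')) Skip Update"
  let ?abs = "IfElse (Less (V ''val'') (Const 0))
         (Seq (Assign ''cc'' (Sub (Const 0) (V ''gam''))) (Assign ''val'' (Sub (Const 0) (V ''val'')))) Skip"
  have decide: "wp ?decide (140 * (real n)\<^sup>2 + 10) Q s2"
    if ag: "agree (?X1 \<union> ?X2 \<union> {''cc''}) s s2"
      and S: "\<And>v. v < n \<Longrightarrow> s2 ''S'' (r * n + v) = ?x v" and T: "\<And>v. v < n \<Longrightarrow> s2 ''T'' (r * n + v) = ?z v"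
      and ST: "\<And>i. i < r * n \<Longrightarrow> s2 ''S'' i = s ''S'' i \<and> s2 ''T'' i = s ''T'' i"
      and v: "s2 ''val'' 0 = \<bar>?c\<bar>" and cc: "s2 ''cc'' 0 = (if ?c < 0 then - \<gamma> else \<gamma>)" for s2
  proof -
    have eq: "s2 ''n'' = s ''n''" "s2 ''r'' = s ''r''" "s2 ''A'' = s ''A''" "s2 ''theta'' = s ''theta''"
       "s2 ''go'' = s ''go''"
      by (rule agreeD[OF ag], simp)+
    have ag': "agree try_vars s s2" by (rule agree_trans[OF ag agree_refl[of "{}"]]) auto
    have g2: "good \<gamma> n G r s2" by (rule good_frame[OF g ag _ ST]) auto
    let ?a = "\<lambda>v. s2 ''S'' (r * n + v)" and ?b = "\<lambda>v. s2 ''T'' (r * n + v)"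
    have cv: "cut_value n (Amat n s2) ?a ?b = ?c"
      unfolding cut_value_def eq by (intro sum.cong refl arg_cong2[where f = "(*)"]) (auto simp: S T)
    show ?thesis
    proof (rule wp_IfElse[where ?T1.0 = "140 * (real n)\<^sup>2"], goal_cases)
      case 2
      then have "progress \<gamma> n G r s (\<bar>?c\<bar> < 2 * \<gamma> * (real n)\<^sup>2) r s2"
        using g2 by (simp add: progress_def eq v th)
      then have "Q s2" by (rule Q[OF ag'])
      then show ?case using le_square_bounds[OF \<open>1 \<le> n\<close>] by (intro wp_Skip) auto
    next
      case 3
      then have big: "2 * \<gamma> * (real n)\<^sup>2 \<le> \<bar>?c\<bar>" by (simp add: eq v th)
      show ?case
      proof (rule wp_Update[where n = n and r = r and a = ?a and b = ?b and c = "if ?c < 0 then - \<gamma> else \<gamma>"])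
        fix s3 assume *: "agree {''i'', ''j'', ''A'', ''c'', ''r'', ''go''} s2 s3"
          "\<And>i j. i < n \<Longrightarrow> j < n \<Longrightarrow> Amat n s3 i j = Amat n s2 i j - (if ?c < 0 then - \<gamma> else \<gamma>) * (?a i * ?b j + ?b i * ?a j)"
          "s3 ''c'' = (s2 ''c'')(r := if ?c < 0 then - \<gamma> else \<gamma>)" "s3 ''r'' 0 = real (Suc r)" "s3 ''go'' 0 = 1"
        have "good \<gamma> n G (Suc r) s3"
        proof (rule good_update[where a = ?a and b = ?b and c = "if ?c < 0 then - \<gamma> else \<gamma>", OF g2 G _ _ refl refl _ _ *(1) _ *(2-4)])
          show "?a v \<in> {0, 1}" "?b v \<in> {0, 1}" if "v < n" for v
            using \<sigma>\<tau> xz[OF that] by (auto simp: S[OF that] T[OF that] half_def)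
          have "(if ?c < 0 then - \<gamma> else \<gamma>) * ?c = \<gamma> * \<bar>?c\<bar>" by auto
          moreover have "\<gamma> * (2 * \<gamma> * (real n)\<^sup>2) \<le> \<gamma> * \<bar>?c\<bar>" using big \<open>0 < \<gamma>\<close> by (intro mult_left_mono) auto
          ultimately show "2 * \<gamma>\<^sup>2 * (real n)\<^sup>2
              \<le> (if ?c < 0 then - \<gamma> else \<gamma>) * cut_value n (Amat n s2) ?a ?b"
            unfolding cv by (simp add: power2_eq_square mult_ac)
        qed auto
        then have "progress \<gamma> n G r s (\<bar>?c\<bar> < 2 * \<gamma> * (real n)\<^sup>2) (Suc r) s3"
          using * by (simp add: progress_def)
        moreover have "agree try_vars s s3" by (rule agree_trans[OF ag' *(1)]) auto
        ultimately show "Q s3" by (rule Q[rotated])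
      qed (use cc \<open>1 \<le> n\<close> in \<open>simp_all add: eq n r\<close>)
    qed (use g2 in auto)
  qed
  have abs: "wp (Seq (Assign ''cc'' (V ''gam'')) (Seq ?abs ?decide)) (140 * (real n)\<^sup>2 + 40) Q s2"
    if ag: "agree (?X1 \<union> ?X2) s s2"
      and S: "\<And>v. v < n \<Longrightarrow> s2 ''S'' (r * n + v) = ?x v" and T: "\<And>v. v < n \<Longrightarrow> s2 ''T'' (r * n + v) = ?z v"
      and ST: "\<And>i. i < r * n \<Longrightarrow> s2 ''S'' i = s ''S'' i \<and> s2 ''T'' i = s ''T'' i"
      and v: "s2 ''val'' 0 = ?c" for s2
  proof -
    have gam2: "s2 ''gam'' 0 = \<gamma>" using agreeD[OF ag, of "''gam''"] gam by simp
    let ?s = "upd s2 ''cc'' 0 \<gamma>"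
    let ?f = "upd (upd s2 ''cc'' 0 (if ?c < 0 then - \<gamma> else \<gamma>)) ''val'' 0 \<bar>?c\<bar>"
    have ag': "agree (?X1 \<union> ?X2 \<union> {''cc''}) s s2" by (rule agree_trans[OF ag agree_refl[of "{}"]]) auto
    have f: "wp ?decide (140 * (real n)\<^sup>2 + 10) Q ?f"
    proof (rule decide)
      show "agree (?X1 \<union> ?X2 \<union> {''cc''}) s ?f" using ag' by (intro agree_upd) auto
    qed (use S T ST in auto)
    have 1: "wp ?abs 20 (\<lambda>s'. s' = ?f) ?s"
    proof (rule wp_IfElse[where ?T1.0 = 14], goal_cases)
      case 2
      then show ?case using gam2 v
        by (intro wp_Assign_Seq[where ?T2.0 = 6] wp_Assign) (auto simp: fun_eq_iff)
    next
      case 3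
      then show ?case using v by (intro wp_Skip) (auto simp: fun_eq_iff)
    qed auto
    have "wp (Seq ?abs ?decide) (140 * (real n)\<^sup>2 + 30) Q ?s"
      by (rule wp_Seq[where ?T1.0 = 20 and ?T2.0 = "140 * (real n)\<^sup>2 + 10"], rule wp_mono[OF 1 order_refl])
         (use f in auto)
    then show ?thesis using gam2 by (intro wp_Assign_Seq[where ?T2.0 = "140 * (real n)\<^sup>2 + 30"]) auto
  qed
  have cut: "wp (Seq CutValue
     (Seq (Assign ''cc'' (V ''gam'')) (Seq ?abs ?decide))) (270 * (real n)\<^sup>2 + 40) Q s1"
    if ag: "agree ?X1 s s1"
      and S: "\<And>v. v < n \<Longrightarrow> s1 ''S'' (r * n + v) = ?x v" and T: "\<And>v. v < n \<Longrightarrow> s1 ''T'' (r * n + v) = ?z v"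
      and ST: "\<And>i. i < r * n \<Longrightarrow> s1 ''S'' i = s ''S'' i \<and> s1 ''T'' i = s ''T'' i" for s1
  proof (rule wp_Seq[where ?T1.0 = "130 * (real n)\<^sup>2" and ?T2.0 = "140 * (real n)\<^sup>2 + 40"],
      rule wp_CutValue[OF _ \<open>1 \<le> n\<close>])
    fix s2 assume *: "agree ?X2 s1 s2"
      "s2 ''val'' 0 = cut_value n (Amat n s1) (\<lambda>v. s1 ''S'' (r * n + v)) (\<lambda>v. s1 ''T'' (r * n + v))"
    have "cut_value n (Amat n s1) (\<lambda>v. s1 ''S'' (r * n + v)) (\<lambda>v. s1 ''T'' (r * n + v)) = ?c"
      using agreeD[OF ag, of "''A''"] unfolding cut_value_def
      by (intro sum.cong refl arg_cong2[where f = "(*)"]) (auto simp: S T)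
    then show "wp (Seq (Assign ''cc'' (V ''gam'')) (Seq ?abs ?decide)) (140 * (real n)\<^sup>2 + 40) Q s2"
    proof (intro abs)
      show "agree (?X1 \<union> ?X2) s s2" by (rule agree_trans[OF ag *(1)]) auto
    qed (use * S T ST agreeD[OF *(1), of "''S''"] agreeD[OF *(1), of "''T''"] in auto)
  qed (use n r agreeD[OF ag, of "''n''"] agreeD[OF ag, of "''r''"] in auto)
  have "50 * real n + 11 + (270 * (real n)\<^sup>2 + 40) \<le> 400 * (real n)\<^sup>2"
    using le_square_bounds[OF \<open>1 \<le> n\<close>] by linarith
  then show ?thesis unfolding Try_def
    by (rule wp_Seq[rotated]) (rule wp_Indicators[where s = s and n = n and r = r], rule n, rule r, rule cut)
qed

section \<open>Testing a sampled row\<close>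

definition Candidate :: program where
  "Candidate = Seq (Assign ''q'' (Read ''P'' (V ''l''))) (Seq RowY (Seq (SignProduct ''Y'' ''X'')
     (Seq (SignProduct ''X'' ''Z'') (Seq (Try 1 1) (Seq (Try 1 (-1)) (Seq (Try (-1) 1) (Try (-1) (-1))))))))"

abbreviation candidate_vars :: "string set" where
  "candidate_vars \<equiv> try_vars \<union> {''q'', ''X'', ''Y'', ''Z''}"

definition no_cut :: "nat \<Rightarrow> (nat \<Rightarrow> nat \<Rightarrow> real) \<Rightarrow> real \<Rightarrow> nat \<Rightarrow> bool" where
  "no_cut n A \<theta> q \<longleftrightarrow> (\<forall>\<sigma>\<in>{-1, 1}. \<forall>\<tau>\<in>{-1, 1}.
     \<bar>cut_value n A (half \<sigma> (test_x n A q)) (half \<tau> (test_z n A q))\<bar> < \<theta>)"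

lemma cut_value_cong:
  assumes "\<And>v. v < n \<Longrightarrow> a v = a' v" "\<And>v. v < n \<Longrightarrow> b v = b' v"
  shows "cut_value n A (half \<sigma> a) (half \<tau> b) = cut_value n A (half \<sigma> a') (half \<tau> b')"
  unfolding cut_value_def half_def using assms by (intro sum.cong refl arg_cong2[where f = "(*)"]) auto

lemma wp_Tries:
  assumes g: "good \<gamma> n G r s" and G: "graph {..<n} G" and "1 \<le> n" "0 < \<gamma>"
    and xz: "\<And>v. v < n \<Longrightarrow> s ''X'' v \<in> {-1, 1}" "\<And>v. v < n \<Longrightarrow> s ''Z'' v \<in> {-1, 1}"
    and Q: "\<And>s' r'. agree try_vars s s' \<Longrightarrow> progress \<gamma> n G r s
      (\<forall>\<sigma>\<in>{-1, 1}. \<forall>\<tau>\<in>{-1, 1}.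
        \<bar>cut_value n (Amat n s) (half \<sigma> (s ''X'')) (half \<tau> (s ''Z''))\<bar> < 2 * \<gamma> * (real n)\<^sup>2) r' s' \<Longrightarrow> Q s'"
  shows "wp (Seq (Try 1 1) (Seq (Try 1 (-1)) (Seq (Try (-1) 1) (Try (-1) (-1))))) (1600 * (real n)\<^sup>2) Q s"
proof -
  let ?C = "\<lambda>s \<sigma> \<tau>. \<bar>cut_value n (Amat n s) (half \<sigma> (s ''X'')) (half \<tau> (s ''Z''))\<bar> < 2 * \<gamma> * (real n)\<^sup>2"
  have step: "wp (Try \<sigma> \<tau>) (400 * (real n)\<^sup>2) Q' s1"
    if s1: "agree try_vars s s1" "progress \<gamma> n G r s F r1 s1" and st: "\<sigma> \<in> {-1, 1}" "\<tau> \<in> {-1, 1}"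
      and Q': "\<And>s2 r2. agree try_vars s s2 \<Longrightarrow>
        progress \<gamma> n G r s (F \<and> ?C s (of_int \<sigma>) (of_int \<tau>)) r2 s2 \<Longrightarrow> Q' s2" for \<sigma> \<tau> F r1 s1 Q'
  proof -
    have eq: "s1 ''X'' = s ''X''" "s1 ''Z'' = s ''Z''" by (rule agreeD[OF s1(1)], simp)+
    have g1: "good \<gamma> n G r1 s1" using s1(2) by (simp add: progress_def)
    show ?thesis
    proof (rule wp_Try[OF g1 G assms(3,4) st])
      fix s2 r2 assume *: "agree try_vars s1 s2" "progress \<gamma> n G r1 s1
        (\<bar>cut_value n (Amat n s1) (half (of_int \<sigma>) (s1 ''X'')) (half (of_int \<tau>) (s1 ''Z''))\<bar> < 2 * \<gamma> * (real n)\<^sup>2) r2 s2"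
      show "Q' s2"
      proof (rule Q')
        show "agree try_vars s s2" by (rule agree_trans[OF s1(1) *(1)]) auto
        show "progress \<gamma> n G r s (F \<and> ?C s (of_int \<sigma>) (of_int \<tau>)) r2 s2"
          by (rule progress_trans[OF s1(2) *(2)]) (auto simp: eq)
      qed
    qed (use xz eq in auto)
  qed
  let ?F1 = "True \<and> ?C s (of_int 1) (of_int 1)"
  let ?F2 = "?F1 \<and> ?C s (of_int 1) (of_int (-1))"
  let ?F3 = "?F2 \<and> ?C s (of_int (-1)) (of_int 1)"
  let ?F4 = "?F3 \<and> ?C s (of_int (-1)) (of_int (-1))"
  have 0: "progress \<gamma> n G r s True r s" using g by (simp add: progress_def)
  show ?thesis
  proof (rule wp_Seq[where ?T1.0 = "400 * (real n)\<^sup>2" and ?T2.0 = "1200 * (real n)\<^sup>2"], rule step[OF agree_refl 0])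
    fix s1 r1 assume 1: "agree try_vars s s1" "progress \<gamma> n G r s ?F1 r1 s1"
    show "wp (Seq (Try 1 (-1)) (Seq (Try (-1) 1) (Try (-1) (-1)))) (1200 * (real n)\<^sup>2) Q s1"
    proof (rule wp_Seq[where ?T1.0 = "400 * (real n)\<^sup>2" and ?T2.0 = "800 * (real n)\<^sup>2"], rule step[OF 1])
      fix s2 r2 assume 2: "agree try_vars s s2" "progress \<gamma> n G r s
        ?F2 r2 s2"
      show "wp (Seq (Try (-1) 1) (Try (-1) (-1))) (800 * (real n)\<^sup>2) Q s2"
      proof (rule wp_Seq[where ?T1.0 = "400 * (real n)\<^sup>2" and ?T2.0 = "400 * (real n)\<^sup>2"], rule step[OF 2])
        fix s3 r3 assume 3: "agree try_vars s s3" "progress \<gamma> n G r s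
          ?F3 r3 s3"
        show "wp (Try (-1) (-1)) (400 * (real n)\<^sup>2) Q s3"
        proof (rule step[OF 3])
          fix s4 r4 assume 4: "agree try_vars s s4" "progress \<gamma> n G r s
            ?F4 r4 s4"
          show "Q s4" by (rule Q[OF 4(1)]) (use 4(2) in \<open>auto simp: progress_def\<close>)
        qed auto
      qed auto
    qed auto
  qed auto
qed

text \<open>The claim \<open>no_cut\<close> is conditional on fresh weights: after an earlier update
  in the same round, \<open>V\<close> belongs to an older matrix and the search goes on without this
  guarantee. Only a round without updates draws the conclusion.\<close>

lemma wp_Candidate:
  assumes g: "good \<gamma> n G r s" and G: "graph {..<n} G" and "1 \<le> n" "0 < \<gamma>"
    and l: "s ''l'' 0 = real l" "s ''P'' l = real q"
    and Q: "\<And>s' r'. agree candidate_vars s s' \<Longrightarrow> progress \<gamma> n G r s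
      ((\<forall>i. s ''V'' i = weight n (Amat n s) i) \<longrightarrow> no_cut n (Amat n s) (2 * \<gamma> * (real n)\<^sup>2) q) r' s' \<Longrightarrow> Q s'"
  shows "wp Candidate (2000 * (real n)\<^sup>2) Q s"
proof -
  let ?tries = "Seq (Try 1 1) (Seq (Try 1 (-1)) (Seq (Try (-1) 1) (Try (-1) (-1))))"
  let ?s = "upd s ''q'' 0 (real q)"
  let ?y = "\<lambda>j. s ''V'' j * (\<Sum>k<n. Amat n s j k * s ''V'' k * Amat n s q k)"
  let ?x = "\<lambda>j. sgn1 (\<Sum>k<n. Amat n s j k * ?y k)"
  let ?z = "\<lambda>j. sgn1 (\<Sum>k<n. Amat n s j k * ?x k)"
  have n: "s ''n'' 0 = real n" using g by (simp add: good_def)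
  have 0: "agree {''q''} s ?s" by (intro agree_upd agree_refl) auto
  have "wp (Seq RowY (Seq (SignProduct ''Y'' ''X'') (Seq (SignProduct ''X'' ''Z'') ?tries)))
     (1900 * (real n)\<^sup>2) Q ?s"
  proof (rule wp_Seq[where ?T1.0 = "100 * (real n)\<^sup>2" and ?T2.0 = "1800 * (real n)\<^sup>2"],
      rule wp_RowY[where n = n and q = q])
    fix s1 assume 1: "agree {''acc'', ''k'', ''j'', ''Y''} ?s s1"
      "\<And>j. j < n \<Longrightarrow> s1 ''Y'' j = ?s ''V'' j * (\<Sum>k<n. Amat n ?s j k * ?s ''V'' k * Amat n ?s q k)"
    have a1: "agree {''acc'', ''k'', ''j'', ''Y'', ''q''} s s1" by (rule agree_trans[OF 0 1(1)]) auto
    have y: "s1 ''Y'' j = ?y j" if "j < n" for j using 1(2)[OF that] by simp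
    have n1: "s1 ''n'' 0 = real n" using agreeD[OF a1, of "''n''"] n by simp
    have A1: "s1 ''A'' = s ''A''" by (rule agreeD[OF a1]) simp
    show "wp (Seq (SignProduct ''Y'' ''X'') (Seq (SignProduct ''X'' ''Z'') ?tries)) (1800 * (real n)\<^sup>2) Q s1"
    proof (rule wp_Seq[where ?T1.0 = "100 * (real n)\<^sup>2" and ?T2.0 = "1700 * (real n)\<^sup>2"],
        rule wp_SignProduct[where n = n])
      fix s2 assume 2: "agree {''acc'', ''k'', ''j'', ''X''} s1 s2"
        "\<And>j. j < n \<Longrightarrow> s2 ''X'' j = sgn1 (\<Sum>k<n. Amat n s1 j k * s1 ''Y'' k)"
      have a2: "agree {''acc'', ''k'', ''j'', ''Y'', ''q'', ''X''} s s2" by (rule agree_trans[OF a1 2(1)]) auto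
      have x: "s2 ''X'' j = ?x j" if "j < n" for j using 2(2)[OF that] by (simp add: y A1)
      have n2: "s2 ''n'' 0 = real n" using agreeD[OF a2, of "''n''"] n by simp
      have A2: "s2 ''A'' = s ''A''" by (rule agreeD[OF a2]) simp
      show "wp (Seq (SignProduct ''X'' ''Z'') ?tries) (1700 * (real n)\<^sup>2) Q s2"
      proof (rule wp_Seq[where ?T1.0 = "100 * (real n)\<^sup>2" and ?T2.0 = "1600 * (real n)\<^sup>2"],
          rule wp_SignProduct[where n = n])
        fix s3 assume 3: "agree {''acc'', ''k'', ''j'', ''Z''} s2 s3"
          "\<And>j. j < n \<Longrightarrow> s3 ''Z'' j = sgn1 (\<Sum>k<n. Amat n s2 j k * s2 ''X'' k)"
        have a3: "agree {''acc'', ''k'', ''j'', ''Y'', ''q'', ''X'', ''Z''} s s3" by (rule agree_trans[OF a2 3(1)]) auto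
        have z: "s3 ''Z'' j = ?z j" if "j < n" for j using 3(2)[OF that] by (simp add: x A2)
        have x3: "s3 ''X'' j = ?x j" if "j < n" for j using x[OF that] agreeD[OF 3(1), of "''X''"] by simp
        have eq: "s3 ''A'' = s ''A''" "s3 ''S'' = s ''S''" "s3 ''T'' = s ''T''" "s3 ''go'' = s ''go''"
          by (rule agreeD[OF a3], simp)+
        have g3: "good \<gamma> n G r s3" by (rule good_frame[OF g a3]) (auto simp: eq)
        show "wp ?tries (1600 * (real n)\<^sup>2) Q s3"
        proof (rule wp_Tries[OF g3 G assms(3,4)])
          fix s4 r' assume 4: "agree try_vars s3 s4" "progress \<gamma> n G r s3
            (\<forall>\<sigma>\<in>{-1, 1}. \<forall>\<tau>\<in>{-1, 1}.
              \<bar>cut_value n (Amat n s3) (half \<sigma> (s3 ''X'')) (half \<tau> (s3 ''Z''))\<bar> < 2 * \<gamma> * (real n)\<^sup>2) r' s4"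
          show "Q s4"
          proof (rule Q)
            show "agree candidate_vars s s4" by (rule agree_trans[OF a3 4(1)]) auto
            have "no_cut n (Amat n s) (2 * \<gamma> * (real n)\<^sup>2) q"
              if V: "\<forall>i. s ''V'' i = weight n (Amat n s) i" and F: "\<forall>\<sigma>\<in>{-1, 1}. \<forall>\<tau>\<in>{-1, 1}.
              \<bar>cut_value n (Amat n s3) (half \<sigma> (s3 ''X'')) (half \<tau> (s3 ''Z''))\<bar> < 2 * \<gamma> * (real n)\<^sup>2"
            proof -
              have tx: "?x v = test_x n (Amat n s) q v" for v using V by (simp add: test_x_def)
              have X: "s3 ''X'' v = test_x n (Amat n s) q v" if "v < n" for v
                unfolding x3[OF that] by (rule tx)
              have Z: "s3 ''Z'' v = test_z n (Amat n s) q v" if "v < n" for v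
                unfolding z[OF that] tx test_z_def by (rule refl)
              show ?thesis using F cut_value_cong[OF X Z] unfolding no_cut_def eq by simp
            qed
            then show "progress \<gamma> n G r s ((\<forall>i. s ''V'' i = weight n (Amat n s) i) \<longrightarrow>
                no_cut n (Amat n s) (2 * \<gamma> * (real n)\<^sup>2) q) r' s4"
              using 4(2) by (auto simp: progress_def eq)
          qed
        qed (auto simp: x3 z sgn1_def)
      qed (use n2 \<open>1 \<le> n\<close> in auto)
    qed (use n1 \<open>1 \<le> n\<close> in auto)
  qed (use n \<open>1 \<le> n\<close> in auto)
  then show ?thesis unfolding Candidate_def
    by (intro wp_Assign_Seq[where ?T2.0 = "1900 * (real n)\<^sup>2"]) (use l le_square_bounds[OF \<open>1 \<le> n\<close>] in auto)
qed

section \<open>The complete algorithm\<close>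

definition Round :: program where
  "Round = Seq (Assign ''go'' (Const 0)) (Seq Weights (Seq Sample (For ''l'' (Const 0) ''len'' Candidate)))"

abbreviation small_cut :: "nat \<Rightarrow> real \<Rightarrow> state \<Rightarrow> bool" where
  "small_cut n \<epsilon> s \<equiv> \<forall>U\<subseteq>{..<n}. \<forall>Z\<subseteq>{..<n}. \<bar>edge_weight (Amat n s) U Z\<bar> \<le> \<epsilon> * (real n)\<^sup>2"

lemma wp_Candidates:
  assumes g: "good \<gamma> n G r s" and G: "graph {..<n} G" and "1 \<le> n" "0 < \<gamma>"
    and len: "s ''len'' 0 = real L" and P: "\<And>l. l < L \<Longrightarrow> s ''P'' l = real (P l)"
    and V: "\<And>i. s ''V'' i = weight n (Amat n s) i"
    and Q: "\<And>s' r'. agree (insert ''l'' candidate_vars) s s' \<Longrightarrow> progress \<gamma> n G r s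
      (\<forall>l<L. no_cut n (Amat n s) (2 * \<gamma> * (real n)\<^sup>2) (P l)) r' s' \<Longrightarrow> Q s'"
  shows "wp (For ''l'' (Const 0) ''len'' Candidate) ((2000 * (real n)\<^sup>2 + 12) * real L + 11) Q s"
proof -
  let ?I = "\<lambda>j s'. agree (insert ''l'' candidate_vars) s s' \<and> s' ''l'' 0 = real j \<and>
      (\<exists>r'. progress \<gamma> n G r s (\<forall>l<j. no_cut n (Amat n s) (2 * \<gamma> * (real n)\<^sup>2) (P l)) r' s')"
  show ?thesis
  proof (rule wp_For[where a = 0 and n = L and B = "2000 * (real n)\<^sup>2" and
      I = "?I"])
    fix j s' assume j: "j < L" and I: "?I j s'"
    note a = conjunct1[OF I]
    have eq: "s' ''P'' = s ''P''" "s' ''V'' = s ''V''" by (rule agreeD[OF a], simp)+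
    obtain r1 where r1: "progress \<gamma> n G r s (\<forall>l<j. no_cut n (Amat n s) (2 * \<gamma> * (real n)\<^sup>2) (P l)) r1 s'"
      using I by blast
    then have g1: "good \<gamma> n G r1 s'" by (simp add: progress_def)
    show "wp Candidate (2000 * (real n)\<^sup>2) (\<lambda>s''. s'' ''l'' 0 = real j \<and>
        ?I (Suc j) (upd s'' ''l'' 0 (real (Suc j)))) s'"
    proof (rule wp_Candidate[OF g1 G assms(3,4)])
      fix s2 r2 assume 2: "agree candidate_vars s' s2" "progress \<gamma> n G r1 s'
        ((\<forall>i. s' ''V'' i = weight n (Amat n s') i) \<longrightarrow> no_cut n (Amat n s') (2 * \<gamma> * (real n)\<^sup>2) (P j)) r2 s2"
      let ?f = "upd s2 ''l'' 0 (real (Suc j))"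
      have "agree (insert ''l'' candidate_vars) s s2" by (rule agree_trans[OF a 2(1)]) auto
      then have ag: "agree (insert ''l'' candidate_vars) s ?f" by (intro agree_upd) auto
      have pr: "progress \<gamma> n G r s (\<forall>l<Suc j. no_cut n (Amat n s) (2 * \<gamma> * (real n)\<^sup>2) (P l)) r2 s2"
        by (rule progress_trans[OF r1 2(2)]) (auto simp: eq V less_Suc_eq)
      have "good \<gamma> n G r2 ?f"
      proof (rule good_frame[where X = "{''l''}"])
        show "good \<gamma> n G r2 s2" using pr by (simp add: progress_def)
        show "agree {''l''} s2 ?f" by (intro agree_upd agree_refl) auto
      qed auto
      then have "progress \<gamma> n G r s (\<forall>l<Suc j. no_cut n (Amat n s) (2 * \<gamma> * (real n)\<^sup>2) (P l)) r2 ?f"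
        using pr by (auto simp: progress_def)
      then show "s2 ''l'' 0 = real j \<and> ?I (Suc j) ?f"
        using ag I agreeD[OF 2(1), of "''l''"] by auto
    qed (use I P[OF j] eq in auto)
  next
    let ?f = "upd s ''l'' 0 (real 0)"
    have ag: "agree {''l''} s ?f" by (intro agree_upd agree_refl) auto
    have "good \<gamma> n G r ?f" by (rule good_frame[OF g ag]) auto
    then show "?I 0 ?f"
      by (intro conjI exI[of _ r]) (auto simp: progress_def agree_def)
  next
    fix k s' assume I: "?I k s'"
    show "s' ''len'' 0 = real L" using agreeD[OF conjunct1[OF I], of "''len''"] len by simp
  next
    fix s' assume "?I L s'"
    then show "Q s'" using Q by blast
  qed auto
qed

text \<open>If nothing was updated, all sampled rows were tested against one matrix with its own
  weights and sample, the situation of \<open>exhausted_imp_small_cut\<close>. That \<open>V\<close>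
  vanishes from \<open>n\<close> on is passed from round to round, since \<open>Weights\<close>
  writes only the first \<open>n\<close> cells while the padding relies on the others.\<close>

lemma wp_Round:
  assumes g: "good \<gamma> n G r s" and G: "graph {..<n} G" and "1 \<le> n" and \<epsilon>: "0 < \<epsilon>" "\<gamma> = \<epsilon> ^ 8 / 300"
    and m: "s ''m'' 0 = real m" "1 \<le> m" "1 \<le> real m * \<epsilon>"
    and V: "\<And>i. n \<le> i \<Longrightarrow> s ''V'' i = 0"
    and Q: "\<And>s' r'. good \<gamma> n G r' s' \<Longrightarrow> s' ''m'' 0 = real m \<Longrightarrow> (\<And>i. n \<le> i \<Longrightarrow> s' ''V'' i = 0) \<Longrightarrow>
      s' ''go'' 0 = 1 \<and> r < r' \<or> s' ''go'' 0 = 0 \<and> r' = r \<and> small_cut n \<epsilon> s' \<Longrightarrow> Q s'"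
  shows "wp Round (160000000 * real m ^ 4 * (real n)\<^sup>2) Q s"
proof -
  have "0 < \<gamma>" unfolding \<epsilon>(2) using \<epsilon>(1) by simp
  let ?A = "Amat n s" and ?M = "real m ^ 4 * (real n)\<^sup>2"
  have n: "s ''n'' 0 = real n" using g by (simp add: good_def)
  obtain S T c where en: "(\<Sum>i<n. sq n (?A i)) \<le> (real n)\<^sup>2 / 4 - 4 * real r * \<gamma>\<^sup>2 * (real n)\<^sup>2"
    and res: "\<And>x y. x < n \<Longrightarrow> y < n \<Longrightarrow> ?A x y = residual n G S T c r x y"
    using g unfolding good_def by blast
  have sym: "?A i j = ?A j i" if "i < n" "j < n" for i j
    using that res symmetric_residual[OF G that] by simp
  have energy: "(\<Sum>i<n. sq n (?A i)) \<le> (real n)\<^sup>2 / 4"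
    using en by (smt (verit) mult_nonneg_nonneg of_nat_0_le_iff zero_le_power2)
  let ?cands = "For ''l'' (Const 0) ''len'' Candidate"
  have cands: "wp ?cands (75000000 * ?M) Q s2"
    if a2: "agree (sample_vars \<union> {''V'', ''go''}) s s2" and go: "s2 ''go'' 0 = 0"
      and V2: "\<And>i. s2 ''V'' i = weight n ?A i"
      and L: "s2 ''len'' 0 = real L" "0 < L" "real L \<le> 36864 * real m ^ 4"
      and P: "\<And>j. j < L \<Longrightarrow> s2 ''P'' j = real (P j)" and H: "0 < H" "H \<le> 2 * n"
      and rep: "represents n (normalized n ?A) H P L (1 / (16 * (real m)\<^sup>2))" for s2 P L H
  proof -
    have A2: "s2 ''A'' = s ''A''" "s2 ''m'' = s ''m''" "s2 ''S'' = s ''S''" "s2 ''T'' = s ''T''"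
      by (rule agreeD[OF a2], simp)+
    have g2: "good \<gamma> n G r s2" by (rule good_frame[OF g a2]) (auto simp: A2)
    have "wp ?cands ((2000 * (real n)\<^sup>2 + 12) * real L + 11) Q s2"
    proof (rule wp_Candidates[OF g2 G \<open>1 \<le> n\<close> \<open>0 < \<gamma>\<close> L(1) P])
      fix s3 r' assume 3: "agree (insert ''l'' candidate_vars) s2 s3" "progress \<gamma> n G r s2
        (\<forall>l<L. no_cut n (Amat n s2) (2 * \<gamma> * (real n)\<^sup>2) (P l)) r' s3"
      have eq: "s3 ''m'' = s2 ''m''" "s3 ''V'' = s2 ''V''" by (rule agreeD[OF 3(1)], simp)+
      show "Q s3"
      proof (rule Q)
        show "good \<gamma> n G r' s3" using 3(2) by (simp add: progress_def)
        show "s3 ''m'' 0 = real m" using m by (simp add: eq A2)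
        show "s3 ''V'' i = 0" if "n \<le> i" for i using that by (simp add: eq V2 weight_def)
        have "small_cut n \<epsilon> s3" if A3: "s3 ''A'' = s2 ''A''"
          and nc: "\<forall>l<L. no_cut n (Amat n s2) (2 * \<gamma> * (real n)\<^sup>2) (P l)"
        proof (intro allI impI, unfold A3 A2, rule exhausted_imp_small_cut[where W = "real H / real L" and P = P and L = L])
          fix v
          \<comment> \<open>As \<open>m \<ge> 1 / \<epsilon>\<close> and
            \<open>H \<le> 2 * n\<close>, the sampling error \<open>n H / (16 m^2)\<close> stays
            within \<open>\<epsilon>^2 n^2 / 8\<close>, the half of \<open>\<rho>\<close> that
            \<open>informative_row\<close> can afford.\<close>
          have "1\<^sup>2 \<le> (real m * \<epsilon>)\<^sup>2" using m(3) by (intro power_mono) auto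
          then have "1 / (16 * (real m)\<^sup>2) \<le> \<epsilon>\<^sup>2 / 16"
            using m(2) by (simp add: field_simps)
          then have "1 / (16 * (real m)\<^sup>2) * (real n * real H) \<le> \<epsilon>\<^sup>2 / 16 * (real n * (2 * real n))"
            using H(2) by (intro mult_mono) auto
          also have "\<dots> = \<epsilon>\<^sup>2 * (real n)\<^sup>2 / 8" by (simp add: power2_eq_square)
          finally have "1 / (16 * (real m)\<^sup>2) * (real n * real H) * sq n v \<le> \<epsilon>\<^sup>2 * (real n)\<^sup>2 / 8 * sq n v"
            by (rule mult_right_mono[OF _ sq_nonneg])
          then show "\<bar>real H / real L * (\<Sum>l<L. (mv n (normalized n ?A) v (P l))\<^sup>2) - sq n (mv n (normalized n ?A) v)\<bar>
              \<le> \<epsilon>\<^sup>2 * (real n)\<^sup>2 / 8 * sq n v"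
            using rep unfolding represents_def by (meson order_trans)
        next
          fix l and \<sigma> \<tau> :: real assume "l < L" "\<sigma> \<in> {-1, 1}" "\<tau> \<in> {-1, 1}"
          show "\<bar>cut_value n ?A (half \<sigma> (test_x n ?A (P l))) (half \<tau> (test_z n ?A (P l)))\<bar>
              < \<epsilon> ^ 8 / 150 * (real n)\<^sup>2"
          proof -
            have "no_cut n ?A (2 * \<gamma> * (real n)\<^sup>2) (P l)" using nc \<open>l < L\<close> by (simp add: A2)
            moreover have "2 * \<gamma> * (real n)\<^sup>2 = \<epsilon> ^ 8 / 150 * (real n)\<^sup>2" by (simp add: \<epsilon>(2))
            ultimately show ?thesis
              using \<open>\<sigma> \<in> {-1, 1}\<close> \<open>\<tau> \<in> {-1, 1}\<close> unfolding no_cut_def by (simp only: Ball_def)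
          qed
        qed (use sym energy \<open>1 \<le> n\<close> \<epsilon> H L(2) in auto)
        then show "s3 ''go'' 0 = 1 \<and> r < r' \<or> s3 ''go'' 0 = 0 \<and> r' = r \<and> small_cut n \<epsilon> s3"
          using 3(2) go unfolding progress_def by auto
      qed
    qed (simp_all add: V2 A2)
    moreover have "(2000 * (real n)\<^sup>2 + 12) * real L + 11 \<le> 75000000 * ?M"
    proof -
      have "(2000 * (real n)\<^sup>2 + 12) * real L \<le> (2012 * (real n)\<^sup>2) * (36864 * real m ^ 4)"
        using le_square_bounds[OF \<open>1 \<le> n\<close>] L(3) by (intro mult_mono) auto
      moreover have "1 * 1 \<le> ?M"
        using le_square_bounds[OF \<open>1 \<le> n\<close>] m(2) by (intro mult_mono) auto
      ultimately show ?thesis by (simp add: mult_ac)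
    qed
    ultimately show ?thesis by (rule wp_mono)
  qed
  let ?s = "upd s ''go'' 0 0"
  have M: "1 * 1 \<le> ?M" "1 * (real n)\<^sup>2 \<le> ?M"
    using le_square_bounds[OF \<open>1 \<le> n\<close>] m(2) by (intro mult_mono mult_right_mono; simp)+
  have "wp (Seq Weights (Seq Sample ?cands)) (158000000 * ?M) Q ?s"
  proof (rule wp_Seq[where ?T1.0 = "110 * (real n)\<^sup>2" and ?T2.0 = "157000000 * ?M"],
      rule wp_Weights[where n = n])
    fix s1 assume 1: "agree {''acc'', ''k'', ''j'', ''V''} ?s s1" "env n (Amat n ?s) s1"
    have 0: "agree {''go''} s ?s" by (intro agree_upd agree_refl) auto
    have a1: "agree {''acc'', ''k'', ''j'', ''V'', ''go''} s s1" by (rule agree_trans[OF 0 1(1)]) auto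
    have e1: "env n ?A s1" using 1(2) by simp
    show "wp (Seq Sample ?cands) (157000000 * ?M) Q s1"
    proof (rule wp_Seq[where ?T1.0 = "82000000 * real m ^ 4 * (real n)\<^sup>2" and ?T2.0 = "75000000 * ?M"],
        rule wp_Sample[OF e1 \<open>1 \<le> n\<close>])
      fix s2 P L H assume 2: "agree sample_vars s1 s2" "s2 ''len'' 0 = real L" "0 < L"
        "real L \<le> 36864 * real m ^ 4" "\<And>j. j < L \<Longrightarrow> s2 ''P'' j = real (P j)" "0 < H" "H \<le> 2 * n"
        "represents n (normalized n ?A) H P L (1 / (16 * (real m)\<^sup>2))"
      show "wp ?cands (75000000 * ?M) Q s2"
      proof (rule cands[OF _ _ _ 2(2-8)])
        show "agree (sample_vars \<union> {''V'', ''go''}) s s2" by (rule agree_trans[OF a1 2(1)]) auto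
        show "s2 ''go'' 0 = 0" using agreeD[OF 2(1), of "''go''"] agreeD[OF 1(1), of "''go''"] by simp
        show "s2 ''V'' i = weight n ?A i" for i
          using agreeD[OF 2(1), of "''V''"] e1 by (simp add: env_def)
      qed
    qed (use m agreeD[OF a1, of "''m''"] in auto)
  qed (use n V \<open>1 \<le> n\<close> M in auto)
  moreover have "3 + 158000000 * ?M \<le> 160000000 * real m ^ 4 * (real n)\<^sup>2"
    using M(1) by linarith
  ultimately show ?thesis unfolding Round_def
    by (intro wp_Assign_Seq[where ?T2.0 = "158000000 * ?M"]) simp_all
qed

section \<open>Initialization\<close>

definition Init :: program where
  "Init = Seq (Assign ''m'' (Const 1))
     (Seq (While (Less (Mul (V ''m'') (V ''eps'')) (Const 1)) (Assign ''m'' (Add (V ''m'') (Const 1))))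
     (Seq (Assign ''N2'' (Mul (V ''n'') (V ''n'')))
     (Seq (SumTo ''acc'' ''k'' ''N2'' (Read ''G'' (V ''k'')))
     (Seq (Assign ''d'' (Div (V ''acc'') (V ''N2'')))
     (Seq (For ''i'' (Const 0) ''N2'' (Write ''A'' (V ''i'') (Sub (Read ''G'' (V ''i'')) (V ''d''))))
     (Seq (Assign ''e2'' (Mul (V ''eps'') (V ''eps'')))
     (Seq (Assign ''e4'' (Mul (V ''e2'') (V ''e2'')))
     (Seq (Assign ''gam'' (Div (Mul (V ''e4'') (V ''e4'')) (Const 300)))
     (Seq (Assign ''theta'' (Mul (Mul (Const 2) (V ''gam'')) (V ''N2'')))
     (Assign ''go'' (Const 1)))))))))))"

text \<open>Counting replaces the missing rounding operation, at a cost of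
  \<open>O(1 + 1 / \<epsilon>)\<close>. The upper bound yields
  \<open>m \<le> 2 * max 1 (1 / \<epsilon>)\<close>, which keeps powers of \<open>m\<close> within
  the admissible time.\<close>

lemma wp_ceiling:
  assumes "s ''eps'' 0 = \<epsilon>" "0 < \<epsilon>" "s ''m'' 0 = 1"
    and Q: "\<And>s' m. agree {''m''} s s' \<Longrightarrow> s' ''m'' 0 = real m \<Longrightarrow> 1 \<le> m \<Longrightarrow> 1 \<le> real m * \<epsilon> \<Longrightarrow>
      real m \<le> 1 / \<epsilon> + 1 \<Longrightarrow> Q s'"
  shows "wp (While (Less (Mul (V ''m'') (V ''eps'')) (Const 1)) (Assign ''m'' (Add (V ''m'') (Const 1))))
    (14 / \<epsilon> + 8) Q s"
proof -
  let ?I = "\<lambda>s'. agree {''m''} s s' \<and> (\<exists>m\<ge>1. s' ''m'' 0 = real m \<and> real m \<le> 1 / \<epsilon> + 1)"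
  let ?\<tau> = "\<lambda>s'. 14 * (1 / \<epsilon> + 1 - s' ''m'' 0) + 8 :: real"
  show ?thesis
  proof (rule wp_While[where
      I = "?I" and
      \<tau> = "?\<tau>" and T = "\<lambda>_. 6"])
    show "?I s"
      using assms(2,3) by (auto intro!: exI[of _ 1])
  next
    let ?b = "Less (Mul (V ''m'') (V ''eps'')) (Const 1)"
    fix s' assume I: "?I s'"
    then obtain m where m: "1 \<le> m" "s' ''m'' 0 = real m" "real m \<le> 1 / \<epsilon> + 1" by blast
    have e: "s' ''eps'' 0 = \<epsilon>" using agreeD[OF conjunct1[OF I], of "''eps''"] assms(1) by simp
    show "test_defined ?b s' \<and> real (1 + test_cost ?b) \<le> ?\<tau> s'"
      using m by simp
    show "wp (Assign ''m'' (Add (V ''m'') (Const 1))) 6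
       (\<lambda>s''. ?I s'' \<and>
         real (1 + test_cost ?b) + 6 + ?\<tau> s''
         \<le> ?\<tau> s') s'" if "test_val ?b s'"
    proof (rule wp_Assign, goal_cases)
      case 2
      have "real m * \<epsilon> < 1" using that m e by simp
      then have "real (Suc m) \<le> 1 / \<epsilon> + 1" using assms(2) by (simp add: field_simps)
      moreover have "agree {''m''} s (upd s' ''m'' 0 (real m + 1))" using I by (intro agree_upd) auto
      ultimately show ?case using m by (auto intro!: exI[of _ "Suc m"])
    qed auto
    show "Q s'" if "\<not> test_val ?b s'"
      by (rule Q[OF conjunct1[OF I] m(2,1) _ m(3)]) (use that m e in simp)
  qed (use assms in auto)
qed

lemma sum_matrix: "(\<Sum>i<n * n. f i) = (\<Sum>x<n. \<Sum>y<n. f (x * n + y))" for f :: "nat \<Rightarrow> real"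
proof -
  have "(\<Sum>i<n * n. f i) = (\<Sum>x<n. sum f {x * n..<x * n + n})" by (rule sum.nat_group[symmetric])
  also have "\<dots> = (\<Sum>x<n. \<Sum>y<n. f (x * n + y))"
  proof (rule sum.cong[OF refl])
    fix x
    show "sum f {x * n..<x * n + n} = (\<Sum>y<n. f (x * n + y))"
      using sum.shift_bounds_nat_ivl[of f 0 "x * n" n] by (simp add: atLeast0LessThan add.commute)
  qed
  finally show ?thesis .
qed

text \<open>Entries are 0 or 1 and thus equal to their squares, so the mean square deviation is
  \<open>d - d^2\<close>, the variance of a 0/1 variable, which is at most 1/4.\<close>

lemma initial_energy:
  assumes G: "graph {..<n} G" and "1 \<le> n"
  shows "(\<Sum>i<n. sq n (\<lambda>j. G i j - edge_density {..<n} G)) \<le> (real n)\<^sup>2 / 4"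
proof -
  define d where "d = edge_density {..<n} G"
  have sum: "(\<Sum>i<n. \<Sum>j<n. G i j) = d * (real n)\<^sup>2"
    using \<open>1 \<le> n\<close> by (simp add: d_def edge_density_def density_def edge_weight_def power2_eq_square)
  have "(\<Sum>i<n. sq n (\<lambda>j. G i j - d)) = (\<Sum>i<n. \<Sum>j<n. G i j - 2 * d * G i j + d\<^sup>2)"
    unfolding sq_def
  proof (intro sum.cong refl)
    fix i j assume "i \<in> {..<n}" "j \<in> {..<n}"
    then have "G i j \<in> {0, 1}" using G by (simp add: graph_def)
    then show "(G i j - d)\<^sup>2 = G i j - 2 * d * G i j + d\<^sup>2" by (auto simp: power2_eq_square algebra_simps)
  qed
  also have "\<dots> = (\<Sum>i<n. \<Sum>j<n. G i j) - 2 * d * (\<Sum>i<n. \<Sum>j<n. G i j) + (real n)\<^sup>2 * d\<^sup>2"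
    by (simp add: sum.distrib sum_subtractf sum_distrib_left power2_eq_square)
  also have "\<dots> = (d - d\<^sup>2) * (real n)\<^sup>2" unfolding sum by (simp add: power2_eq_square algebra_simps)
  also have "\<dots> \<le> 1 / 4 * (real n)\<^sup>2"
  proof (rule mult_right_mono)
    have "0 \<le> (d - 1 / 2)\<^sup>2" by simp
    then show "d - d\<^sup>2 \<le> 1 / 4" by (simp add: power2_eq_square algebra_simps)
  qed simp
  finally show ?thesis by (simp add: d_def)
qed

lemma wp_Init:
  assumes \<epsilon>: "0 < \<epsilon>" and n: "1 \<le> n" and G: "graph {..<n} G"
    and Q: "\<And>s m. good (\<epsilon> ^ 8 / 300) n G 0 s \<Longrightarrow> s ''m'' 0 = real m \<Longrightarrow> 1 \<le> m \<Longrightarrow> 1 \<le> real m * \<epsilon> \<Longrightarrow>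
      real m \<le> 1 / \<epsilon> + 1 \<Longrightarrow> (\<And>i. s ''V'' i = 0) \<Longrightarrow> s ''go'' 0 = 1 \<Longrightarrow> Q s"
  shows "wp Init (14 / \<epsilon> + 200 * (real n)\<^sup>2) Q (input_state \<epsilon> n G)"
proof -
  let ?s = "input_state \<epsilon> n G"
  let ?d = "edge_density {..<n} G"
  have in_vars: "?s ''eps'' 0 = \<epsilon>" "?s ''n'' 0 = real n" "?s ''V'' i = 0" "?s ''r'' 0 = 0" for i
    by (simp_all add: input_state_def)
  have in_G: "?s ''G'' (x * n + y) = G x y" if "x < n" "y < n" for x y
    using that address_less[OF that] by (simp add: input_state_def)
  have sumG: "(\<Sum>i<n * n. ?s ''G'' i) / real (n * n) = ?d"
  proof -
    have "(\<Sum>i<n * n. ?s ''G'' i) = (\<Sum>x<n. \<Sum>y<n. G x y)"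
      unfolding sum_matrix by (intro sum.cong refl) (simp add: in_G)
    then show ?thesis by (simp add: edge_density_def density_def edge_weight_def)
  qed
  let ?tail = "Seq (Assign ''e2'' (Mul (V ''eps'') (V ''eps'')))
     (Seq (Assign ''e4'' (Mul (V ''e2'') (V ''e2'')))
     (Seq (Assign ''gam'' (Div (Mul (V ''e4'') (V ''e4'')) (Const 300)))
     (Seq (Assign ''theta'' (Mul (Mul (Const 2) (V ''gam'')) (V ''N2'')))
     (Assign ''go'' (Const 1)))))"
  let ?fillA = "For ''i'' (Const 0) ''N2'' (Write ''A'' (V ''i'') (Sub (Read ''G'' (V ''i'')) (V ''d'')))"
  let ?X = "{''m'', ''N2'', ''acc'', ''k'', ''d''}"
  have tail: "wp ?tail 50 Q s3"
    if a: "agree (?X \<union> {''A'', ''i''}) ?s s3" and A: "\<And>i. i < n * n \<Longrightarrow> s3 ''A'' i = ?s ''G'' i - ?d"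
      and N2: "s3 ''N2'' 0 = real (n * n)"
      and m: "s3 ''m'' 0 = real m" "1 \<le> m" "1 \<le> real m * \<epsilon>" "real m \<le> 1 / \<epsilon> + 1" for s3 m
  proof -
    have eq: "s3 ''eps'' = ?s ''eps''" "s3 ''n'' = ?s ''n''" "s3 ''V'' = ?s ''V''" "s3 ''r'' = ?s ''r''"
      by (rule agreeD[OF a], simp)+
    define e4 where "e4 = \<epsilon> * \<epsilon> * (\<epsilon> * \<epsilon>)"
    have gam: "e4 * e4 / 300 = \<epsilon> ^ 8 / 300" by (simp add: e4_def eval_nat_numeral)
    let ?f = "upd (upd (upd (upd (upd s3 ''e2'' 0 (\<epsilon> * \<epsilon>)) ''e4'' 0 e4) ''gam'' 0 (e4 * e4 / 300))
      ''theta'' 0 (2 * (e4 * e4 / 300) * (real n * real n))) ''go'' 0 1"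
    have AG: "s3 ''A'' (x * n + y) = G x y - ?d" if "x < n" "y < n" for x y
      using that address_less[OF that] by (simp add: A in_G)
    have "(\<Sum>i<n. sq n (\<lambda>j. s3 ''A'' (i * n + j))) = (\<Sum>i<n. sq n (\<lambda>j. G i j - ?d))"
      unfolding sq_def by (intro sum.cong refl) (simp add: AG)
    then have "good (\<epsilon> ^ 8 / 300) n G 0 ?f"
      using initial_energy[OF G n] unfolding good_def
      by (simp add: gam eq in_vars AG residual_def outputs_def power2_eq_square[of "real n"])
    then have "Q ?f" by (rule Q[OF _ _ m(2-4)]) (simp_all add: m eq in_vars)
    then show ?thesis
      by (intro wp_Assign_Seq[where ?T2.0 = 40] wp_Assign_Seq[where ?T2.0 = 30] wp_Assign_Seq[where ?T2.0 = 20]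
          wp_Assign_Seq[where ?T2.0 = 5] wp_Assign) (simp_all add: eq in_vars N2 e4_def)
  qed
  have fillA: "wp (Seq ?fillA ?tail) (25 * real (n * n) + 70) Q s2"
    if a: "agree ?X ?s s2" and d: "s2 ''d'' 0 = ?d" and N2: "s2 ''N2'' 0 = real (n * n)"
      and m: "s2 ''m'' 0 = real m" "1 \<le> m" "1 \<le> real m * \<epsilon>" "real m \<le> 1 / \<epsilon> + 1" for s2 m
  proof -
    let ?I = "\<lambda>k s3. agree {''A'', ''i''} s2 s3 \<and> s3 ''i'' 0 = real k \<and>
        (\<forall>i<k. s3 ''A'' i = ?s ''G'' i - ?d)"
    show ?thesis
    proof (rule wp_Seq[where ?T1.0 = "25 * real (n * n) + 20" and ?T2.0 = 50],
        rule wp_For[where a = 0 and n = "n * n" and B = 10 and I = "?I"])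
      fix k s3 assume I: "?I k s3"
      note a3 = conjunct1[OF I]
      have eq: "s3 ''G'' = ?s ''G''" "s3 ''d'' = s2 ''d''"
        using agreeD[OF a3, of "''G''"] agreeD[OF a, of "''G''"] agreeD[OF a3, of "''d''"] by auto
      have "agree {''A'', ''i''} s2 (upd (upd s3 ''A'' k (?s ''G'' k - ?d)) ''i'' 0 (real (Suc k)))"
        using a3 by (intro agree_upd) auto
      then show "wp (Write ''A'' (V ''i'') (Sub (Read ''G'' (V ''i'')) (V ''d''))) 10 (\<lambda>s''. s'' ''i'' 0 = real k \<and>
        ?I (Suc k) (upd s'' ''i'' 0 (real (Suc k)))) s3"
        using I by (intro wp_Write[where k = k]) (auto simp: eq d less_Suc_eq)
    next
      fix s3 assume I: "?I (n * n) s3"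
      note a3 = conjunct1[OF I]
      show "wp ?tail 50 Q s3"
      proof (rule tail)
        show "agree (?X \<union> {''A'', ''i''}) ?s s3" by (rule agree_trans[OF a a3]) auto
      qed (use I N2 m agreeD[OF a3, of "''N2''"] agreeD[OF a3, of "''m''"] in auto)
    next
      fix k s3 assume I: "?I k s3"
      show "s3 ''N2'' 0 = real (n * n)" using agreeD[OF conjunct1[OF I], of "''N2''"] N2 by simp
    qed (auto intro: agree_upd)
  qed
  let ?sum = "SumTo ''acc'' ''k'' ''N2'' (Read ''G'' (V ''k''))"
  let ?rest = "Seq (Assign ''d'' (Div (V ''acc'') (V ''N2''))) (Seq ?fillA ?tail)"
  have sum: "wp (Seq ?sum ?rest) (45 * real (n * n) + 100) Q (upd s1 ''N2'' 0 (real (n * n)))"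
    if a: "agree {''m''} ?s s1"
      and m: "s1 ''m'' 0 = real m" "1 \<le> m" "1 \<le> real m * \<epsilon>" "real m \<le> 1 / \<epsilon> + 1" for s1 m
  proof (rule wp_Seq[where ?T1.0 = "20 * real (n * n) + 15" and ?T2.0 = "25 * real (n * n) + 80"],
      rule wp_SumTo[where n = "n * n" and g = "?s ''G''"])
    let ?s1 = "upd s1 ''N2'' 0 (real (n * n))"
    have a1: "agree {''m'', ''N2''} ?s ?s1"
      by (rule agree_upd) (use agree_trans[OF a agree_refl[of "{}"], of "{''m'', ''N2''}"] in auto)
    fix s2 assume 2: "agree {''acc'', ''k''} ?s1 s2" "s2 ''acc'' 0 = (\<Sum>i<n * n. ?s ''G'' i)"
    have "agree {''m'', ''N2'', ''acc'', ''k''} ?s s2" by (rule agree_trans[OF a1 2(1)]) auto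
    then have a2: "agree ?X ?s (upd s2 ''d'' 0 ?d)"
      by (intro agree_upd) (auto simp: agree_def)
    have N2: "s2 ''N2'' 0 = real (n * n)" "s2 ''m'' 0 = real m"
      using agreeD[OF 2(1), of "''N2''"] agreeD[OF 2(1), of "''m''"] m by auto
    have d: "val (Div (V ''acc'') (V ''N2'')) s2 = ?d" using sumG by (simp add: 2 N2)
    show "wp ?rest (25 * real (n * n) + 80) Q s2"
    proof (rule wp_Assign_Seq[where ?T2.0 = "25 * real (n * n) + 70"], goal_cases)
      case 2
      show ?case unfolding d by (rule fillA[OF a2]) (use N2 m in auto)
    qed (use N2 n in auto)
  next
    fix i s2 assume 2: "i < n * n" "agree {''acc'', ''k''} (upd s1 ''N2'' 0 (real (n * n))) s2" "s2 ''k'' 0 = real i"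
    have "s2 ''G'' = ?s ''G''" using agreeD[OF 2(2), of "''G''"] agreeD[OF a, of "''G''"] by simp
    then show "defined (Read ''G'' (V ''k'')) s2 \<and> val (Read ''G'' (V ''k'')) s2 = ?s ''G'' i"
      by (simp add: 2)
  qed auto
  let ?loop = "While (Less (Mul (V ''m'') (V ''eps'')) (Const 1)) (Assign ''m'' (Add (V ''m'') (Const 1)))"
  let ?body = "Seq (Assign ''N2'' (Mul (V ''n'') (V ''n''))) (Seq ?sum ?rest)"
  have "wp (Seq ?loop ?body) (14 / \<epsilon> + 45 * real (n * n) + 120) Q (upd ?s ''m'' 0 1)"
  proof (rule wp_Seq[where ?T1.0 = "14 / \<epsilon> + 8" and ?T2.0 = "45 * real (n * n) + 110"],
      rule wp_ceiling[where \<epsilon> = \<epsilon>])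
    fix s1 m assume 1: "agree {''m''} (upd ?s ''m'' 0 1) s1" "s1 ''m'' 0 = real m" "1 \<le> m" "1 \<le> real m * \<epsilon>"
      "real m \<le> 1 / \<epsilon> + 1"
    have 0: "agree {''m''} ?s (upd ?s ''m'' 0 1)" by (intro agree_upd agree_refl) auto
    have a1: "agree {''m''} ?s s1" by (rule agree_trans[OF 0 1(1)]) auto
    show "wp ?body (45 * real (n * n) + 110) Q s1"
      by (rule wp_Assign_Seq[where ?T2.0 = "45 * real (n * n) + 100"])
         (use sum[OF a1 1(2-5)] agreeD[OF a1, of "''n''"] in_vars in auto)
  qed (use in_vars \<epsilon> in auto)
  moreover have "14 / \<epsilon> + 45 * real (n * n) + 123 \<le> 14 / \<epsilon> + 200 * (real n)\<^sup>2"
    using le_square_bounds[OF n] by (simp add: power2_eq_square)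
  ultimately show ?thesis unfolding Init_def
    by (intro wp_Assign_Seq[where ?T2.0 = "14 / \<epsilon> + 45 * real (n * n) + 120"]) simp_all
qed

section \<open>The number of rounds and the total time\<close>

definition Regularize :: program where
  "Regularize = Seq Init (While (Less (Const 0) (V ''go'')) Round)"

text \<open>The remaining energy is nonnegative, which limits how often
  \<open>4 \<gamma>^2 n^2\<close> can be taken from \<open>n^2 / 4\<close>.\<close>

lemma good_rounds:
  assumes "good \<gamma> n G r s" "0 < \<gamma>" "1 \<le> n"
  shows "real r \<le> 1 / (16 * \<gamma>\<^sup>2)"
proof -
  have "0 \<le> (\<Sum>i<n. sq n (Amat n s i))" by (intro sum_nonneg sq_nonneg)
  also have "\<dots> \<le> (real n)\<^sup>2 / 4 - 4 * real r * \<gamma>\<^sup>2 * (real n)\<^sup>2" using assms(1) by (simp add: good_def)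
  also have "\<dots> = (1 / 4 - 4 * real r * \<gamma>\<^sup>2) * (real n)\<^sup>2" by (simp add: algebra_simps)
  finally have "0 \<le> 1 / 4 - 4 * real r * \<gamma>\<^sup>2" using assms(3) by (simp add: zero_le_mult_iff)
  then show ?thesis using assms(2) by (simp add: field_simps)
qed

lemma wp_Regularize:
  assumes G: "graph {..<n} G" and n: "1 \<le> n" and \<epsilon>: "0 < \<epsilon>" and \<gamma>: "\<gamma> = \<epsilon> ^ 8 / 300"
    and x: "x = max 1 (1 / \<epsilon>)"
    and Q: "\<And>s r. good \<gamma> n G r s \<Longrightarrow> small_cut n \<epsilon> s \<Longrightarrow> Q s"
  shows "wp Regularize (40000000000000 * x ^ 20 * (real n)\<^sup>2) Q (input_state \<epsilon> n G)"
proof -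
  have g0: "0 < \<gamma>" unfolding \<gamma> using \<epsilon> by simp
  define R where "R = 1 / (16 * \<gamma>\<^sup>2)"
  \<comment> \<open>The time of one round: \<open>m \<le> 2 * x\<close> turns
    \<open>160000000 m^4\<close> into \<open>16 * 160000000 x^4\<close>.\<close>
  define D where "D = 2560000000 * x ^ 4 * (real n)\<^sup>2"
  have x1: "1 \<le> x" and xe: "1 / \<epsilon> \<le> x" by (auto simp: x)
  have n2: "1 \<le> (real n)\<^sup>2" using le_square_bounds[OF n] by simp
  have xp: "1 \<le> x ^ k" for k using x1 by simp
  have "1 * 1 \<le> x ^ 4 * (real n)\<^sup>2" by (intro mult_mono xp n2) auto
  then have D: "2560000000 \<le> D" by (simp add: D_def)
  have R0: "0 \<le> R" by (simp add: R_def)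
  have R: "R \<le> 5625 * x ^ 16"
  proof -
    have "(\<epsilon> ^ 8)\<^sup>2 = \<epsilon> ^ 16" by (simp flip: power_mult)
    then have "R = 5625 * (1 / \<epsilon>) ^ 16" by (simp add: R_def \<gamma> power_divide)
    also have "\<dots> \<le> 5625 * x ^ 16" using xe \<epsilon> by (intro mult_left_mono power_mono) auto
    finally show ?thesis .
  qed
  have loop: "wp (While (Less (Const 0) (V ''go'')) Round) ((R + 1) * (D + 5) + 5) Q s"
    if s: "good \<gamma> n G 0 s" "s ''m'' 0 = real m" "1 \<le> m" "1 \<le> real m * \<epsilon>" "real m \<le> 1 / \<epsilon> + 1"
      "\<And>i. s ''V'' i = 0" "s ''go'' 0 = 1" for s m
  proof -
    let ?I = "\<lambda>s r. good \<gamma> n G r s \<and> s ''m'' 0 = real m \<and> (\<forall>i\<ge>n. s ''V'' i = 0) \<and>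
      (s ''go'' 0 = 1 \<or> s ''go'' 0 = 0 \<and> small_cut n \<epsilon> s)"
    \<comment> \<open>Every round but the last raises \<open>r\<close>; the summand 1 next to
      \<open>R\<close> pays for the last one. The factor \<open>go\<close> lets the potential fall
      to 5, the cost of the failing test, once the search has ended.\<close>
    let ?\<tau> = "\<lambda>s. s ''go'' 0 * (R + 1 - s ''r'' 0) * (D + 5) + 5 :: real"
    have mD: "160000000 * real m ^ 4 * (real n)\<^sup>2 \<le> D"
    proof -
      have "real m \<le> 2 * x" using s(5) x1 xe by linarith
      then have "real m ^ 4 \<le> (2 * x) ^ 4" by (intro power_mono) auto
      then have "160000000 * real m ^ 4 * (real n)\<^sup>2 \<le> 160000000 * (2 * x) ^ 4 * (real n)\<^sup>2"
        by (intro mult_right_mono mult_left_mono) auto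
      also have "\<dots> = D" by (simp add: D_def power_mult_distrib)
      finally show ?thesis .
    qed
    have rR: "s' ''r'' 0 = real r" "real r \<le> R" if "good \<gamma> n G r s'" for r s'
      using that good_rounds[OF that g0 n] by (auto simp: good_def outputs_def R_def)
    show ?thesis
    proof (rule wp_While[where I = "\<lambda>s. \<exists>r. ?I s r" and \<tau> = ?\<tau> and T = "\<lambda>_. D"])
      show "\<exists>r. ?I s r" using s by blast
      show "?\<tau> s \<le> (R + 1) * (D + 5) + 5" using s rR[OF s(1)] by simp
    next
      fix s' assume "\<exists>r. ?I s' r"
      then obtain r where I: "?I s' r" by blast
      have r: "s' ''r'' 0 = real r" "real r \<le> R" using rR[OF conjunct1[OF I]] by simp_all
      have "0 \<le> s' ''go'' 0 * (R + 1 - s' ''r'' 0) * (D + 5)"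
      proof (intro mult_nonneg_nonneg)
        show "0 \<le> s' ''go'' 0" using I by linarith
      qed (use r D in auto)
      then show "test_defined (Less (Const 0) (V ''go'')) s' \<and>
          real (1 + test_cost (Less (Const 0) (V ''go''))) \<le> ?\<tau> s'"
        by simp
      show "Q s'" if "\<not> test_val (Less (Const 0) (V ''go'')) s'"
      proof -
        have "s' ''go'' 0 \<noteq> 1" using that by simp
        then show ?thesis using I by (intro Q) blast+
      qed
      show "wp Round D (\<lambda>s''. (\<exists>r. ?I s'' r) \<and>
          real (1 + test_cost (Less (Const 0) (V ''go''))) + D + ?\<tau> s'' \<le> ?\<tau> s') s'"
        if "test_val (Less (Const 0) (V ''go'')) s'"
      proof (rule wp_mono[OF _ mD])
        have "s' ''go'' 0 \<noteq> 0" using that by simp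
        then have go: "s' ''go'' 0 = 1" using I by blast
        show "wp Round (160000000 * real m ^ 4 * (real n)\<^sup>2) (\<lambda>s''. (\<exists>r. ?I s'' r) \<and>
          real (1 + test_cost (Less (Const 0) (V ''go''))) + D + ?\<tau> s'' \<le> ?\<tau> s') s'"
        proof (rule wp_Round[where r = r and m = m and \<gamma> = \<gamma> and \<epsilon> = \<epsilon> and G = G])
          fix s'' r'' assume *: "good \<gamma> n G r'' s''" "s'' ''m'' 0 = real m" "\<And>i. n \<le> i \<Longrightarrow> s'' ''V'' i = 0"
            "s'' ''go'' 0 = 1 \<and> r < r'' \<or> s'' ''go'' 0 = 0 \<and> r'' = r \<and> small_cut n \<epsilon> s''"
          note r'' = rR[OF *(1)]
          have le: "5 + D + ?\<tau> s'' \<le> ?\<tau> s'"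
          proof (cases "s'' ''go'' 0 = 1")
            case True
            then have "real r + 1 \<le> real r''" using *(4) by linarith
            then have "(R + 1 - real r'' + 1) * (D + 5) \<le> (R + 1 - real r) * (D + 5)"
              using D by (intro mult_right_mono) auto
            moreover have "(R + 1 - real r'' + 1) * (D + 5) = (R + 1 - real r'') * (D + 5) + (D + 5)"
              by (simp only: distrib_right mult_1_left)
            ultimately show ?thesis unfolding True go r(1) r''(1) by linarith
          next
            case False
            then have "s'' ''go'' 0 = 0" using *(4) by auto
            moreover have "1 * (D + 5) \<le> (R + 1 - real r) * (D + 5)"
              using D r by (intro mult_right_mono) auto
            ultimately show ?thesis using go r by simp
          qed
          have c: "real (1 + test_cost (Less (Const 0) (V ''go''))) = 5" by simp
          have I'': "?I s'' r''" using * by blast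
          show "(\<exists>r. ?I s'' r) \<and>
            real (1 + test_cost (Less (Const 0) (V ''go''))) + D + ?\<tau> s'' \<le> ?\<tau> s'"
            unfolding c by (rule conjI[OF exI[of _ r''] le]) (rule I'')
        qed (use I G n \<epsilon> \<gamma> s in blast)+
      qed
    qed
  qed
  have "wp Regularize ((14 / \<epsilon> + 200 * (real n)\<^sup>2) + ((R + 1) * (D + 5) + 5)) Q (input_state \<epsilon> n G)"
    unfolding Regularize_def
  proof (rule wp_Seq[OF _ order_refl], rule wp_Init[OF \<epsilon> n G])
    fix s m
    assume "good (\<epsilon> ^ 8 / 300) n G 0 s" "s ''m'' 0 = real m" "1 \<le> m" "1 \<le> real m * \<epsilon>"
      "real m \<le> 1 / \<epsilon> + 1" "\<And>i. s ''V'' i = 0" "s ''go'' 0 = 1"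
    then show "wp (While (Less (Const 0) (V ''go'')) Round) ((R + 1) * (D + 5) + 5) Q s"
      by (intro loop) (auto simp: \<gamma>)
  qed
  moreover have "(14 / \<epsilon> + 200 * (real n)\<^sup>2) + ((R + 1) * (D + 5) + 5) \<le> 40000000000000 * x ^ 20 * (real n)\<^sup>2"
  proof -
    \<comment> \<open>The exponent is 16 for the number of rounds plus 4 for the cost of
      each.\<close>
    let ?M = "x ^ 20 * (real n)\<^sup>2"
    have "x ^ 1 \<le> x ^ 20" using x1 by (intro power_increasing) auto
    then have "x * 1 \<le> x ^ 20 * (real n)\<^sup>2" using n2 x1 by (intro mult_mono) auto
    then have "14 / \<epsilon> \<le> 14 * ?M" using xe by simp
    moreover have M: "1 * (real n)\<^sup>2 \<le> ?M" by (intro mult_right_mono xp) auto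
    moreover have "(R + 1) * (D + 5) \<le> (5626 * x ^ 16) * (2 * D)"
      using R xp[of 16] D R0 by (intro mult_mono) auto
    moreover have "(5626 * x ^ 16) * (2 * D) = 28805120000000 / 1 * ?M"
      unfolding D_def by (simp add: power_add[symmetric] mult_ac)
    ultimately show ?thesis using n2 by simp
  qed
  ultimately show ?thesis by (rule wp_mono)
qed

lemma cut_dist_le:
  assumes "graph {..<n} G" "1 \<le> n"
    and A: "\<And>x y. x < n \<Longrightarrow> y < n \<Longrightarrow> A x y = G x y - H x y"
    and small: "\<And>U Z. U \<subseteq> {..<n} \<Longrightarrow> Z \<subseteq> {..<n} \<Longrightarrow> \<bar>edge_weight A U Z\<bar> \<le> \<epsilon> * (real n)\<^sup>2"
  shows "cut_dist {..<n} G H \<le> \<epsilon>"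
proof -
  have "\<bar>edge_weight G U Z - edge_weight H U Z\<bar> / (real n)\<^sup>2 \<le> \<epsilon>" if "U \<subseteq> {..<n}" "Z \<subseteq> {..<n}" for U Z
  proof -
    have "edge_weight A U Z = edge_weight G U Z - edge_weight H U Z"
      unfolding edge_weight_def sum_subtractf[symmetric] using that by (intro sum.cong refl A) auto
    then show ?thesis using small[OF that] \<open>1 \<le> n\<close> by (simp add: divide_le_eq)
  qed
  then show ?thesis unfolding cut_dist_def by (subst Max_le_iff) (auto intro: finite_cartesian_product)
qed

theorem theorem1p3:
  "\<exists>(p :: program) (K :: nat) (C :: nat).
     \<forall>(\<epsilon> :: real) (n :: nat) (G :: nat wgraph).
       \<epsilon> > 0 \<longrightarrow> n \<ge> 1 \<longrightarrow> graph {..<n} G \<longrightarrow>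
       (\<exists>(t :: nat) (s :: state) (r :: nat)
          (S :: nat \<Rightarrow> nat set) (T :: nat \<Rightarrow> nat set) (c :: nat \<Rightarrow> real).
          run p (input_state \<epsilon> n G) t s \<and>
          real t \<le> real K * max 1 (1 / \<epsilon>) ^ K * (real n)\<^sup>2 \<and>
          outputs s n r S T c \<and>
          real r \<le> real C * (1 / \<epsilon>) ^ 16 \<and>
          (\<forall>i<r. S i \<subseteq> {..<n} \<and> T i \<subseteq> {..<n} \<and> c i \<in> {- (\<epsilon> ^ 8 / 300), \<epsilon> ^ 8 / 300}) \<and>
          cut_dist {..<n} G
            (\<lambda>x y. edge_density {..<n} G + (\<Sum>i<r. c i * K_graph (S i) (T i) x y)) \<le> \<epsilon>)"
proof -
  \<comment> \<open>One number serves as factor and as exponent, and the factor dictates it. Since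
    \<open>max 1 (1 / \<epsilon>) \<ge> 1\<close>, the oversized exponent only weakens the
    bound.\<close>
  obtain K :: nat where K: "20 \<le> K" "real K = 40000000000000"
    by (rule that[of 40000000000000]) simp_all
  show ?thesis
  proof (rule exI[of _ Regularize], rule exI[of _ K], rule exI[of _ 5625], intro allI impI)
    fix \<epsilon> :: real and n :: nat and G :: "nat wgraph"
    assume \<epsilon>: "0 < \<epsilon>" and n: "1 \<le> n" and G: "graph {..<n} G"
    define x where "x = max 1 (1 / \<epsilon>)"
    define \<gamma> where "\<gamma> = \<epsilon> ^ 8 / 300"
    have g0: "0 < \<gamma>" unfolding \<gamma>_def using \<epsilon> by simp
    have "wp Regularize (40000000000000 * x ^ 20 * (real n)\<^sup>2)
        (\<lambda>s. \<exists>r. good \<gamma> n G r s \<and> small_cut n \<epsilon> s) (input_state \<epsilon> n G)"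
      by (rule wp_Regularize[OF G n \<epsilon> \<gamma>_def x_def]) blast
    then obtain t s r where run: "run Regularize (input_state \<epsilon> n G) t s"
      and t: "real t \<le> 40000000000000 * x ^ 20 * (real n)\<^sup>2"
      and g: "good \<gamma> n G r s" and cut: "small_cut n \<epsilon> s"
      unfolding wp_def by blast
    obtain S T c where out: "outputs s n r S T c"
      and sets: "\<forall>i<r. S i \<subseteq> {..<n} \<and> T i \<subseteq> {..<n} \<and> c i \<in> {- \<gamma>, \<gamma>}"
      and res: "\<forall>x<n. \<forall>y<n. Amat n s x y = residual n G S T c r x y"
      using g unfolding good_def by blast
    have "x ^ 20 \<le> x ^ K" using K(1) by (intro power_increasing) (auto simp: x_def)
    then have "40000000000000 * x ^ 20 * (real n)\<^sup>2 \<le> real K * x ^ K * (real n)\<^sup>2"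
      unfolding K(2) by (intro mult_right_mono mult_left_mono) auto
    then have time: "real t \<le> real K * max 1 (1 / \<epsilon>) ^ K * (real n)\<^sup>2" using t unfolding x_def by linarith
    \<comment> \<open>With \<open>\<gamma> = \<epsilon>^8 / 300\<close> the constant is
      \<open>300^2 / 16 = 5625\<close>.\<close>
    have "1 / (16 * \<gamma>\<^sup>2) = 5625 * (1 / \<epsilon>) ^ 16"
    proof -
      have "(\<epsilon> ^ 8)\<^sup>2 = \<epsilon> ^ 16" by (simp flip: power_mult)
      then show ?thesis by (simp add: \<gamma>_def power_divide)
    qed
    then have r: "real r \<le> real 5625 * (1 / \<epsilon>) ^ 16" using good_rounds[OF g g0 n] by simp
    have cd: "cut_dist {..<n} G
        (\<lambda>x y. edge_density {..<n} G + (\<Sum>i<r. c i * K_graph (S i) (T i) x y)) \<le> \<epsilon>"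
      by (rule cut_dist_le[OF G n, where A = "Amat n s"]) (use res cut in \<open>simp_all add: residual_def\<close>)
    show "\<exists>t s r S T c.
          run Regularize (input_state \<epsilon> n G) t s \<and>
          real t \<le> real K * max 1 (1 / \<epsilon>) ^ K * (real n)\<^sup>2 \<and>
          outputs s n r S T c \<and>
          real r \<le> real 5625 * (1 / \<epsilon>) ^ 16 \<and>
          (\<forall>i<r. S i \<subseteq> {..<n} \<and> T i \<subseteq> {..<n} \<and> c i \<in> {- (\<epsilon> ^ 8 / 300), \<epsilon> ^ 8 / 300}) \<and>
          cut_dist {..<n} G
            (\<lambda>x y. edge_density {..<n} G + (\<Sum>i<r. c i * K_graph (S i) (T i) x y)) \<le> \<epsilon>"
      using run time out r sets[unfolded \<gamma>_def] cd by blast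
  qed
qed

end
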